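(* Assume the standing hypotheses with $p>2$. Let $\lambda>\underline{\lambda}_1$, let $m_0$ and $\delta>0$ be as in Theorem 2.1, and for $m\ge m_0$ let $u_m\ge0$ be global minimum points of $J_m$ with $J_m(u_m)\le-\delta$ (so they are positive solutions of (P$_m$)). Then there exist $u\in H^1_0(\Omega)\cap L^\infty(\Omega)$, $u\not\equiv0$, and a subsequence along which $u_m\rightharpoonup u$ weakly in $H^1_0(\Omega)$ and strongly in $L^q(\Omega)$ for every $q\in[1,\infty)$, such that $u\in\mathcal K$ and \[ \int_\Omega M(x)\nabla u\cdot\nabla(v-u)\ge\lambda\int_\Omega u^{p-1}(v-u)\quad\forall v\in\mathcal K. \] Moreover there exists $g_u\in L^\infty(\Omega)$ with $0\le g_u\le\lambda$, $g_u\not\equiv0$, $g_u(x)(1-u(x))=0$ a.e. in $\Omega$ (in particular $|\{u=1\}|>0$), and \[ \int_\Omega M(x)\nabla u\cdot\nabla\varphi+\int_\Omega g_u\varphi=\lambda\int_\Omega u^{p-1}\varphi\quad\forall\varphi\in H^1_0(\Omega). \]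
   Context: $\Omega\subset\mathbb{R}^N$ bounded domain; $M(x)$ symmetric, bounded, with $\alpha|\xi|^2\le M(x)\xi\cdot\xi\le\beta|\xi|^2$, $0<\alpha<\beta$. $X_m=H^1_0(\Omega)\cap L^m(\Omega)$. Problem (P$_m$): $-\mathrm{div}(M\nabla u)+u^{m-1}=\lambda u^{p-1}$ in $\Omega$, $u=0$ on $\partial\Omega$ (weak solutions in $X_m$). $J_m(v)=\frac12\int_\Omega M\nabla v\cdot\nabla v+\frac1m\|v\|_m^m-\frac\lambda p\|v^+\|_p^p$. $\underline{\lambda}_1=\inf_{\psi\in H^1_0\cap L^\infty,\psi\ne0}\frac{p\beta}{2}\|\nabla\psi\|_2^2\|\psi\|_\infty^{p-2}/\|\psi\|_p^p$. Theorem 2.1 states: for $\lambda>\underline\lambda_1$ there are $m_0>2^*$ and $\delta>0$ such that for all $m\ge m_0$, $J_m$ has a nonnegative nontrivial global minimizer $u_m$ with $J_m(u_m)\le-\delta$. $\mathcal K:=\{v\in H^1_0(\Omega):0\le v(x)\le1\text{ a.e.}\}$. *)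

theory Defs
  imports "HOL-Analysis.Analysis"
begin

definition pd :: "'n::finite \<Rightarrow> ((real^'n) \<Rightarrow> real) \<Rightarrow> (real^'n) \<Rightarrow> real" where
  "pd i f x = frechet_derivative f (at x) (axis i 1)"

fun iter_pd :: "'n::finite list \<Rightarrow> ((real^'n) \<Rightarrow> real) \<Rightarrow> (real^'n) \<Rightarrow> real" where
  "iter_pd [] f = f"
| "iter_pd (i # is) f = pd i (iter_pd is f)"

definition smooth_fun :: "((real^'n::finite) \<Rightarrow> real) \<Rightarrow> bool" where
  "smooth_fun f \<longleftrightarrow> (\<forall>is x. iter_pd is f differentiable (at x))"

definition cgrad :: "((real^'n::finite) \<Rightarrow> real) \<Rightarrow> (real^'n) \<Rightarrow> real^'n" where
  "cgrad f x = (\<chi> i. pd i f x)"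

definition test_fun :: "(real^'n::finite) set \<Rightarrow> ((real^'n) \<Rightarrow> real) \<Rightarrow> bool" where
  "test_fun \<Omega> \<phi> \<longleftrightarrow> smooth_fun \<phi> \<and> compact (closure {x. \<phi> x \<noteq> 0})
      \<and> closure {x. \<phi> x \<noteq> 0} \<subseteq> \<Omega>"

text \<open>H^1_0(Omega) as the closure of C_c^infinity(Omega) in the H^1 norm:
  H10_grad Omega u G means u is in H^1_0(Omega) with weak gradient G.\<close>
definition H10_grad :: "(real^'n::finite) set \<Rightarrow> ((real^'n) \<Rightarrow> real) \<Rightarrow> ((real^'n) \<Rightarrow> real^'n) \<Rightarrow> bool" where
  "H10_grad \<Omega> u G \<longleftrightarrow> set_borel_measurable lebesgue \<Omega> u \<and> set_borel_measurable lebesgue \<Omega> G \<and>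
     (\<exists>\<phi>::nat \<Rightarrow> (real^'n) \<Rightarrow> real. (\<forall>k. test_fun \<Omega> (\<phi> k)) \<and>
        ((\<lambda>k. \<integral>\<^sup>+x\<in>\<Omega>. ennreal ((\<phi> k x - u x)\<^sup>2) \<partial>lebesgue) \<longlonglongrightarrow> 0) \<and>
        ((\<lambda>k. \<integral>\<^sup>+x\<in>\<Omega>. ennreal ((norm (cgrad (\<phi> k) x - G x))\<^sup>2) \<partial>lebesgue) \<longlonglongrightarrow> 0))"

definition H10 :: "(real^'n::finite) set \<Rightarrow> ((real^'n) \<Rightarrow> real) \<Rightarrow> bool" where
  "H10 \<Omega> u \<longleftrightarrow> (\<exists>G. H10_grad \<Omega> u G)"

text \<open>The weak gradient (unique up to null sets).\<close>
definition wgrad :: "(real^'n::finite) set \<Rightarrow> ((real^'n) \<Rightarrow> real) \<Rightarrow> (real^'n) \<Rightarrow> real^'n" where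
  "wgrad \<Omega> u = (SOME G. H10_grad \<Omega> u G)"

definition Lp :: "(real^'n::finite) set \<Rightarrow> real \<Rightarrow> ((real^'n) \<Rightarrow> real) \<Rightarrow> bool" where
  "Lp \<Omega> q u \<longleftrightarrow> set_borel_measurable lebesgue \<Omega> u \<and>
     (\<integral>\<^sup>+x\<in>\<Omega>. ennreal (\<bar>u x\<bar> powr q) \<partial>lebesgue) < \<infinity>"

definition Linf :: "(real^'n::finite) set \<Rightarrow> ((real^'n) \<Rightarrow> real) \<Rightarrow> bool" where
  "Linf \<Omega> u \<longleftrightarrow> set_borel_measurable lebesgue \<Omega> u \<and>
     (\<exists>C. AE x\<in>\<Omega> in lebesgue. \<bar>u x\<bar> \<le> C)"

definition Linf_norm :: "(real^'n::finite) set \<Rightarrow> ((real^'n) \<Rightarrow> real) \<Rightarrow> real" where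
  "Linf_norm \<Omega> u = Inf {C. 0 \<le> C \<and> (AE x\<in>\<Omega> in lebesgue. \<bar>u x\<bar> \<le> C)}"

definition pnorm_pow :: "(real^'n::finite) set \<Rightarrow> real \<Rightarrow> ((real^'n) \<Rightarrow> real) \<Rightarrow> real" where
  "pnorm_pow \<Omega> q u = (\<integral>x\<in>\<Omega>. \<bar>u x\<bar> powr q \<partial>lebesgue)"

definition ae_zero :: "(real^'n::finite) set \<Rightarrow> ((real^'n) \<Rightarrow> real) \<Rightarrow> bool" where
  "ae_zero \<Omega> u \<longleftrightarrow> (AE x\<in>\<Omega> in lebesgue. u x = 0)"

definition elliptic_matrix :: "(real^'n::finite) set \<Rightarrow> ((real^'n) \<Rightarrow> real^'n^'n) \<Rightarrow> real \<Rightarrow> real \<Rightarrow> bool" where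
  "elliptic_matrix \<Omega> M \<alpha> \<beta> \<longleftrightarrow> 0 < \<alpha> \<and> \<alpha> < \<beta> \<and>
     (\<forall>i j. set_borel_measurable lebesgue \<Omega> (\<lambda>x. M x $ i $ j)) \<and>
     (\<exists>C. \<forall>x\<in>\<Omega>. \<forall>i j. \<bar>M x $ i $ j\<bar> \<le> C) \<and>
     (\<forall>x\<in>\<Omega>. transpose (M x) = M x) \<and>
     (\<forall>x\<in>\<Omega>. \<forall>\<xi>. \<alpha> * (norm \<xi>)\<^sup>2 \<le> (M x *v \<xi>) \<bullet> \<xi> \<and> (M x *v \<xi>) \<bullet> \<xi> \<le> \<beta> * (norm \<xi>)\<^sup>2)"

definition aform :: "(real^'n::finite) set \<Rightarrow> ((real^'n) \<Rightarrow> real^'n^'n) \<Rightarrow> ((real^'n) \<Rightarrow> real) \<Rightarrow> ((real^'n) \<Rightarrow> real) \<Rightarrow> real" where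
  "aform \<Omega> M u v = (\<integral>x\<in>\<Omega>. (M x *v wgrad \<Omega> u x) \<bullet> wgrad \<Omega> v x \<partial>lebesgue)"

definition Xm :: "(real^'n::finite) set \<Rightarrow> real \<Rightarrow> ((real^'n) \<Rightarrow> real) \<Rightarrow> bool" where
  "Xm \<Omega> m v \<longleftrightarrow> H10 \<Omega> v \<and> Lp \<Omega> m v"

definition Jm :: "(real^'n::finite) set \<Rightarrow> ((real^'n) \<Rightarrow> real^'n^'n) \<Rightarrow> real \<Rightarrow> real \<Rightarrow> real
                  \<Rightarrow> ((real^'n) \<Rightarrow> real) \<Rightarrow> real" where
  "Jm \<Omega> M lam p m v = 1/2 * aform \<Omega> M v v + 1/m * pnorm_pow \<Omega> m v
      - lam/p * pnorm_pow \<Omega> p (\<lambda>x. max (v x) 0)"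

definition lambda1 :: "(real^'n::finite) set \<Rightarrow> real \<Rightarrow> real \<Rightarrow> real" where
  "lambda1 \<Omega> \<beta> p = Inf {p * \<beta> / 2 * (\<integral>x\<in>\<Omega>. (norm (wgrad \<Omega> \<psi> x))\<^sup>2 \<partial>lebesgue)
        * Linf_norm \<Omega> \<psi> powr (p - 2) / pnorm_pow \<Omega> p \<psi>
      | \<psi>. H10 \<Omega> \<psi> \<and> Linf \<Omega> \<psi> \<and> \<not> ae_zero \<Omega> \<psi>}"

definition Kset :: "(real^'n::finite) set \<Rightarrow> ((real^'n) \<Rightarrow> real) \<Rightarrow> bool" where
  "Kset \<Omega> v \<longleftrightarrow> H10 \<Omega> v \<and> (AE x\<in>\<Omega> in lebesgue. 0 \<le> v x \<and> v x \<le> 1)"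

text \<open>Weak convergence in the Hilbert space H^1_0 (inner product int uv + grad u . grad v),
  tested against every element of H^1_0 (Riesz representation).\<close>
definition H10_weak_conv :: "(real^'n::finite) set \<Rightarrow> (nat \<Rightarrow> (real^'n) \<Rightarrow> real) \<Rightarrow> ((real^'n) \<Rightarrow> real) \<Rightarrow> bool" where
  "H10_weak_conv \<Omega> w u \<longleftrightarrow> (\<forall>k. H10 \<Omega> (w k)) \<and> H10 \<Omega> u \<and>
     (\<forall>v. H10 \<Omega> v \<longrightarrow>
        (\<lambda>k. \<integral>x\<in>\<Omega>. w k x * v x + wgrad \<Omega> (w k) x \<bullet> wgrad \<Omega> v x \<partial>lebesgue)
          \<longlonglongrightarrow> (\<integral>x\<in>\<Omega>. u x * v x + wgrad \<Omega> u x \<bullet> wgrad \<Omega> v x \<partial>lebesgue))"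

definition Lq_conv :: "(real^'n::finite) set \<Rightarrow> real \<Rightarrow> (nat \<Rightarrow> (real^'n) \<Rightarrow> real) \<Rightarrow> ((real^'n) \<Rightarrow> real) \<Rightarrow> bool" where
  "Lq_conv \<Omega> q w u \<longleftrightarrow> (\<forall>k. Lp \<Omega> q (w k)) \<and> Lp \<Omega> q u \<and>
     ((\<lambda>k. \<integral>x\<in>\<Omega>. \<bar>w k x - u x\<bar> powr q \<partial>lebesgue) \<longlonglongrightarrow> 0)"

end

(*
  A minimizer u_m is bounded by T_m = lam^(1/(m-p)), because truncating at T_m does not increase the
  gradient term and lowers the remaining energy; T_m tends to 1 and T_m^(m-1) to lam. The equations
  satisfied by u_m and u_k, subtracted and tested with u_m - u_k, turn the L2 compactness
  of the sequence (Rellich) into strong convergence in H^1_0. The bounded penalty terms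
  u_m^(m-1) have convex combinations converging in L2 to a multiplier g with 0 <= g <= lam, and g
  vanishes where the limit w is below 1. The variational inequality follows from the equation
  with g, since g (v - w) = g (v - 1) <= 0 for v in K. If g were 0, testing with w would give
  energy (1/2 - 1/p) lam int w^p >= 0 in the limit, against J(u_m) <= -delta.
*)
theory Submission
  imports Defs "HOL-Library.Diagonal_Subsequence"
begin

text \<open>\<open>H10\<close> is a closure of test functions and \<open>wgrad\<close> a choice
  among the admissible gradients, so uniqueness of the gradient, the chain rule, closedness and
  compactness are all read off approximating sequences. Truncation by a minimum is not smooth, hence
  it is smoothed and applied to the test functions first. Compactness comes from averages over
  lattice cells: at a fixed mesh a function has only countably many of them, so a diagonal argument
  applies, and the gradient bound makes the error small uniformly along the sequence. The bound by
  T_m is used three times: it dominates the difference quotients behind the equation, it bounds the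
  reaction terms in L2, and it puts the limit below 1. Where the limit equals 1, a base near 1 meets
  an exponent tending to infinity and no pointwise limit of u_m^(m-1) is available. Averages are
  enough, because the equation is linear in the penalty, its bounds are convex conditions, and
  complementarity is a single linear pairing with 1 - w. Strong convergence of the gradients is what
  carries the quadratic energy to the limit.\<close>

section \<open>Square integrable functions over a measure\<close>

definition L2 :: "'a measure \<Rightarrow> ('a \<Rightarrow> 'b::euclidean_space) \<Rightarrow> bool" where
  "L2 M f \<longleftrightarrow> f \<in> borel_measurable M \<and> integrable M (\<lambda>x. (norm (f x))\<^sup>2)"

definition ip2 :: "'a measure \<Rightarrow> ('a \<Rightarrow> 'b::euclidean_space) \<Rightarrow> ('a \<Rightarrow> 'b) \<Rightarrow> real" where
  "ip2 M f g = (\<integral>x. f x \<bullet> g x \<partial>M)"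

definition norm2 :: "'a measure \<Rightarrow> ('a \<Rightarrow> 'b::euclidean_space) \<Rightarrow> real" where
  "norm2 M f = sqrt (\<integral>x. (norm (f x))\<^sup>2 \<partial>M)"

lemma L2_measurable: "L2 M f \<Longrightarrow> f \<in> borel_measurable M"
  by (simp add: L2_def)

lemma integrable_inner_L2:
  assumes "L2 M f" "L2 M g"
  shows "integrable M (\<lambda>x. f x \<bullet> g x)"
proof (rule Bochner_Integration.integrable_bound)
  show "integrable M (\<lambda>x. (norm (f x))\<^sup>2 + (norm (g x))\<^sup>2)"
    using assms by (auto simp: L2_def)
  show "(\<lambda>x. f x \<bullet> g x) \<in> borel_measurable M"
    using assms by (auto simp: L2_def)
  have "norm (f x \<bullet> g x) \<le> norm ((norm (f x))\<^sup>2 + (norm (g x))\<^sup>2)" for x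
  proof -
    have "\<bar>f x \<bullet> g x\<bar> \<le> norm (f x) * norm (g x)" by (rule Cauchy_Schwarz_ineq2)
    moreover have "2 * (norm (f x) * norm (g x)) \<le> (norm (f x))\<^sup>2 + (norm (g x))\<^sup>2"
      using sum_squares_bound[of "norm (f x)" "norm (g x)"] by simp
    moreover have "0 \<le> norm (f x) * norm (g x)" by simp
    ultimately show ?thesis by simp
  qed
  then show "AE x in M. norm (f x \<bullet> g x) \<le> norm ((norm (f x))\<^sup>2 + (norm (g x))\<^sup>2)" by simp
qed

lemma L2_dominated:
  assumes g: "L2 M g" and f: "f \<in> borel_measurable M" and le: "AE x in M. norm (f x) \<le> C * norm (g x)"
  shows "L2 M f"
proof -
  have "integrable M (\<lambda>x. (norm (f x))\<^sup>2)"
  proof (rule Bochner_Integration.integrable_bound)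
    show "integrable M (\<lambda>x. C\<^sup>2 * (norm (g x))\<^sup>2)" using g by (simp add: L2_def)
    show "(\<lambda>x. (norm (f x))\<^sup>2) \<in> borel_measurable M" using f by simp
    show "AE x in M. norm ((norm (f x))\<^sup>2) \<le> norm (C\<^sup>2 * (norm (g x))\<^sup>2)"
      using le
    proof eventually_elim
      case (elim x)
      have "(norm (f x))\<^sup>2 \<le> (C * norm (g x))\<^sup>2"
        by (rule power_mono[OF elim]) simp
      then show ?case by (simp add: power_mult_distrib)
    qed
  qed
  then show ?thesis using f by (simp add: L2_def)
qed

lemma L2_cong_AE:
  assumes "L2 M g" "f \<in> borel_measurable M" "AE x in M. f x = g x"
  shows "L2 M f"
  by (rule L2_dominated[OF assms(1,2), of 1]) (use assms(3) in auto)

lemma norm2_cong_AE: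
  assumes "f \<in> borel_measurable M" "g \<in> borel_measurable M" "AE x in M. f x = g x"
  shows "norm2 M f = norm2 M g"
  unfolding norm2_def
  by (rule arg_cong[of _ _ sqrt], rule integral_cong_AE) (use assms in auto)

lemma L2_zero [simp]: "L2 M (\<lambda>x. 0)"
  by (simp add: L2_def)

lemma L2_scaleR [intro]: "L2 M f \<Longrightarrow> L2 M (\<lambda>x. c *\<^sub>R f x)"
  by (auto simp: L2_def power_mult_distrib)

lemma L2_cmult [intro]: "L2 M f \<Longrightarrow> L2 M (\<lambda>x. c * f x :: real)"
  using L2_scaleR[of M f c] by simp

lemma L2_add [intro]:
  assumes "L2 M f" "L2 M g"
  shows "L2 M (\<lambda>x. f x + g x)"
proof -
  have "integrable M (\<lambda>x. (norm (f x))\<^sup>2 + (norm (g x))\<^sup>2 + 2 * (f x \<bullet> g x))"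
    using assms integrable_inner_L2[OF assms] by (auto simp: L2_def)
  moreover have "(norm (f x))\<^sup>2 + (norm (g x))\<^sup>2 + 2 * (f x \<bullet> g x) = (norm (f x + g x))\<^sup>2" for x
    by (simp add: power2_norm_eq_inner inner_add inner_commute)
  ultimately show ?thesis using assms by (auto simp: L2_def)
qed

lemma L2_uminus [intro]: "L2 M f \<Longrightarrow> L2 M (\<lambda>x. - f x)"
  by (auto simp: L2_def)

lemma L2_diff [intro]: "L2 M f \<Longrightarrow> L2 M g \<Longrightarrow> L2 M (\<lambda>x. f x - g x)"
  using L2_add[of M f "\<lambda>x. - g x"] by auto

lemma L2_bounded:
  assumes "finite_measure M" "f \<in> borel_measurable M" "AE x in M. norm (f x) \<le> C"
  shows "L2 M f"
proof -
  have "L2 M (\<lambda>x. 1::real)"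
    using finite_measure.integrable_const[OF assms(1), of "1::real"] by (simp add: L2_def)
  then show ?thesis by (rule L2_dominated[where C=C]) (use assms in auto)
qed

lemma L2_integrable:
  assumes "finite_measure M" "L2 M f"
  shows "integrable M f"
proof -
  have "L2 M (\<lambda>x. 1::real)" by (rule L2_bounded[OF assms(1), of _ 1]) auto
  have "L2 M (\<lambda>x. norm (f x))" using assms(2) by (auto simp: L2_def)
  from integrable_inner_L2[OF this \<open>L2 M (\<lambda>x. 1::real)\<close>]
  have "integrable M (\<lambda>x. norm (f x))" by simp
  then show ?thesis using assms(2) by (simp add: L2_def integrable_norm_iff)
qed

lemma norm2_nonneg [simp]: "0 \<le> norm2 M f"
  by (simp add: norm2_def)

lemma norm2_square: "(norm2 M f)\<^sup>2 = (\<integral>x. (norm (f x))\<^sup>2 \<partial>M)"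
  by (simp add: norm2_def)

lemma norm2_square_eq_ip2: "(norm2 M f)\<^sup>2 = ip2 M f f"
  by (simp add: norm2_square ip2_def power2_norm_eq_inner)

lemma norm2_zero [simp]: "norm2 M (\<lambda>x. 0) = 0"
  by (simp add: norm2_def)

lemma norm2_scaleR: "norm2 M (\<lambda>x. c *\<^sub>R f x) = \<bar>c\<bar> * norm2 M f"
  by (simp add: norm2_def power_mult_distrib real_sqrt_mult)

lemma norm2_minus_commute: "norm2 M (\<lambda>x. f x - g x) = norm2 M (\<lambda>x. g x - f x)"
  by (simp add: norm2_def norm_minus_commute)

lemma ip2_add_left: "L2 M f \<Longrightarrow> L2 M g \<Longrightarrow> L2 M h \<Longrightarrow> ip2 M (\<lambda>x. f x + g x) h = ip2 M f h + ip2 M g h"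
  by (simp add: ip2_def inner_add_left integrable_inner_L2)

lemma ip2_diff_left: "L2 M f \<Longrightarrow> L2 M g \<Longrightarrow> L2 M h \<Longrightarrow> ip2 M (\<lambda>x. f x - g x) h = ip2 M f h - ip2 M g h"
  by (simp add: ip2_def inner_diff_left integrable_inner_L2)

lemma ip2_diff_right: "L2 M f \<Longrightarrow> L2 M g \<Longrightarrow> L2 M h \<Longrightarrow> ip2 M h (\<lambda>x. f x - g x) = ip2 M h f - ip2 M h g"
  by (simp add: ip2_def inner_diff_right integrable_inner_L2)

lemma norm2_add_square:
  assumes "L2 M f" "L2 M g"
  shows "(norm2 M (\<lambda>x. f x + t *\<^sub>R g x))\<^sup>2 = (norm2 M f)\<^sup>2 + 2 * t * ip2 M f g + t\<^sup>2 * (norm2 M g)\<^sup>2"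
proof -
  have "(norm (f x + t *\<^sub>R g x))\<^sup>2 = (norm (f x))\<^sup>2 + 2 * t * (f x \<bullet> g x) + t\<^sup>2 * (norm (g x))\<^sup>2" for x
    by (simp add: power2_norm_eq_inner inner_add inner_commute algebra_simps) (simp add: power2_eq_square algebra_simps)
  then show ?thesis
    using assms integrable_inner_L2[OF assms] by (simp add: norm2_square ip2_def L2_def)
qed

text \<open>The square of the norm of f + t g is a quadratic polynomial in t that never becomes
  negative, so its discriminant is at most 0.\<close>

lemma Cauchy_Schwarz_L2:
  assumes "L2 M f" "L2 M g"
  shows "\<bar>ip2 M f g\<bar> \<le> norm2 M f * norm2 M g"
proof -
  define a b c where "a = (norm2 M f)\<^sup>2" and "b = ip2 M f g" and "c = (norm2 M g)\<^sup>2"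
  have q: "0 \<le> a + 2 * t * b + t\<^sup>2 * c" for t
    using norm2_add_square[OF assms, of t] unfolding a_def b_def c_def
    by (metis zero_le_power2)
  have "b\<^sup>2 \<le> a * c"
  \<comment> \<open>With c = 0 the polynomial is affine in t; a nonzero slope would let it reach -1.
    Otherwise its value at the vertex -b/c gives the inequality.\<close>
  proof (cases "c = 0")
    case True
    have "b = 0"
    proof (rule ccontr)
      assume "b \<noteq> 0"
      then have "a + 2 * (- (a + 1) / (2 * b)) * b = -1" by (simp add: field_simps)
      with q[of "- (a + 1) / (2 * b)"] True show False by simp
    qed
    then show ?thesis using True by simp
  next
    case False
    then have c: "c > 0" by (simp add: c_def)
    have "a + 2 * (- b / c) * b + (- b / c)\<^sup>2 * c = (a * c - b\<^sup>2) / c"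
      using c by (simp add: field_simps power2_eq_square)
    with q[of "- b / c"] c have "0 \<le> a * c - b\<^sup>2" by (simp add: zero_le_divide_iff)
    then show ?thesis by simp
  qed
  then have "b\<^sup>2 \<le> (norm2 M f * norm2 M g)\<^sup>2" by (simp add: a_def c_def power_mult_distrib)
  then have "\<bar>b\<bar> \<le> \<bar>norm2 M f * norm2 M g\<bar>" by (simp only: abs_le_square_iff)
  then show ?thesis by (simp add: b_def)
qed

lemma norm2_triangle:
  assumes "L2 M f" "L2 M g"
  shows "norm2 M (\<lambda>x. f x + g x) \<le> norm2 M f + norm2 M g"
proof (rule power2_le_imp_le)
  have "ip2 M f g \<le> norm2 M f * norm2 M g"
    using Cauchy_Schwarz_L2[OF assms] by linarith
  then show "(norm2 M (\<lambda>x. f x + g x))\<^sup>2 \<le> (norm2 M f + norm2 M g)\<^sup>2"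
    using norm2_add_square[OF assms, of 1] by (simp add: power2_sum)
qed simp

lemma norm2_triangle_diff:
  assumes "L2 M f" "L2 M g" "L2 M h"
  shows "norm2 M (\<lambda>x. f x - h x) \<le> norm2 M (\<lambda>x. f x - g x) + norm2 M (\<lambda>x. g x - h x)"
  using norm2_triangle[of M "\<lambda>x. f x - g x" "\<lambda>x. g x - h x"] assms by (auto simp: L2_diff)

lemma norm2_triangle_sub:
  assumes "L2 M f" "L2 M g"
  shows "norm2 M f \<le> norm2 M g + norm2 M (\<lambda>x. f x - g x)"
  using norm2_triangle[of M g "\<lambda>x. f x - g x"] assms by (auto simp: L2_diff)

lemma norm2_mono:
  assumes "L2 M g" "f \<in> borel_measurable M" "AE x in M. norm (f x) \<le> norm (g x)"
  shows "norm2 M f \<le> norm2 M g"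
proof -
  have "L2 M f" by (rule L2_dominated[OF assms(1,2), of 1]) (use assms(3) in auto)
  have "(\<integral>x. (norm (f x))\<^sup>2 \<partial>M) \<le> (\<integral>x. (norm (g x))\<^sup>2 \<partial>M)"
    by (rule integral_mono_AE) (use assms \<open>L2 M f\<close> in \<open>auto simp: L2_def elim!: eventually_mono intro: power_mono\<close>)
  then show ?thesis by (simp add: norm2_def)
qed

lemma norm2_eq_0_iff:
  assumes "L2 M f"
  shows "norm2 M f = 0 \<longleftrightarrow> (AE x in M. f x = 0)"
proof -
  have "norm2 M f = 0 \<longleftrightarrow> (\<integral>x. (norm (f x))\<^sup>2 \<partial>M) = 0" by (simp add: norm2_def)
  also have "\<dots> \<longleftrightarrow> (AE x in M. (norm (f x))\<^sup>2 = 0)"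
    by (rule integral_nonneg_eq_0_iff_AE) (use assms in \<open>auto simp: L2_def\<close>)
  finally show ?thesis by simp
qed

lemma integral_norm_le_norm2:
  assumes "finite_measure M" "L2 M f"
  shows "(\<integral>x. norm (f x) \<partial>M) \<le> sqrt (measure M (space M)) * norm2 M f"
proof -
  have one: "L2 M (\<lambda>x. 1::real)" by (rule L2_bounded[OF assms(1), of _ 1]) auto
  have nf: "L2 M (\<lambda>x. norm (f x))" using assms(2) by (auto simp: L2_def)
  have "ip2 M (\<lambda>x. 1) (\<lambda>x. norm (f x)) \<le> norm2 M (\<lambda>x. 1::real) * norm2 M (\<lambda>x. norm (f x))"
    using Cauchy_Schwarz_L2[OF one nf] by linarith
  then show ?thesis by (simp add: ip2_def norm2_def)
qed

lemma tendsto_norm2_imp_tendsto_ip2: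
  assumes f: "\<And>k. L2 M (f k)" "L2 M F" and g: "\<And>k. L2 M (g k)" "L2 M G"
    and cf: "(\<lambda>k. norm2 M (\<lambda>x. f k x - F x)) \<longlonglongrightarrow> 0" and cg: "(\<lambda>k. norm2 M (\<lambda>x. g k x - G x)) \<longlonglongrightarrow> 0"
  shows "(\<lambda>k. ip2 M (f k) (g k)) \<longlonglongrightarrow> ip2 M F G"
proof -
  define a b where "a = (\<lambda>k. norm2 M (\<lambda>x. f k x - F x))" and "b = (\<lambda>k. norm2 M (\<lambda>x. g k x - G x))"
  have "(\<lambda>k. ip2 M (f k) (g k) - ip2 M F G) \<longlonglongrightarrow> 0"
  proof (rule tendsto_0_le[where K=1])
    show "(\<lambda>k. a k * b k + a k * norm2 M G + norm2 M F * b k) \<longlonglongrightarrow> 0"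
      by (rule tendsto_eq_intros cf[folded a_def] cg[folded b_def] refl | simp)+
    show "\<forall>\<^sub>F k in sequentially. norm (ip2 M (f k) (g k) - ip2 M F G)
            \<le> norm (a k * b k + a k * norm2 M G + norm2 M F * b k) * 1"
    proof (rule always_eventually, rule allI)
      fix k
      have "ip2 M (f k) (g k) - ip2 M F G =
          ip2 M (\<lambda>x. f k x - F x) (\<lambda>x. g k x - G x) + ip2 M (\<lambda>x. f k x - F x) G + ip2 M F (\<lambda>x. g k x - G x)"
        using f g by (simp add: ip2_diff_left ip2_diff_right L2_diff)
      moreover have "\<bar>ip2 M (\<lambda>x. f k x - F x) (\<lambda>x. g k x - G x)\<bar> \<le> a k * b k"
        "\<bar>ip2 M (\<lambda>x. f k x - F x) G\<bar> \<le> a k * norm2 M G" "\<bar>ip2 M F (\<lambda>x. g k x - G x)\<bar> \<le> norm2 M F * b k"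
        unfolding a_def b_def using f g by (auto intro!: Cauchy_Schwarz_L2)
      ultimately have "\<bar>ip2 M (f k) (g k) - ip2 M F G\<bar> \<le> a k * b k + a k * norm2 M G + norm2 M F * b k"
        by linarith
      also have "\<dots> \<le> \<bar>a k * b k + a k * norm2 M G + norm2 M F * b k\<bar> * 1"
        by simp
      finally show "norm (ip2 M (f k) (g k) - ip2 M F G)
            \<le> norm (a k * b k + a k * norm2 M G + norm2 M F * b k) * 1"
        by simp
    qed
  qed
  then show ?thesis by (simp add: LIM_zero_iff)
qed

text \<open>Fatou's lemma for the squared norms. Membership of the limit in L2 is part of the
  conclusion, so only its measurability has to be known beforehand.\<close>

lemma L2_tendsto_AE_bounded:
  fixes F :: "'a \<Rightarrow> 'b::euclidean_space"
  assumes g: "\<And>k. L2 M (g k)" and F: "F \<in> borel_measurable M"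
    and lim: "AE x in M. (\<lambda>k. g k x) \<longlonglongrightarrow> F x" and le: "\<And>k. norm2 M (g k) \<le> C"
  shows "L2 M F" "norm2 M F \<le> C"
proof -
  have C: "0 \<le> C" using le[of 0] norm2_nonneg[of M "g 0"] by linarith
  have meas: "\<And>k. (\<lambda>x. ennreal ((norm (g k x))\<^sup>2)) \<in> borel_measurable M"
    using g by (auto simp: L2_def)
  have "(\<integral>\<^sup>+x. ennreal ((norm (F x))\<^sup>2) \<partial>M) = (\<integral>\<^sup>+x. liminf (\<lambda>k. ennreal ((norm (g k x))\<^sup>2)) \<partial>M)"
  proof (rule nn_integral_cong_AE)
    show "AE x in M. ennreal ((norm (F x))\<^sup>2) = liminf (\<lambda>k. ennreal ((norm (g k x))\<^sup>2))"
      using lim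
    proof eventually_elim
      case (elim x)
      have "(\<lambda>k. ennreal ((norm (g k x))\<^sup>2)) \<longlonglongrightarrow> ennreal ((norm (F x))\<^sup>2)"
        by (intro tendsto_ennrealI tendsto_intros elim)
      then show ?case by (rule lim_imp_Liminf[symmetric, OF trivial_limit_sequentially])
    qed
  qed
  also have "\<dots> \<le> liminf (\<lambda>k. \<integral>\<^sup>+x. ennreal ((norm (g k x))\<^sup>2) \<partial>M)"
    by (rule nn_integral_liminf[OF meas])
  also have "\<dots> \<le> liminf (\<lambda>k::nat. ennreal (C\<^sup>2))"
  proof (rule Liminf_mono, rule always_eventually, rule allI)
    fix k
    have "(\<integral>\<^sup>+x. ennreal ((norm (g k x))\<^sup>2) \<partial>M) = ennreal ((norm2 M (g k))\<^sup>2)"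
      unfolding norm2_square using g by (intro nn_integral_eq_integral) (auto simp: L2_def)
    also have "\<dots> \<le> ennreal (C\<^sup>2)"
      by (intro ennreal_leI power_mono le) simp
    finally show "(\<integral>\<^sup>+x. ennreal ((norm (g k x))\<^sup>2) \<partial>M) \<le> ennreal (C\<^sup>2)" .
  qed
  finally have fin: "(\<integral>\<^sup>+x. ennreal ((norm (F x))\<^sup>2) \<partial>M) \<le> ennreal (C\<^sup>2)"
    by (simp add: Liminf_const)
  then have int: "integrable M (\<lambda>x. (norm (F x))\<^sup>2)"
    using F by (intro integrableI_nonneg) (auto intro: le_less_trans)
  then show "L2 M F" using F by (simp add: L2_def)
  have "(norm2 M F)\<^sup>2 \<le> C\<^sup>2"
    unfolding norm2_square by (rule integral_real_bounded[OF _ fin]) simp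
  then show "norm2 M F \<le> C" using C by (rule power2_le_imp_le)
qed

text \<open>On a finite measure, convergence in L2 implies convergence in L1, and an L1 convergent
  sequence has an a.e. convergent subsequence.\<close>

lemma tendsto_norm2_AE_subseq:
  fixes f :: "nat \<Rightarrow> 'a \<Rightarrow> 'b::euclidean_space"
  assumes fin: "finite_measure M" and f: "\<And>k. L2 M (f k)" "L2 M F"
    and lim: "(\<lambda>k. norm2 M (\<lambda>x. f k x - F x)) \<longlonglongrightarrow> 0"
  obtains r :: "nat \<Rightarrow> nat" where "strict_mono r" "AE x in M. (\<lambda>k. f (r k) x) \<longlonglongrightarrow> F x"
proof -
  have "(\<lambda>k. \<integral>x. norm (f k x - F x) \<partial>M) \<longlonglongrightarrow> 0"
  proof (rule tendsto_sandwich[OF _ _ tendsto_const])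
    show "\<forall>\<^sub>F k in sequentially. (\<integral>x. norm (f k x - F x) \<partial>M)
        \<le> sqrt (measure M (space M)) * norm2 M (\<lambda>x. f k x - F x)"
      using f by (intro always_eventually allI integral_norm_le_norm2 fin) auto
    show "(\<lambda>k. sqrt (measure M (space M)) * norm2 M (\<lambda>x. f k x - F x)) \<longlonglongrightarrow> 0"
      using tendsto_mult_left[OF lim] by simp
  qed simp
  from tendsto_L1_AE_subseq[OF _ this] f fin
  obtain r :: "nat \<Rightarrow> nat" where r: "strict_mono r" "AE x in M. (\<lambda>k. f (r k) x - F x) \<longlonglongrightarrow> 0"
    by (auto intro: L2_integrable)
  show ?thesis
    by (rule that[OF r(1)]) (use r(2) in \<open>auto simp: LIM_zero_iff\<close>)
qed

section \<open>Completeness of L2\<close>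

definition Cauchy_L2 :: "'a measure \<Rightarrow> (nat \<Rightarrow> 'a \<Rightarrow> 'b::euclidean_space) \<Rightarrow> bool" where
  "Cauchy_L2 M f \<longleftrightarrow> (\<forall>e>0. \<exists>N. \<forall>m\<ge>N. \<forall>n\<ge>N. norm2 M (\<lambda>x. f m x - f n x) < e)"

lemma Cauchy_L2D:
  assumes "Cauchy_L2 M f" "e > 0"
  obtains N where "\<And>m n. m \<ge> N \<Longrightarrow> n \<ge> N \<Longrightarrow> norm2 M (\<lambda>x. f m x - f n x) < e"
  using assms unfolding Cauchy_L2_def by blast

text \<open>Riesz-Fischer: a subsequence with geometrically small gaps has an a.e. absolutely
  convergent telescoping series, which defines the limit; Fatou's lemma then turns the Cauchy
  estimate into an estimate of the distance to the limit.\<close>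

lemma L2_complete:
  fixes f :: "nat \<Rightarrow> 'a \<Rightarrow> 'b::euclidean_space"
  assumes fin: "finite_measure M" and f: "\<And>k. L2 M (f k)" and Cau: "Cauchy_L2 M f"
  obtains F where "L2 M F" "(\<lambda>k. norm2 M (\<lambda>x. f k x - F x)) \<longlonglongrightarrow> 0"
proof -
  have "\<exists>N. \<forall>m\<ge>N. \<forall>n\<ge>N. norm2 M (\<lambda>x. f m x - f n x) < (1/2)^k" for k :: nat
    using Cau unfolding Cauchy_L2_def by auto
  then obtain N where N: "\<And>k m n. m \<ge> N k \<Longrightarrow> n \<ge> N k \<Longrightarrow> norm2 M (\<lambda>x. f m x - f n x) < (1/2)^k"
    by metis
  \<comment> \<open>The partial sums of \<open>N\<close> dominate each \<open>N k\<close>, and the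
    summand k makes the indices strictly increasing.\<close>
  define r where "r k = (\<Sum>j\<le>k. N j) + k" for k
  have r: "strict_mono r" unfolding strict_mono_Suc_iff by (simp add: r_def)
  have rN: "N k \<le> r k" for k
  proof -
    have "N k \<le> (\<Sum>j\<le>k. N j)" by (rule member_le_sum) auto
    then show ?thesis by (simp add: r_def)
  qed
  define d where "d k x = f (r (Suc k)) x - f (r k) x" for k x
  have d: "L2 M (d k)" for k unfolding d_def using f by auto
  define c where "c = sqrt (measure M (space M))"
  have c0: "0 \<le> c" by (simp add: c_def)
  have dn: "(\<integral>x. norm (d k x) \<partial>M) \<le> c * (1/2)^k" for k
  proof -
    have "N k \<le> r (Suc k)" using rN[of k] r by (meson le_trans less_imp_le lessI strict_monoD)
    then have "norm2 M (d k) \<le> (1/2)^k" unfolding d_def using N[of k "r (Suc k)" "r k"] rN[of k] by simp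
    then have "c * norm2 M (d k) \<le> c * (1/2)^k" by (rule mult_left_mono[OF _ c0])
    moreover have "(\<integral>x. norm (d k x) \<partial>M) \<le> c * norm2 M (d k)"
      unfolding c_def by (rule integral_norm_le_norm2[OF fin d])
    ultimately show ?thesis by linarith
  qed
  have intd: "integrable M (\<lambda>x. norm (d k x))" for k using L2_integrable[OF fin d] by auto
  have AEs: "AE x in M. summable (\<lambda>k. norm (d k x))"
  proof -
    have "(\<integral>\<^sup>+x. (\<Sum>k. ennreal (norm (d k x))) \<partial>M) = (\<Sum>k. \<integral>\<^sup>+x. ennreal (norm (d k x)) \<partial>M)"
      by (rule nn_integral_suminf) (use L2_measurable[OF d] in measurable)
    also have "\<dots> \<le> (\<Sum>k. ennreal (c * (1/2)^k))"
    proof (rule suminf_le)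
      fix k show "(\<integral>\<^sup>+x. ennreal (norm (d k x)) \<partial>M) \<le> ennreal (c * (1/2)^k)"
        using nn_integral_eq_integral[OF intd[of k]] dn[of k] by (simp add: ennreal_leI)
    qed auto
    also have "\<dots> < \<infinity>"
    proof -
      have "summable (\<lambda>k. c * (1/2)^k)" by (intro summable_mult summable_geometric) auto
      then have "(\<Sum>k. ennreal (c * (1/2)^k)) = ennreal (\<Sum>k. c * (1/2)^k)"
        by (intro suminf_ennreal2) (use c0 in auto)
      then show ?thesis by simp
    qed
    finally have "(\<integral>\<^sup>+x. (\<Sum>k. ennreal (norm (d k x))) \<partial>M) \<noteq> \<infinity>" by simp
    then have "AE x in M. (\<Sum>k. ennreal (norm (d k x))) \<noteq> \<infinity>"
      by (intro nn_integral_PInf_AE) (use L2_measurable[OF d] in measurable)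
    then show ?thesis
      by eventually_elim (rule summable_suminf_not_top, auto)
  qed
  define F where "F x = lim (\<lambda>k. f (r k) x)" for x
  have F: "F \<in> borel_measurable M" unfolding F_def using f by (intro borel_measurable_lim_metric) (auto simp: L2_def)
  have AEF: "AE x in M. (\<lambda>k. f (r k) x) \<longlonglongrightarrow> F x"
    using AEs
  proof eventually_elim
    case (elim x)
    then have "summable (\<lambda>k. d k x)" by (rule summable_norm_cancel)
    then have "(\<lambda>n. f (r 0) x + (\<Sum>k<n. d k x)) \<longlonglongrightarrow> f (r 0) x + (\<Sum>k. d k x)"
      by (intro tendsto_intros summable_LIMSEQ)
    moreover have "f (r 0) x + (\<Sum>k<n. d k x) = f (r n) x" for n
      by (simp add: d_def sum_lessThan_telescope[of "\<lambda>k. f (r k) x"])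
    ultimately have "convergent (\<lambda>n. f (r n) x)" by (auto simp: convergent_def)
    then show ?case unfolding F_def by (simp add: convergent_LIMSEQ_iff)
  qed
  \<comment> \<open>Letting the second index of the Cauchy estimate run to infinity along the a.e.
    convergent subsequence. The first half of the conclusion also shows that \<open>F\<close> itself
    is in L2.\<close>
  have key: "L2 M (\<lambda>x. f m x - F x) \<and> norm2 M (\<lambda>x. f m x - F x) \<le> e"
    if "e > 0" and NN: "\<And>m n. m \<ge> N0 \<Longrightarrow> n \<ge> N0 \<Longrightarrow> norm2 M (\<lambda>x. f m x - f n x) < e" and m: "m \<ge> N0" for e N0 m
  proof -
    have r': "r (k + N0) \<ge> N0" for k using seq_suble[OF r, of "k + N0"] by linarith
    have "AE x in M. (\<lambda>k. f m x - f (r (k + N0)) x) \<longlonglongrightarrow> f m x - F x"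
      using AEF by eventually_elim (intro tendsto_intros LIMSEQ_ignore_initial_segment)
    moreover have "(\<lambda>x. f m x - F x) \<in> borel_measurable M"
      using F L2_measurable[OF f] by measurable
    ultimately show ?thesis
      using L2_tendsto_AE_bounded[of M "\<lambda>k x. f m x - f (r (k + N0)) x" "\<lambda>x. f m x - F x" e]
        f less_imp_le[OF NN[OF m r']] by auto
  qed
  obtain N1 where "\<And>m n. m \<ge> N1 \<Longrightarrow> n \<ge> N1 \<Longrightarrow> norm2 M (\<lambda>x. f m x - f n x) < 1"
    by (rule Cauchy_L2D[OF Cau]) auto
  from key[OF _ this, of N1] have "L2 M (\<lambda>x. f N1 x - F x)" by auto
  from L2_diff[OF f[of N1] this] have "L2 M F" by simp
  moreover have "(\<lambda>k. norm2 M (\<lambda>x. f k x - F x)) \<longlonglongrightarrow> 0"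
  proof (rule LIMSEQ_I)
    fix e :: real assume "e > 0"
    then have "e/2 > 0" by simp
    obtain N0 where "\<And>m n. m \<ge> N0 \<Longrightarrow> n \<ge> N0 \<Longrightarrow> norm2 M (\<lambda>x. f m x - f n x) < e/2"
      using Cauchy_L2D[OF Cau \<open>e/2 > 0\<close>] by blast
    from key[OF \<open>e/2 > 0\<close> this] \<open>e > 0\<close> have "\<forall>k\<ge>N0. norm (norm2 M (\<lambda>x. f k x - F x) - 0) < e"
      by fastforce
    then show "\<exists>N. \<forall>k\<ge>N. norm (norm2 M (\<lambda>x. f k x - F x) - 0) < e" by blast
  qed
  ultimately show ?thesis by (rule that)
qed

lemma Cauchy_L2_convergent:
  fixes f :: "nat \<Rightarrow> 'a \<Rightarrow> 'b::euclidean_space"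
  assumes f: "\<And>k. L2 M (f k)" "L2 M F" and lim: "(\<lambda>k. norm2 M (\<lambda>x. f k x - F x)) \<longlonglongrightarrow> 0"
  shows "Cauchy_L2 M f"
  unfolding Cauchy_L2_def
proof (intro allI impI)
  fix e :: real assume "e > 0"
  then have "\<forall>\<^sub>F k in sequentially. norm2 M (\<lambda>x. f k x - F x) < e/2"
    by (intro order_tendstoD(2)[OF lim]) simp
  then obtain N where N: "\<And>k. k \<ge> N \<Longrightarrow> norm2 M (\<lambda>x. f k x - F x) < e/2"
    by (auto simp: eventually_sequentially)
  have "norm2 M (\<lambda>x. f m x - f n x) < e" if "m \<ge> N" "n \<ge> N" for m n
    using norm2_triangle_diff[OF f(1) f(2) f(1), of m n] norm2_minus_commute[of M F "f n"] N[OF that(1)] N[OF that(2)]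
    by linarith
  then show "\<exists>N. \<forall>m\<ge>N. \<forall>n\<ge>N. norm2 M (\<lambda>x. f m x - f n x) < e" by blast
qed

section \<open>Strong limits of convex combinations\<close>

text \<open>Midpoints take the place of general convex combinations: the parallelogram identity uses
  nothing else, and any property stable under midpoints passes to the hull by induction.\<close>

inductive_set mid_hull :: "('a \<Rightarrow> real) set \<Rightarrow> ('a \<Rightarrow> real) set" for S where
  base: "f \<in> S \<Longrightarrow> f \<in> mid_hull S"
| mid: "f \<in> mid_hull S \<Longrightarrow> g \<in> mid_hull S \<Longrightarrow> (\<lambda>x. (f x + g x) / 2) \<in> mid_hull S"

lemma mid_hull_mono: "S \<subseteq> T \<Longrightarrow> mid_hull S \<subseteq> mid_hull T"
proof
  fix f assume "S \<subseteq> T" "f \<in> mid_hull S"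
  show "f \<in> mid_hull T" using \<open>f \<in> mid_hull S\<close>
    by induction (use \<open>S \<subseteq> T\<close> in \<open>auto intro: mid_hull.intros\<close>)
qed

lemma L2_half_sum: "L2 M f \<Longrightarrow> L2 M g \<Longrightarrow> L2 M (\<lambda>x. (f x + g x) / 2 :: real)"
  using L2_cmult[OF L2_add, of M f g "1/2"] by simp

lemma L2_mid_hull: "f \<in> mid_hull S \<Longrightarrow> (\<And>g. g \<in> S \<Longrightarrow> L2 M g) \<Longrightarrow> L2 M f"
  by (induction rule: mid_hull.induct) (auto intro: L2_half_sum)

lemma parallelogram_L2:
  fixes f g :: "'a \<Rightarrow> real"
  assumes "L2 M f" "L2 M g"
  shows "(norm2 M (\<lambda>x. f x - g x))\<^sup>2 = 2 * (norm2 M f)\<^sup>2 + 2 * (norm2 M g)\<^sup>2 - 4 * (norm2 M (\<lambda>x. (f x + g x) / 2))\<^sup>2"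
proof -
  have half: "norm2 M (\<lambda>x. (f x + g x) / 2) = norm2 M (\<lambda>x. f x + g x) / 2"
    using norm2_scaleR[of M "1/2" "\<lambda>x. f x + g x"] by simp
  have "4 * (norm2 M (\<lambda>x. (f x + g x) / 2))\<^sup>2 = (norm2 M (\<lambda>x. f x + g x))\<^sup>2"
    unfolding half by (simp add: power_divide)
  then show ?thesis
    using norm2_add_square[OF assms, of 1] norm2_add_square[OF assms, of "-1"] by simp
qed

text \<open>A norm-minimizing sequence in the shrinking convex hulls of the tails is Cauchy by the
  parallelogram identity; this replaces weak sequential compactness together with Mazur's lemma.\<close>
lemma bounded_L2_mid_hull_convergent:
  fixes f :: "nat \<Rightarrow> 'a \<Rightarrow> real"
  assumes fin: "finite_measure M" and f: "\<And>k. L2 M (f k)" and B: "\<And>k. norm2 M (f k) \<le> B"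
  obtains h g where "\<And>n. h n \<in> mid_hull (f ` {n..})" "L2 M g" "(\<lambda>n. norm2 M (\<lambda>x. h n x - g x)) \<longlonglongrightarrow> 0"
proof -
  define C where "C n = mid_hull (f ` {n..})" for n
  have CL2: "L2 M h" if "h \<in> C n" for h n
    using L2_mid_hull[OF that[unfolded C_def]] f by auto
  have Cmono: "C n \<subseteq> C m" if "m \<le> n" for m n
    unfolding C_def by (rule mid_hull_mono) (use that in auto)
  have Cne: "f n \<in> C n" for n unfolding C_def by (auto intro: mid_hull.base)
  define d where "d n = Inf ((\<lambda>h. (norm2 M h)\<^sup>2) ` C n)" for n
  have bdd: "bdd_below ((\<lambda>h. (norm2 M h)\<^sup>2) ` C n)" for n by (rule bdd_belowI2[of _ 0]) simp
  have dle: "d n \<le> (norm2 M h)\<^sup>2" if "h \<in> C n" for n h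
    unfolding d_def by (rule cINF_lower[OF bdd that])
  have dmono: "d m \<le> d n" if "m \<le> n" for m n
    unfolding d_def by (rule cInf_superset_mono) (use bdd Cmono[OF that] Cne[of n] in auto)
  have dB: "d n \<le> B\<^sup>2" for n
    using dle[OF Cne[of n]] power_mono[OF B[of n], of 2] by simp
  define \<epsilon> where "\<epsilon> n = 1 / real (Suc n)" for n
  have \<epsilon>0: "\<epsilon> \<longlonglongrightarrow> 0" unfolding \<epsilon>_def by (rule LIMSEQ_Suc[OF lim_const_over_n])
  have "\<exists>h\<in>C n. (norm2 M h)\<^sup>2 < d n + \<epsilon> n" for n
  proof -
    have "Inf ((\<lambda>h. (norm2 M h)\<^sup>2) ` C n) < d n + \<epsilon> n" by (simp add: d_def \<epsilon>_def)
    then show ?thesis using cInf_lessD[of "(\<lambda>h. (norm2 M h)\<^sup>2) ` C n"] Cne[of n] by blast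
  qed
  then obtain h where h: "\<And>n. h n \<in> C n" "\<And>n. (norm2 M (h n))\<^sup>2 < d n + \<epsilon> n" by metis
  \<comment> \<open>The hulls shrink, so their minimal squared norms increase; they stay below B^2
    and converge. The remaining gap \<open>D - d N\<close> then controls the distance of any two
    near-minimizers taken from the hull with index N.\<close>
  have "incseq d" using dmono by (auto simp: incseq_def)
  then obtain D where D: "d \<longlonglongrightarrow> D" "\<And>n. d n \<le> D" using incseq_convergent[of d "B\<^sup>2"] dB by blast
  have est: "(norm2 M (\<lambda>x. h m x - h n x))\<^sup>2 \<le> 4 * (D - d N) + 4 * \<epsilon> N" if "N \<le> m" "N \<le> n" for m n N
  proof -
    have "h m \<in> C N" "h n \<in> C N" using h(1) Cmono that by blast+
    then have "(\<lambda>x. (h m x + h n x) / 2) \<in> C N" unfolding C_def by (rule mid_hull.mid)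
    then have "d N \<le> (norm2 M (\<lambda>x. (h m x + h n x) / 2))\<^sup>2" by (rule dle)
    moreover have "\<epsilon> m \<le> \<epsilon> N" "\<epsilon> n \<le> \<epsilon> N"
      unfolding \<epsilon>_def using that by (auto intro!: divide_left_mono)
    moreover have "X \<le> 4 * (D - d N) + 4 * \<epsilon> N"
      if "X = 2 * a + 2 * b - 4 * c" "d N \<le> c" "\<epsilon> m \<le> \<epsilon> N" "\<epsilon> n \<le> \<epsilon> N" "a < d m + \<epsilon> m" "b < d n + \<epsilon> n"
      for X a b c using that D(2)[of m] D(2)[of n] by argo
    ultimately show ?thesis
      using parallelogram_L2[OF CL2[OF h(1)] CL2[OF h(1)], of m n] h(2)[of m] h(2)[of n] by blast
  qed
  have "Cauchy_L2 M h" unfolding Cauchy_L2_def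
  proof (intro allI impI)
    fix e :: real assume e: "e > 0"
    have "(\<lambda>N. 4 * (D - d N) + 4 * \<epsilon> N) \<longlonglongrightarrow> 4 * (D - D) + 0"
      by (intro tendsto_intros D(1) tendsto_mult_right_zero \<epsilon>0)
    then have "\<forall>\<^sub>F N in sequentially. 4 * (D - d N) + 4 * \<epsilon> N < e\<^sup>2"
      using e by (intro order_tendstoD(2)) auto
    then obtain N where N: "4 * (D - d N) + 4 * \<epsilon> N < e\<^sup>2" by (auto simp: eventually_sequentially)
    have "norm2 M (\<lambda>x. h m x - h n x) < e" if "m \<ge> N" "n \<ge> N" for m n
      using power2_less_imp_less[of "norm2 M (\<lambda>x. h m x - h n x)" e] est[OF that] N e by linarith
    then show "\<exists>N. \<forall>m\<ge>N. \<forall>n\<ge>N. norm2 M (\<lambda>x. h m x - h n x) < e" by blast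
  qed
  from L2_complete[OF fin CL2[OF h(1)] this]
  obtain g where "L2 M g" "(\<lambda>k. norm2 M (\<lambda>x. h k x - g x)) \<longlonglongrightarrow> 0" .
  with h(1) show ?thesis by (intro that[of h g]) (auto simp: C_def)
qed

section \<open>Smoothness through partial derivatives, and a smoothed truncation\<close>

lemma pd_eqI: "(f has_derivative D) (at x) \<Longrightarrow> pd i f x = D (axis i 1)"
  by (simp add: pd_def frechet_derivative_at[symmetric])

text \<open>Smoothness is defined through iterated partial derivatives; a class of differentiable
  functions that is closed under every partial derivative consists of smooth functions.\<close>
inductive smooth_alg :: "((real^'n::finite) \<Rightarrow> real) \<Rightarrow> bool" where
  smooth: "smooth_fun f \<Longrightarrow> smooth_alg f"
| const: "smooth_alg (\<lambda>x. c)"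
| add: "smooth_alg f \<Longrightarrow> smooth_alg g \<Longrightarrow> smooth_alg (\<lambda>x. f x + g x)"
| mult: "smooth_alg f \<Longrightarrow> smooth_alg g \<Longrightarrow> smooth_alg (\<lambda>x. f x * g x)"
| powr: "smooth_alg f \<Longrightarrow> (\<And>x. f x > 0) \<Longrightarrow> smooth_alg (\<lambda>x. f x powr a)"

lemma smooth_fun_differentiable: "smooth_fun f \<Longrightarrow> f differentiable (at x)"
  unfolding smooth_fun_def by (metis iter_pd.simps(1))

lemma iter_pd_append: "iter_pd (xs @ ys) f = iter_pd xs (iter_pd ys f)"
  by (induction xs) auto

lemma smooth_fun_pd: "smooth_fun f \<Longrightarrow> smooth_fun (pd i f)"
  unfolding smooth_fun_def by (metis iter_pd_append iter_pd.simps)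

lemma has_derivative_powr_const:
  fixes f :: "'a::real_normed_vector \<Rightarrow> real"
  assumes f: "(f has_derivative D) (at x)" and pos: "f x > 0"
  shows "((\<lambda>y. f y powr a) has_derivative (\<lambda>h. a * (f x powr (a - 1)) * D h)) (at x)"
proof -
  have "((\<lambda>s. s powr a) has_real_derivative a * (f x powr (a - 1))) (at (f x))"
    using has_real_derivative_powr[OF pos] .
  then have "((\<lambda>s. s powr a) has_derivative (\<lambda>h. a * (f x powr (a - 1)) * h)) (at (f x))"
    by (simp add: has_field_derivative_def)
  from has_derivative_compose[OF f this] show ?thesis .
qed

lemma smooth_alg_differentiable: "smooth_alg f \<Longrightarrow> f differentiable (at x)"
proof (induction rule: smooth_alg.induct)
  case (smooth f) then show ?case by (rule smooth_fun_differentiable)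
next
  case (powr f a)
  then obtain D where "(f has_derivative D) (at x)" by (auto simp: differentiable_def)
  from has_derivative_powr_const[OF this powr.hyps(2)] show ?case by (auto simp: differentiable_def)
qed (auto intro: differentiable_add differentiable_mult)

lemma differentiable_has_derivative: "f differentiable (at x) \<Longrightarrow> (f has_derivative frechet_derivative f (at x)) (at x)"
  by (simp add: frechet_derivative_works)

text \<open>Arbitrary real exponents are what closes the class: differentiating
  \<open>f x powr a\<close> lowers the exponent to a - 1, and the positivity of f admits the new
  power again.\<close>

lemma smooth_alg_pd: "smooth_alg f \<Longrightarrow> smooth_alg (pd i f)"
proof (induction rule: smooth_alg.induct)
  case (smooth f) then show ?case by (intro smooth_alg.smooth smooth_fun_pd)
next
  case (const c)
  have "pd i (\<lambda>x. c) = (\<lambda>x. 0)" by (rule ext) (auto intro: pd_eqI[OF has_derivative_const])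
  then show ?case using smooth_alg.const[of 0] by simp
next
  case (add f g)
  have "pd i (\<lambda>x. f x + g x) = (\<lambda>x. pd i f x + pd i g x)"
  proof
    fix x
    from has_derivative_add[OF differentiable_has_derivative[OF smooth_alg_differentiable[OF add.hyps(1)]]
        differentiable_has_derivative[OF smooth_alg_differentiable[OF add.hyps(2)]], of x]
    show "pd i (\<lambda>x. f x + g x) x = pd i f x + pd i g x" by (simp add: pd_eqI) (simp add: pd_def)
  qed
  then show ?case using add by (simp add: smooth_alg.add)
next
  case (mult f g)
  have "pd i (\<lambda>x. f x * g x) = (\<lambda>x. f x * pd i g x + pd i f x * g x)"
  proof
    fix x
    from has_derivative_mult[OF differentiable_has_derivative[OF smooth_alg_differentiable[OF mult.hyps(1)]]
        differentiable_has_derivative[OF smooth_alg_differentiable[OF mult.hyps(2)]], of x]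
    show "pd i (\<lambda>x. f x * g x) x = f x * pd i g x + pd i f x * g x" by (simp add: pd_eqI) (simp add: pd_def)
  qed
  then show ?case using mult by (simp add: smooth_alg.add smooth_alg.mult)
next
  case (powr f a)
  have "pd i (\<lambda>x. f x powr a) = (\<lambda>x. (a * f x powr (a - 1)) * pd i f x)"
  proof
    fix x
    from has_derivative_powr_const[OF differentiable_has_derivative[OF smooth_alg_differentiable[OF powr.hyps(1)]] powr.hyps(2), where x=x and a=a]
    show "pd i (\<lambda>x. f x powr a) x = (a * f x powr (a - 1)) * pd i f x" by (simp add: pd_eqI) (simp add: pd_def)
  qed
  then show ?case using powr by (simp add: smooth_alg.powr smooth_alg.mult smooth_alg.const)
qed

lemma smooth_alg_imp_smooth_fun:
  assumes "smooth_alg f" shows "smooth_fun f"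
proof -
  have "smooth_alg (iter_pd is f)" for "is" by (induction "is") (auto intro: smooth_alg_pd assms)
  then show ?thesis by (simp add: smooth_fun_def smooth_alg_differentiable)
qed

text \<open>The formula min(s,T) = (s + T - |s - T|)/2 with the absolute value smoothed, normalized so that
  0 is mapped to 0 and supports do not grow.\<close>
definition soft_min :: "real \<Rightarrow> real \<Rightarrow> real \<Rightarrow> real" where
  "soft_min T e s = (s + sqrt (T\<^sup>2 + e\<^sup>2) - sqrt ((s - T)\<^sup>2 + e\<^sup>2)) / 2"

definition soft_min' :: "real \<Rightarrow> real \<Rightarrow> real \<Rightarrow> real" where
  "soft_min' T e s = (1 - (s - T) / sqrt ((s - T)\<^sup>2 + e\<^sup>2)) / 2"

lemma soft_min_0 [simp]: "soft_min T e 0 = 0"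
  by (simp add: soft_min_def)

lemma has_derivative_soft_min:
  assumes e: "e > 0"
  shows "(soft_min T e has_real_derivative soft_min' T e s) (at s)"
proof -
  have pos: "(s - T)\<^sup>2 + e\<^sup>2 > 0" using e by (simp add: add_nonneg_pos)
  have "((\<lambda>s. (s - T)\<^sup>2 + e\<^sup>2) has_real_derivative 2 * (s - T)) (at s)"
    by (auto intro!: derivative_eq_intros)
  from DERIV_chain2[OF DERIV_real_sqrt[OF pos] this]
  have "((\<lambda>s. sqrt ((s - T)\<^sup>2 + e\<^sup>2)) has_real_derivative inverse (sqrt ((s - T)\<^sup>2 + e\<^sup>2)) / 2 * (2 * (s - T))) (at s)" .
  moreover have "inverse q / 2 * (2 * (s - T)) = (s - T) / q" for q :: real
    by (cases "q = 0") (auto simp: field_simps)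
  ultimately have "((\<lambda>s. sqrt ((s - T)\<^sup>2 + e\<^sup>2)) has_real_derivative (s - T) / sqrt ((s - T)\<^sup>2 + e\<^sup>2)) (at s)"
    by (simp only:)
  from DERIV_cdivide[OF DERIV_diff[OF DERIV_add[OF DERIV_ident DERIV_const[of "sqrt (T\<^sup>2 + e\<^sup>2)"]] this], of 2]
  show ?thesis
    unfolding soft_min_def[abs_def] soft_min'_def by simp
qed

text \<open>Both bounds reflect |s - T| \<le> sqrt((s - T)^2 + e^2). They make
  \<open>soft_min\<close> 1-Lipschitz and let composition with it only shrink gradients, so the
  truncation cannot raise the quadratic part of the energy.\<close>

lemma soft_min'_bounds:
  assumes e: "e > 0"
  shows "0 \<le> soft_min' T e s" "soft_min' T e s \<le> 1"
proof -
  define q where "q = sqrt ((s - T)\<^sup>2 + e\<^sup>2)"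
  have pos: "(s - T)\<^sup>2 + e\<^sup>2 > 0" using e by (simp add: add_nonneg_pos)
  then have q: "q > 0" by (simp add: q_def)
  have "\<bar>s - T\<bar> \<le> q" unfolding q_def by (rule real_le_rsqrt) simp
  then have "(s - T) / q \<le> 1" "- 1 \<le> (s - T) / q" using q by (simp_all add: divide_le_eq le_divide_eq)
  then show "0 \<le> soft_min' T e s" "soft_min' T e s \<le> 1"
    unfolding soft_min'_def q_def[symmetric] by auto
qed

lemma continuous_soft_min':
  assumes "e > 0" shows "continuous_on UNIV (soft_min' T e)"
proof -
  have "sqrt ((s - T)\<^sup>2 + e\<^sup>2) \<noteq> 0" for s
    using assms by (simp add: add_nonneg_eq_0_iff)
  then show ?thesis unfolding soft_min'_def by (intro continuous_intros) auto
qed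

lemma soft_min_Lipschitz:
  assumes e: "e > 0"
  shows "\<bar>soft_min T e s - soft_min T e t\<bar> \<le> \<bar>s - t\<bar>"
proof -
  have "norm (soft_min T e s - soft_min T e t) \<le> 1 * norm (s - t)"
    by (rule field_differentiable_bound[of UNIV _ "soft_min' T e"])
      (use soft_min'_bounds[OF e] has_derivative_soft_min[OF e] in \<open>auto simp: abs_le_iff intro: order_trans\<close>)
  then show ?thesis by simp
qed

text \<open>The sign of T matters through the normalizing term: sqrt(T^2) has to be T for the limit
  to be the minimum.\<close>

lemma soft_min_tendsto_min:
  assumes T: "T \<ge> 0" and e: "e \<longlonglongrightarrow> 0"
  shows "(\<lambda>k. soft_min T (e k) s) \<longlonglongrightarrow> min s T"
proof -
  have "(\<lambda>k. soft_min T (e k) s) \<longlonglongrightarrow> (s + sqrt (T\<^sup>2 + 0\<^sup>2) - sqrt ((s - T)\<^sup>2 + 0\<^sup>2)) / 2"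
    unfolding soft_min_def by (intro tendsto_intros e) auto
  moreover have eq: "(s + sqrt (T\<^sup>2 + 0\<^sup>2) - sqrt ((s - T)\<^sup>2 + 0\<^sup>2)) / 2 = min s T"
    using T by (auto simp: min_def)
  ultimately show ?thesis unfolding eq by blast
qed

lemma smooth_fun_soft_min:
  assumes f: "smooth_fun f" and e: "e > 0"
  shows "smooth_fun (\<lambda>x. soft_min T e (f x))"
proof (rule smooth_alg_imp_smooth_fun)
  \<comment> \<open>The square root is written as the power 1/2 of \<open>q\<close>, whose
    positivity for e > 0 puts it into the class \<open>smooth_alg\<close>.\<close>
  define q where "q x = (f x + - T) * (f x + - T) + e\<^sup>2" for x
  have pos: "q x > 0" for x
    using e by (simp add: q_def add_nonneg_pos power2_eq_square[symmetric])
  have q: "smooth_alg q" unfolding q_def by (intro smooth_alg.intros f)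
  have "smooth_alg (\<lambda>x. (1/2) * f x + ((1/2) * sqrt (T\<^sup>2 + e\<^sup>2) + (-1/2) * (q x powr (1/2))))"
    by (intro smooth_alg.intros f q pos)
  also have "(\<lambda>x. (1/2) * f x + ((1/2) * sqrt (T\<^sup>2 + e\<^sup>2) + (-1/2) * (q x powr (1/2)))) = (\<lambda>x. soft_min T e (f x))"
    using pos by (auto simp: soft_min_def powr_half_sqrt less_imp_le q_def power2_eq_square algebra_simps diff_divide_distrib add_divide_distrib)
  finally show "smooth_alg (\<lambda>x. soft_min T e (f x))" .
qed

section \<open>Test functions and their gradients\<close>

lemma smooth_fun_continuous: "smooth_fun f \<Longrightarrow> continuous_on S f"
  by (meson continuous_at_imp_continuous_on differentiable_imp_continuous_within smooth_fun_differentiable)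

lemma smooth_fun_has_derivative:
  assumes "smooth_fun f"
  shows "(f has_derivative (\<lambda>h. cgrad f x \<bullet> h)) (at x)"
proof -
  let ?D = "frechet_derivative f (at x)"
  have D: "(f has_derivative ?D) (at x)" by (rule differentiable_has_derivative[OF smooth_fun_differentiable[OF assms]])
  then have lin: "linear ?D" by (rule has_derivative_linear)
  have "?D h = cgrad f x \<bullet> h" for h
  proof -
    have "?D h = ?D (\<Sum>i\<in>UNIV. h $ i *\<^sub>R axis i 1)" by (simp add: basis_expansion scalar_mult_eq_scaleR[symmetric])
    also have "\<dots> = (\<Sum>i\<in>UNIV. h $ i * ?D (axis i 1))"
      by (simp add: linear_sum[OF lin] linear_scale[OF lin])
    also have "\<dots> = cgrad f x \<bullet> h" by (simp add: cgrad_def inner_vec_def pd_def mult.commute)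
    finally show ?thesis .
  qed
  then have "?D = (\<lambda>h. cgrad f x \<bullet> h)" by auto
  with D show ?thesis by simp
qed

lemma cgrad_continuous: "smooth_fun f \<Longrightarrow> continuous_on S (cgrad f)"
  unfolding cgrad_def by (intro continuous_on_vec_lambda smooth_fun_continuous smooth_fun_pd)

lemma pd_eq_cgrad: "pd i f x = cgrad f x $ i"
  by (simp add: cgrad_def)

lemma cgrad_eqI:
  assumes "(f has_derivative (\<lambda>h. G \<bullet> h)) (at x)"
  shows "cgrad f x = G"
  by (simp add: vec_eq_iff cgrad_def pd_eqI[OF assms] inner_axis)

lemma zero_outside: "x \<notin> closure {x. f x \<noteq> 0} \<Longrightarrow> f x = 0"
  using closure_subset[of "{x. f x \<noteq> 0}"] by blast

lemma cgrad_outside: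
  assumes "x \<notin> closure {x. f x \<noteq> 0}"
  shows "cgrad f x = 0"
proof (rule cgrad_eqI)
  have "(f has_derivative (\<lambda>h. 0)) (at x)"
    by (rule has_derivative_transform_within_open[OF has_derivative_const[of 0], of "- closure {x. f x \<noteq> 0}"])
      (use assms in \<open>auto dest: zero_outside\<close>)
  then show "(f has_derivative (\<lambda>h. 0 \<bullet> h)) (at x)" by simp
qed

lemma test_funD:
  assumes "test_fun \<Omega> \<phi>"
  shows "smooth_fun \<phi>" "compact (closure {x. \<phi> x \<noteq> 0})" "closure {x. \<phi> x \<noteq> 0} \<subseteq> \<Omega>"
  using assms by (auto simp: test_fun_def)

lemma compact_closure_subset:
  assumes "compact K" "closure S \<subseteq> K"
  shows "compact (closure S)"
  using compact_Int_closed[OF assms(1) closed_closure[of S]] assms(2) by (simp add: inf.absorb2)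

lemma test_funI:
  assumes \<phi>: "test_fun \<Omega> \<phi>" and \<psi>: "smooth_fun \<psi>" and sub: "\<And>x. x \<notin> closure {x. \<phi> x \<noteq> 0} \<Longrightarrow> \<psi> x = 0"
  shows "test_fun \<Omega> \<psi>"
proof -
  have "closure {x. \<psi> x \<noteq> 0} \<subseteq> closure {x. \<phi> x \<noteq> 0}"
    by (rule closure_minimal) (use sub in auto)
  then show ?thesis
    using test_funD[OF \<phi>] \<psi> compact_closure_subset unfolding test_fun_def by blast
qed

lemma test_fun_pd: "test_fun \<Omega> \<phi> \<Longrightarrow> test_fun \<Omega> (pd i \<phi>)"
  by (rule test_funI) (auto intro: smooth_fun_pd test_funD simp: pd_eq_cgrad cgrad_outside)

lemma test_fun_soft_min: "test_fun \<Omega> \<phi> \<Longrightarrow> e > 0 \<Longrightarrow> test_fun \<Omega> (\<lambda>x. soft_min T e (\<phi> x))"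
  by (rule test_funI) (auto intro: smooth_fun_soft_min test_funD dest: zero_outside)

lemma test_fun_cmult: "test_fun \<Omega> \<phi> \<Longrightarrow> test_fun \<Omega> (\<lambda>x. c * \<phi> x)"
  by (rule test_funI) (auto intro!: smooth_alg_imp_smooth_fun[OF smooth_alg.mult[OF smooth_alg.const smooth_alg.smooth]] intro: test_funD dest: zero_outside)

lemma test_fun_add:
  assumes \<phi>: "test_fun \<Omega> \<phi>" and \<psi>: "test_fun \<Omega> \<psi>"
  shows "test_fun \<Omega> (\<lambda>x. \<phi> x + \<psi> x)"
proof -
  have "closure {x. \<phi> x + \<psi> x \<noteq> 0} \<subseteq> closure {x. \<phi> x \<noteq> 0} \<union> closure {x. \<psi> x \<noteq> 0}" (is "_ \<subseteq> ?K")
  proof (rule closure_minimal)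
    show "{x. \<phi> x + \<psi> x \<noteq> 0} \<subseteq> ?K"
    proof
      fix x assume "x \<in> {x. \<phi> x + \<psi> x \<noteq> 0}"
      then have "\<phi> x \<noteq> 0 \<or> \<psi> x \<noteq> 0" by auto
      then show "x \<in> ?K" using zero_outside[of x \<phi>] zero_outside[of x \<psi>] by blast
    qed
  qed (intro closed_Un closed_closure)
  moreover have "compact ?K" "?K \<subseteq> \<Omega>" by (intro compact_Un Un_least test_funD(2,3)[OF \<phi>] test_funD(2,3)[OF \<psi>])+
  moreover have "smooth_fun (\<lambda>x. \<phi> x + \<psi> x)"
    by (rule smooth_alg_imp_smooth_fun[OF smooth_alg.add[OF smooth_alg.smooth[OF test_funD(1)[OF \<phi>]] smooth_alg.smooth[OF test_funD(1)[OF \<psi>]]]])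
  ultimately show ?thesis
    using compact_closure_subset[of ?K "{x. \<phi> x + \<psi> x \<noteq> 0}"] unfolding test_fun_def
    by (auto dest: order_trans)
qed

lemma cgrad_add: "smooth_fun f \<Longrightarrow> smooth_fun g \<Longrightarrow> cgrad (\<lambda>x. f x + g x) x = cgrad f x + cgrad g x"
  by (rule cgrad_eqI) (auto intro!: derivative_eq_intros smooth_fun_has_derivative simp: inner_add_left)

lemma cgrad_cmult: "smooth_fun f \<Longrightarrow> cgrad (\<lambda>x. c * f x) x = c *\<^sub>R cgrad f x"
  by (rule cgrad_eqI) (auto intro!: derivative_eq_intros smooth_fun_has_derivative)

lemma cgrad_soft_min:
  assumes f: "smooth_fun f" and e: "e > 0"
  shows "cgrad (\<lambda>x. soft_min T e (f x)) x = soft_min' T e (f x) *\<^sub>R cgrad f x"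
proof (rule cgrad_eqI)
  have "(soft_min T e has_derivative (\<lambda>h. soft_min' T e (f x) * h)) (at (f x))"
    using has_derivative_soft_min[OF e] by (simp add: has_field_derivative_def)
  from has_derivative_compose[OF smooth_fun_has_derivative[OF f] this]
  show "((\<lambda>x. soft_min T e (f x)) has_derivative (\<lambda>h. (soft_min' T e (f x) *\<^sub>R cgrad f x) \<bullet> h)) (at x)"
    by simp
qed

section \<open>Integration by parts and translation estimates\<close>

lemma integrable_compact_support:
  fixes f :: "'a::euclidean_space \<Rightarrow> 'b::{banach, second_countable_topology}"
  assumes "continuous_on UNIV f" "compact K" "\<And>x. x \<notin> K \<Longrightarrow> f x = 0"
  shows "integrable lborel f"
proof -
  have "integrable lborel (\<lambda>x. indicator K x *\<^sub>R f x)"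
    by (rule borel_integrable_compact) (use assms(2) continuous_on_subset[OF assms(1)] in auto)
  moreover have "(\<lambda>x. indicator K x *\<^sub>R f x) = f"
    using assms(3) by (auto simp: indicator_def)
  ultimately show ?thesis by simp
qed

lemma L2_compact_support:
  fixes f :: "'a::euclidean_space \<Rightarrow> 'b::euclidean_space"
  assumes "continuous_on UNIV f" "compact K" "\<And>x. x \<notin> K \<Longrightarrow> f x = 0"
  shows "L2 lborel f"
proof -
  have "continuous_on UNIV (\<lambda>x. (norm (f x))\<^sup>2)" by (intro continuous_intros assms(1))
  from integrable_compact_support[OF this assms(2)] assms(3)
  show ?thesis unfolding L2_def using borel_measurable_continuous_onI[OF assms(1)] by simp
qed

lemma lborel_distr_translate: "distr lborel borel (\<lambda>x. x + c) = (lborel :: 'a::euclidean_space measure)"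
proof -
  have "(\<lambda>x. x + c) = (+) c" by (simp add: fun_eq_iff add.commute)
  then show ?thesis using lborel_distr_plus[of c] by simp
qed

lemma integral_lborel_translate:
  fixes f :: "'a::euclidean_space \<Rightarrow> 'b::{banach, second_countable_topology}"
  assumes "f \<in> borel_measurable borel"
  shows "(\<integral>x. f (x + c) \<partial>lborel) = (\<integral>x. f x \<partial>lborel)"
proof -
  have "(\<integral>x. f x \<partial>lborel) = (\<integral>x. f x \<partial>distr lborel borel (\<lambda>x. x + c))"
    by (simp add: lborel_distr_translate)
  also have "\<dots> = (\<integral>x. f (x + c) \<partial>lborel)" by (rule integral_distr) (use assms in auto)
  finally show ?thesis by simp
qed

lemma nn_integral_lborel_translate:
  fixes f :: "'a::euclidean_space \<Rightarrow> ennreal"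
  assumes "f \<in> borel_measurable borel"
  shows "(\<integral>\<^sup>+x. f (x + c) \<partial>lborel) = (\<integral>\<^sup>+x. f x \<partial>lborel)"
proof -
  have "(\<integral>\<^sup>+x. f x \<partial>lborel) = (\<integral>\<^sup>+x. f x \<partial>distr lborel borel (\<lambda>x. x + c))"
    by (simp add: lborel_distr_translate)
  also have "\<dots> = (\<integral>\<^sup>+x. f (x + c) \<partial>lborel)" by (rule nn_integral_distr) (use assms in auto)
  finally show ?thesis by simp
qed

text \<open>By translation invariance every difference quotient in direction v has integral 0. The
  quotients are bounded by the Lipschitz constant and supported in one compact set, so dominated
  convergence carries this to the derivative.\<close>

lemma integral_derivative_compact_support:
  fixes F :: "'a::euclidean_space \<Rightarrow> real"
  assumes F: "\<And>x. (F has_derivative (\<lambda>h. G x \<bullet> h)) (at x)" and G: "continuous_on UNIV G"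
    and K: "compact K" and F0: "\<And>x. x \<notin> K \<Longrightarrow> F x = 0" and G0: "\<And>x. x \<notin> K \<Longrightarrow> G x = 0"
  shows "(\<integral>x. G x \<bullet> v \<partial>lborel) = 0"
proof -
  have contF: "continuous_on UNIV F"
    by (rule has_derivative_continuous_on) (rule has_derivative_at_withinI[OF F])
  then have measF: "F \<in> borel_measurable borel" by (rule borel_measurable_continuous_onI)
  have intF: "integrable lborel F" by (rule integrable_compact_support[OF contF K F0])
  have "compact (G ` K)" by (rule compact_continuous_image[OF continuous_on_subset[OF G] K]) auto
  then have "bounded (G ` K)" by (rule compact_imp_bounded)
  then obtain B where B: "\<And>x. x \<in> K \<Longrightarrow> norm (G x) \<le> B" "B > 0"
    unfolding bounded_pos by auto
  have B': "norm (G x) \<le> B" for x using B G0 by (cases "x \<in> K") auto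
  have Lip: "\<bar>F x - F y\<bar> \<le> B * norm (x - y)" for x y
  proof -
    have "norm (F x - F y) \<le> B * norm (x - y)"
    proof (rule differentiable_bound[of UNIV F "\<lambda>x h. G x \<bullet> h"])
      show "onorm (\<lambda>h. G x \<bullet> h) \<le> B" for x
      proof (rule onorm_le)
        fix h have "\<bar>G x \<bullet> h\<bar> \<le> norm (G x) * norm h" by (rule Cauchy_Schwarz_ineq2)
        also have "\<dots> \<le> B * norm h" by (rule mult_right_mono[OF B']) simp
        finally show "norm (G x \<bullet> h) \<le> B * norm h" by simp
      qed
    qed (use F in auto)
    then show ?thesis by simp
  qed
  define h where "h n = 1 / real (Suc n)" for n
  have h: "h n > 0" "h n \<le> 1" for n by (auto simp: h_def)
  have h0: "h \<longlonglongrightarrow> 0" unfolding h_def by (rule LIMSEQ_Suc[OF lim_const_over_n])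
  define q where "q n x = (F (x + h n *\<^sub>R v) - F x) / h n" for n x
  \<comment> \<open>All translates of K by -t v with t between 0 and 1; since \<open>h n\<close> is
    at most 1, this contains the support of every difference quotient.\<close>
  define K' where "K' = (\<lambda>(y,t). y - t *\<^sub>R v) ` (K \<times> {0..1::real})"
  have K': "compact K'" unfolding K'_def
    by (rule compact_continuous_image) (auto intro!: continuous_intros compact_Times K simp: case_prod_unfold)
  have q0: "q n x = 0" if "x \<notin> K'" for n x
  proof -
    have "x \<notin> K" using that unfolding K'_def by (auto intro!: image_eqI[of _ _ "(x,0)"])
    moreover have "x + h n *\<^sub>R v \<notin> K"
    proof
      assume "x + h n *\<^sub>R v \<in> K"
      then have "x \<in> K'" unfolding K'_def
        by (intro image_eqI[of _ _ "(x + h n *\<^sub>R v, h n)"]) (use h[of n] in auto)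
      with that show False by simp
    qed
    ultimately show ?thesis by (simp add: q_def F0)
  qed
  have qB: "\<bar>q n x\<bar> \<le> B * norm v" for n x
  proof -
    have "\<bar>F (x + h n *\<^sub>R v) - F x\<bar> \<le> B * (h n * norm v)" using Lip[of "x + h n *\<^sub>R v" x] h[of n] by simp
    then show ?thesis using h[of n] by (simp add: q_def abs_divide pos_divide_le_eq mult_ac)
  qed
  have qint: "(\<integral>x. q n x \<partial>lborel) = 0" for n
  proof -
    have "integrable lborel (\<lambda>x. F (x + h n *\<^sub>R v))"
      by (rule integrable_distr[of "\<lambda>x. x + h n *\<^sub>R v" lborel borel]) (use intF in \<open>auto simp: lborel_distr_translate\<close>)
    then show ?thesis unfolding q_def using intF integral_lborel_translate[OF measF, of "h n *\<^sub>R v"] by simp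
  qed
  have "(\<lambda>n. \<integral>x. q n x \<partial>lborel) \<longlonglongrightarrow> (\<integral>x. G x \<bullet> v \<partial>lborel)"
  proof (rule integral_dominated_convergence[where w = "\<lambda>x. indicator K' x *\<^sub>R (B * norm v)"])
    show "(\<lambda>x. G x \<bullet> v) \<in> borel_measurable lborel"
      using borel_measurable_continuous_onI[OF G] by simp
    show "q n \<in> borel_measurable lborel" for n unfolding q_def using measF by simp
    show "integrable lborel (\<lambda>x. indicator K' x *\<^sub>R (B * norm v))"
      by (rule borel_integrable_compact[OF K']) auto
    show "AE x in lborel. norm (q n x) \<le> indicator K' x *\<^sub>R (B * norm v)" for n
      using q0 qB by (auto simp: indicator_def)
    show "AE x in lborel. (\<lambda>n. q n x) \<longlonglongrightarrow> G x \<bullet> v"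
    proof (rule AE_I2)
      fix x
      have "((\<lambda>t. F (x + t *\<^sub>R v)) has_derivative (\<lambda>t. G x \<bullet> (t *\<^sub>R v))) (at 0)"
        by (rule has_derivative_compose[of "\<lambda>t. x + t *\<^sub>R v" "\<lambda>t. t *\<^sub>R v" 0 UNIV F "\<lambda>h. G x \<bullet> h"])
          (auto intro!: derivative_eq_intros F)
      then have "((\<lambda>t. F (x + t *\<^sub>R v)) has_real_derivative (G x \<bullet> v)) (at 0)"
        unfolding has_field_derivative_def by (simp add: mult.commute[of _ "G x \<bullet> v"])
      then have "((\<lambda>t. (F (x + t *\<^sub>R v) - F x) / t) \<longlongrightarrow> G x \<bullet> v) (at 0)"
        by (simp add: DERIV_def)
      then show "(\<lambda>n. q n x) \<longlonglongrightarrow> G x \<bullet> v" unfolding q_def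
        by (rule filterlim_compose) (use h h0 in \<open>auto simp: filterlim_at less_imp_neq[symmetric]\<close>)
    qed
  qed
  then have "(\<lambda>n. 0::real) \<longlonglongrightarrow> (\<integral>x. G x \<bullet> v \<partial>lborel)" by (simp add: qint)
  then show ?thesis by (simp add: LIMSEQ_const_iff)
qed

lemma test_fun_integration_by_parts:
  assumes \<phi>: "test_fun \<Omega> \<phi>" and \<psi>: "test_fun \<Omega> \<psi>"
  shows "(\<integral>x. pd i \<phi> x * \<psi> x \<partial>lborel) = - (\<integral>x. \<phi> x * pd i \<psi> x \<partial>lborel)"
proof -
  let ?K = "closure {x. \<phi> x \<noteq> 0}"
  note s = test_funD(1)[OF \<phi>] test_funD(1)[OF \<psi>]
  note K = test_funD(2)[OF \<phi>]
  have "(\<integral>x. (\<phi> x *\<^sub>R cgrad \<psi> x + \<psi> x *\<^sub>R cgrad \<phi> x) \<bullet> axis i 1 \<partial>lborel) = 0"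
  proof (rule integral_derivative_compact_support[of "\<lambda>x. \<phi> x * \<psi> x", OF _ _ K])
    show "((\<lambda>x. \<phi> x * \<psi> x) has_derivative (\<lambda>h. (\<phi> x *\<^sub>R cgrad \<psi> x + \<psi> x *\<^sub>R cgrad \<phi> x) \<bullet> h)) (at x)" for x
      using has_derivative_mult[OF smooth_fun_has_derivative[OF s(1)] smooth_fun_has_derivative[OF s(2)], of x]
      by (simp add: inner_add_left mult.commute)
  qed (auto intro!: continuous_intros smooth_fun_continuous cgrad_continuous s dest: zero_outside simp: cgrad_outside)
  then have "(\<integral>x. \<phi> x * pd i \<psi> x + pd i \<phi> x * \<psi> x \<partial>lborel) = 0"
    by (simp add: inner_axis pd_eq_cgrad mult.commute)
  moreover have "integrable lborel (\<lambda>x. \<phi> x * pd i \<psi> x)"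
    by (rule integrable_compact_support[OF continuous_on_mult K])
      (auto intro: smooth_fun_continuous smooth_fun_pd s dest: zero_outside)
  moreover have "integrable lborel (\<lambda>x. pd i \<phi> x * \<psi> x)"
    by (rule integrable_compact_support[OF continuous_on_mult K])
      (use cgrad_outside[of _ \<phi>] in \<open>auto intro: smooth_fun_continuous smooth_fun_pd s simp: cgrad_def vec_eq_iff\<close>)
  ultimately show ?thesis by simp
qed

lemma test_fun_L2: "test_fun \<Omega> \<phi> \<Longrightarrow> L2 lborel \<phi>" "test_fun \<Omega> \<phi> \<Longrightarrow> L2 lborel (cgrad \<phi>)"
  by (auto intro!: L2_compact_support[OF _ test_funD(2)] smooth_fun_continuous cgrad_continuous
      intro: test_funD dest: zero_outside simp: cgrad_outside)

text \<open>With d the increment of f, which is the mean of g over the unit interval, integrating (g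
  - d)^2 \<ge> 0 gives the integral of g^2 as at least d^2.\<close>

lemma square_le_nn_integral_derivative:
  fixes f g :: "real \<Rightarrow> real"
  assumes f: "\<And>t. (f has_real_derivative g t) (at t)" and g: "continuous_on UNIV g"
  shows "ennreal ((f 1 - f 0)\<^sup>2) \<le> (\<integral>\<^sup>+t. ennreal ((g t)\<^sup>2) * indicator {0..1} t \<partial>lborel)"
proof -
  define d where "d = f 1 - f 0"
  have gd: "(g has_integral d) {0..1}" unfolding d_def
    by (rule fundamental_theorem_of_calculus)
      (use f in \<open>auto simp: has_real_derivative_iff_has_vector_derivative[symmetric] intro: has_field_derivative_at_within\<close>)
  have "(\<lambda>t. (g t)\<^sup>2) integrable_on {0..1}"
    by (rule integrable_continuous_real) (intro continuous_intros continuous_on_subset[OF g], auto)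
  then obtain I where I: "((\<lambda>t. (g t)\<^sup>2) has_integral I) {0..1}" by (auto simp: integrable_on_def)
  have c: "((\<lambda>t. d\<^sup>2) has_integral d\<^sup>2) {0..1::real}" using has_integral_const_real[of "d\<^sup>2" 0 1] by simp
  have "((\<lambda>t. (g t)\<^sup>2 - 2 * d * g t + d\<^sup>2) has_integral (I - 2 * d * d + d\<^sup>2)) {0..1}"
    by (intro has_integral_add has_integral_diff I c has_integral_mult_right gd)
  moreover have "(g t)\<^sup>2 - 2 * d * g t + d\<^sup>2 \<ge> 0" for t
    using zero_le_power2[of "g t - d"] by (simp add: power2_diff mult_ac)
  ultimately have "0 \<le> I - 2 * d * d + d\<^sup>2" by (rule has_integral_nonneg)
  then have "d\<^sup>2 \<le> I" by (simp add: power2_eq_square)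
  moreover have "(\<integral>\<^sup>+t. ennreal ((g t)\<^sup>2) * indicator {0..1} t \<partial>lborel) = ennreal I"
    by (rule nn_integral_has_integral_lebesgue'[OF _ I]) simp
  ultimately show ?thesis by (simp add: d_def ennreal_leI)
qed

text \<open>The increment along y is the integral of the directional derivative over the segment.
  After exchanging the integrals, translation invariance makes the inner integral independent of the
  position on the segment. This is the only place where the gradient bound enters the compactness
  argument.\<close>

lemma translation_estimate:
  assumes \<phi>: "test_fun \<Omega> \<phi>"
  shows "(\<integral>\<^sup>+x. ennreal ((\<phi> (x + y) - \<phi> x)\<^sup>2) \<partial>lborel) \<le> ennreal ((norm y)\<^sup>2 * (norm2 lborel (cgrad \<phi>))\<^sup>2)"
proof -
  note s = test_funD(1)[OF \<phi>]
  have cc: "continuous_on UNIV (cgrad \<phi>)" by (rule cgrad_continuous[OF s])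
  then have meas: "cgrad \<phi> \<in> borel_measurable borel" by (rule borel_measurable_continuous_onI)
  have "(\<integral>\<^sup>+x. ennreal ((\<phi> (x + y) - \<phi> x)\<^sup>2) \<partial>lborel)
      \<le> (\<integral>\<^sup>+x. \<integral>\<^sup>+t. ennreal ((cgrad \<phi> (x + t *\<^sub>R y) \<bullet> y)\<^sup>2) * indicator {0..1} t \<partial>lborel \<partial>lborel)"
  proof (rule nn_integral_mono)
    fix x
    have "((\<lambda>t. \<phi> (x + t *\<^sub>R y)) has_real_derivative (cgrad \<phi> (x + t *\<^sub>R y) \<bullet> y)) (at t)" for t
    proof -
      have "((\<lambda>t. \<phi> (x + t *\<^sub>R y)) has_derivative (\<lambda>h. cgrad \<phi> (x + t *\<^sub>R y) \<bullet> (h *\<^sub>R y))) (at t)"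
        by (rule has_derivative_compose[of "\<lambda>t. x + t *\<^sub>R y" "\<lambda>h. h *\<^sub>R y" t UNIV \<phi> "\<lambda>h. cgrad \<phi> (x + t *\<^sub>R y) \<bullet> h"])
          (auto intro!: derivative_eq_intros smooth_fun_has_derivative s)
      then show ?thesis unfolding has_field_derivative_def by (simp add: mult_commute_abs)
    qed
    moreover have "continuous_on UNIV (\<lambda>t. cgrad \<phi> (x + t *\<^sub>R y) \<bullet> y)"
      by (intro continuous_intros continuous_on_compose2[OF cc]) auto
    ultimately have "ennreal ((\<phi> (x + 1 *\<^sub>R y) - \<phi> (x + 0 *\<^sub>R y))\<^sup>2)
        \<le> (\<integral>\<^sup>+t. ennreal ((cgrad \<phi> (x + t *\<^sub>R y) \<bullet> y)\<^sup>2) * indicator {0..1} t \<partial>lborel)"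
      by (rule square_le_nn_integral_derivative)
    then show "ennreal ((\<phi> (x + y) - \<phi> x)\<^sup>2)
        \<le> (\<integral>\<^sup>+t. ennreal ((cgrad \<phi> (x + t *\<^sub>R y) \<bullet> y)\<^sup>2) * indicator {0..1} t \<partial>lborel)" by simp
  qed
  also have "\<dots> = (\<integral>\<^sup>+t. \<integral>\<^sup>+x. ennreal ((cgrad \<phi> (x + t *\<^sub>R y) \<bullet> y)\<^sup>2) * indicator {0..1} t \<partial>lborel \<partial>lborel)"
    by (rule lborel_pair.Fubini'[symmetric]) (use meas in measurable)
  also have "\<dots> = (\<integral>\<^sup>+t. (\<integral>\<^sup>+x. ennreal ((cgrad \<phi> x \<bullet> y)\<^sup>2) \<partial>lborel) * indicator {0..1::real} t \<partial>lborel)"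
  proof (rule nn_integral_cong)
    fix t :: real
    have "(\<integral>\<^sup>+x. ennreal ((cgrad \<phi> (x + t *\<^sub>R y) \<bullet> y)\<^sup>2) * indicator {0..1} t \<partial>lborel)
       = (\<integral>\<^sup>+x. ennreal ((cgrad \<phi> (x + t *\<^sub>R y) \<bullet> y)\<^sup>2) \<partial>lborel) * indicator {0..1} t"
      by (rule nn_integral_multc) (use meas in measurable)
    also have "(\<integral>\<^sup>+x. ennreal ((cgrad \<phi> (x + t *\<^sub>R y) \<bullet> y)\<^sup>2) \<partial>lborel) = (\<integral>\<^sup>+x. ennreal ((cgrad \<phi> x \<bullet> y)\<^sup>2) \<partial>lborel)"
      by (rule nn_integral_lborel_translate[where f = "\<lambda>x. ennreal ((cgrad \<phi> x \<bullet> y)\<^sup>2)"]) (use meas in measurable)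
    finally show "(\<integral>\<^sup>+x. ennreal ((cgrad \<phi> (x + t *\<^sub>R y) \<bullet> y)\<^sup>2) * indicator {0..1} t \<partial>lborel)
       = (\<integral>\<^sup>+x. ennreal ((cgrad \<phi> x \<bullet> y)\<^sup>2) \<partial>lborel) * indicator {0..1} t" .
  qed
  also have "\<dots> = (\<integral>\<^sup>+x. ennreal ((cgrad \<phi> x \<bullet> y)\<^sup>2) \<partial>lborel)"
    by (subst nn_integral_cmult_indicator) auto
  also have "\<dots> \<le> (\<integral>\<^sup>+x. ennreal ((norm y)\<^sup>2 * (norm (cgrad \<phi> x))\<^sup>2) \<partial>lborel)"
  proof (intro nn_integral_mono ennreal_leI)
    fix x
    have "\<bar>cgrad \<phi> x \<bullet> y\<bar> \<le> \<bar>norm y * norm (cgrad \<phi> x)\<bar>"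
      using Cauchy_Schwarz_ineq2[of "cgrad \<phi> x" y] by (simp add: mult.commute)
    then show "(cgrad \<phi> x \<bullet> y)\<^sup>2 \<le> (norm y)\<^sup>2 * (norm (cgrad \<phi> x))\<^sup>2"
      by (simp only: abs_le_square_iff power_mult_distrib)
  qed
  also have "\<dots> = ennreal (\<integral>x. (norm y)\<^sup>2 * (norm (cgrad \<phi> x))\<^sup>2 \<partial>lborel)"
    by (rule nn_integral_eq_integral) (use test_fun_L2(2)[OF \<phi>] in \<open>auto simp: L2_def\<close>)
  also have "\<dots> = ennreal ((norm y)\<^sup>2 * (norm2 lborel (cgrad \<phi>))\<^sup>2)"
    by (simp add: norm2_square)
  finally show ?thesis .
qed

section \<open>Dominated convergence in L2, and restriction of Lebesgue measure to a domain\<close>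

lemma norm2_tendsto_0_dominated:
  assumes f: "\<And>k. f k \<in> borel_measurable M" and g: "L2 M g"
    and lim: "AE x in M. (\<lambda>k. f k x) \<longlonglongrightarrow> 0" and le: "\<And>k. AE x in M. norm (f k x) \<le> norm (g x)"
  shows "(\<lambda>k. norm2 M (f k)) \<longlonglongrightarrow> 0"
proof -
  have "(\<lambda>k. \<integral>x. (norm (f k x))\<^sup>2 \<partial>M) \<longlonglongrightarrow> (\<integral>x. 0 \<partial>M)"
  proof (rule integral_dominated_convergence[where w = "\<lambda>x. (norm (g x))\<^sup>2"])
    show "integrable M (\<lambda>x. (norm (g x))\<^sup>2)" using g by (simp add: L2_def)
    show "AE x in M. (\<lambda>k. (norm (f k x))\<^sup>2) \<longlonglongrightarrow> 0"
      using lim by eventually_elim (use tendsto_norm_zero in \<open>force intro!: tendsto_eq_intros\<close>)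
    show "AE x in M. norm ((norm (f k x))\<^sup>2) \<le> (norm (g x))\<^sup>2" for k
      using le[of k] by eventually_elim (simp add: power_mono)
  qed (use f in auto)
  then have "(\<lambda>k. sqrt (\<integral>x. (norm (f k x))\<^sup>2 \<partial>M)) \<longlonglongrightarrow> sqrt 0"
    by (intro tendsto_real_sqrt) simp
  then show ?thesis by (simp add: norm2_def)
qed

lemma L2_lborel_imp_L2_lebesgue_on:
  fixes f :: "'a::euclidean_space \<Rightarrow> 'b::euclidean_space"
  assumes "\<Omega> \<in> sets lebesgue" "L2 lborel f"
  shows "L2 (lebesgue_on \<Omega>) f"
proof -
  have f: "f \<in> borel_measurable borel" "integrable lborel (\<lambda>x. (norm (f x))\<^sup>2)"
    using assms(2) by (auto simp: L2_def)
  then have "f \<in> borel_measurable lebesgue" by (simp add: measurable_completion)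
  then have m: "f \<in> borel_measurable (lebesgue_on \<Omega>)" by (rule measurable_restrict_space1)
  have i: "integrable lebesgue (\<lambda>x. (norm (f x))\<^sup>2)"
    using f by (subst integrable_completion) auto
  then have "integrable (lebesgue_on \<Omega>) (\<lambda>x. (norm (f x))\<^sup>2)"
    using integrable_mult_indicator[OF assms(1) i] assms(1) by (subst integrable_restrict_space) auto
  with m show ?thesis by (simp add: L2_def)
qed

lemma integral_lebesgue_on_support:
  fixes f :: "'a::euclidean_space \<Rightarrow> 'b::euclidean_space"
  assumes "\<Omega> \<in> sets lebesgue" "f \<in> borel_measurable borel" "\<And>x. x \<notin> \<Omega> \<Longrightarrow> f x = 0"
  shows "(\<integral>x. f x \<partial>lebesgue_on \<Omega>) = (\<integral>x. f x \<partial>lborel)"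
proof -
  have "(\<integral>x. f x \<partial>lebesgue_on \<Omega>) = (\<integral>x. indicator \<Omega> x *\<^sub>R f x \<partial>lebesgue)"
    by (rule integral_restrict_space) (use assms in auto)
  also have "(\<lambda>x. indicator \<Omega> x *\<^sub>R f x) = f" using assms(3) by (auto simp: indicator_def)
  also have "(\<integral>x. f x \<partial>lebesgue) = (\<integral>x. f x \<partial>lborel)" by (rule integral_completion) (use assms in auto)
  finally show ?thesis .
qed

lemma norm2_lebesgue_on_support:
  fixes f :: "'a::euclidean_space \<Rightarrow> 'b::euclidean_space"
  assumes "\<Omega> \<in> sets lebesgue" "f \<in> borel_measurable borel" "\<And>x. x \<notin> \<Omega> \<Longrightarrow> f x = 0"
  shows "norm2 (lebesgue_on \<Omega>) f = norm2 lborel f"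
  unfolding norm2_def
  by (subst integral_lebesgue_on_support) (use assms in auto)

text \<open>Estimates proved over the whole space with Borel functions are brought to the completed
  measure on the domain. The cell averages need this form, because they do not vanish outside the
  domain.\<close>

lemma norm2_lebesgue_on_le:
  fixes f :: "'a::euclidean_space \<Rightarrow> 'b::euclidean_space"
  assumes \<Omega>: "\<Omega> \<in> sets lebesgue" and f: "f \<in> borel_measurable borel"
    and le: "(\<integral>\<^sup>+x. ennreal ((norm (f x))\<^sup>2) \<partial>lborel) \<le> ennreal (C\<^sup>2)" and C: "C \<ge> 0"
  shows "L2 (lebesgue_on \<Omega>) f" "norm2 (lebesgue_on \<Omega>) f \<le> C"
proof -
  have i: "integrable lborel (\<lambda>x. (norm (f x))\<^sup>2)"
    using f le by (intro integrableI_nonneg) (auto intro: le_less_trans)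
  then have "L2 lborel f" using f by (simp add: L2_def)
  then show L: "L2 (lebesgue_on \<Omega>) f" by (rule L2_lborel_imp_L2_lebesgue_on[OF \<Omega>])
  have "ennreal (\<integral>x. (norm (f x))\<^sup>2 \<partial>lebesgue_on \<Omega>) = (\<integral>\<^sup>+x. ennreal ((norm (f x))\<^sup>2) \<partial>lebesgue_on \<Omega>)"
    by (rule nn_integral_eq_integral[symmetric]) (use L in \<open>auto simp: L2_def\<close>)
  also have "\<dots> = (\<integral>\<^sup>+x. ennreal ((norm (f x))\<^sup>2) * indicator \<Omega> x \<partial>lebesgue)"
    by (rule nn_integral_restrict_space) (use \<Omega> in auto)
  also have "\<dots> \<le> (\<integral>\<^sup>+x. ennreal ((norm (f x))\<^sup>2) \<partial>lebesgue)"
    by (intro nn_integral_mono) (auto simp: indicator_def)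
  also have "\<dots> = (\<integral>\<^sup>+x. ennreal ((norm (f x))\<^sup>2) \<partial>lborel)"
    by (rule nn_integral_completion)
  also note le
  finally have "(norm2 (lebesgue_on \<Omega>) f)\<^sup>2 \<le> C\<^sup>2" by (simp add: norm2_square)
  then show "norm2 (lebesgue_on \<Omega>) f \<le> C" using C by (rule power2_le_imp_le)
qed

section \<open>Compactness by averaging over lattice cells\<close>

lemma diagonal_convergent_subsequence:
  fixes a :: "nat \<Rightarrow> 'i::countable \<Rightarrow> real"
  assumes bdd: "\<And>i. bounded (range (\<lambda>k. a k i))"
  obtains r where "strict_mono r" "\<And>i. convergent (\<lambda>k. a (r k) i)"
proof -
  interpret subseqs "\<lambda>n s. convergent (\<lambda>k. a (s k) (from_nat n))"
  proof
    fix n and s :: "nat \<Rightarrow> nat"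
    have "bounded (range (\<lambda>k. a (s k) (from_nat n)))"
      by (rule bounded_subset[OF bdd[of "from_nat n"]]) auto
    then obtain l r where "strict_mono r" "((\<lambda>k. a (s k) (from_nat n)) \<circ> r) \<longlonglongrightarrow> l"
      using bounded_imp_convergent_subsequence by blast
    then show "\<exists>r'. strict_mono r' \<and> convergent (\<lambda>k. a ((s \<circ> r') k) (from_nat n))"
      by (auto simp: o_def convergent_def)
  qed
  show ?thesis
  proof (rule that[OF subseq_diagseq])
    fix i :: 'i
    \<comment> \<open>The diagonal sequence is a subsequence of the one chosen for an index only
      after that index has been passed, so an initial segment is dropped here and restored at the
      end.\<close>
    have "convergent (\<lambda>k. a ((diagseq \<circ> (+) (Suc (to_nat i))) k) (from_nat (to_nat i)))"
    proof (rule diagseq_holds)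
      fix r s :: "nat \<Rightarrow> nat" and n
      assume "strict_mono r" "convergent (\<lambda>k. a (s k) (from_nat n))"
      from convergent_subseq_convergent[OF this(2,1)]
      show "convergent (\<lambda>k. a ((s \<circ> r) k) (from_nat n))" by (simp add: o_def)
    qed
    then have "convergent (\<lambda>k. a (diagseq (k + Suc (to_nat i))) i)"
      by (simp add: o_def add.commute)
    then show "convergent (\<lambda>k. a (diagseq k) i)"
      by (subst (asm) convergent_ignore_initial_segment)
  qed
qed

text \<open>Lattice nodes are indexed by integer-valued functions on a finite type. This index type
  is countable, as the diagonal argument requires.\<close>

definition grid_point :: "real \<Rightarrow> ('n \<Rightarrow> int) \<Rightarrow> real^'n::finite" where
  "grid_point h z = (\<chi> i. h * of_int (z i))"

definition grid_floor :: "real \<Rightarrow> real^'n::finite \<Rightarrow> real^'n" where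
  "grid_floor h x = grid_point h (\<lambda>i. \<lfloor>x $ i / h\<rfloor>)"

text \<open>The integral over the cell with lower corner a, not yet divided by the volume. Moving
  the corner into the argument of f makes it a parameter integral, hence measurable in a.\<close>

definition box_int :: "real \<Rightarrow> (real^'n::finite \<Rightarrow> real) \<Rightarrow> real^'n \<Rightarrow> real" where
  "box_int h f a = (\<integral>z. indicator (cbox 0 (\<chi> i. h)) z * f (a + z) \<partial>lborel)"

lemma grid_floor_bounds:
  assumes "h > 0"
  shows "grid_floor h x $ i \<le> x $ i" "x $ i \<le> grid_floor h x $ i + h"
proof -
  have "real_of_int \<lfloor>x $ i / h\<rfloor> \<le> x $ i / h" "x $ i / h \<le> real_of_int \<lfloor>x $ i / h\<rfloor> + 1"
    by linarith+
  from iffD1[OF pos_le_divide_eq[OF assms] this(1)] iffD1[OF pos_divide_le_eq[OF assms] this(2)]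
  show "grid_floor h x $ i \<le> x $ i" "x $ i \<le> grid_floor h x $ i + h"
    by (simp_all add: grid_floor_def grid_point_def algebra_simps)
qed

lemma grid_floor_measurable: "grid_floor h \<in> borel_measurable borel"
  by (subst borel_measurable_euclidean_space)
    (auto simp: grid_floor_def grid_point_def Basis_vec_def inner_axis)

lemma box_int_measurable:
  assumes [measurable]: "f \<in> borel_measurable borel"
  shows "box_int h f \<in> borel_measurable borel"
proof -
  have "(\<lambda>a. \<integral>z. indicator (cbox 0 (\<chi> i. h)) z * f (a + z) \<partial>lborel) \<in> borel_measurable borel"
    by (rule sigma_finite_measure.borel_measurable_lebesgue_integral[OF sigma_finite_lborel]) measurable
  then show ?thesis by (simp add: box_int_def[abs_def])
qed

lemma emeasure_cube:
  assumes "a \<le> b"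
  shows "emeasure lborel (cbox (\<chi> i::'n::finite. a) (\<chi> i. b)) = ennreal ((b - a) ^ CARD('n))"
proof -
  have ne: "cbox (\<chi> i::'n. a) (\<chi> i. b) \<noteq> {}"
    using assms by (auto simp: interval_ne_empty_cart)
  have "measure lborel (cbox (\<chi> i::'n. a) (\<chi> i. b)) = (b - a) ^ CARD('n)"
    using content_cbox_cart[OF ne] by simp
  then show ?thesis using emeasure_eq_ennreal_measure[of lborel "cbox (\<chi> i::'n. a) (\<chi> i. b)"]
    by (simp add: emeasure_lborel_cbox_eq)
qed

text \<open>Cauchy-Schwarz between the indicator of the cell and the function c - f(a + z). The free
  constant serves two purposes: c = f(x) measures how far the average is from f, and c = 0 bounds
  the average itself.\<close>

lemma box_int_square_le:
  fixes f :: "real^'n::finite \<Rightarrow> real"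
  assumes f: "continuous_on UNIV f" and h: "h > 0"
  shows "ennreal ((c - box_int h f a / h ^ CARD('n))\<^sup>2)
     \<le> ennreal (1 / h ^ CARD('n)) * (\<integral>\<^sup>+z. ennreal ((c - f (a + z))\<^sup>2) * indicator (cbox 0 (\<chi> i. h)) z \<partial>lborel)"
proof -
  let ?Q = "cbox 0 (\<chi> i. h) :: (real^'n) set"
  define H where "H = h ^ CARD('n)"
  have H: "H > 0" using h by (simp add: H_def)
  have z0: "(\<chi> i::'n. (0::real)) = 0" by (simp add: vec_eq_iff)
  have mQ: "emeasure lborel ?Q = ennreal H"
    using emeasure_cube[of 0 h, where 'n='n] h by (simp add: H_def z0)
  have int: "integrable lborel (\<lambda>z. indicator ?Q z *\<^sub>R k z)" if "continuous_on UNIV k" for k :: "real^'n \<Rightarrow> real"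
    by (rule borel_integrable_compact) (use continuous_on_subset[OF that] in auto)
  have L2i: "L2 lborel (\<lambda>z. indicator ?Q z * k z)" if k: "continuous_on UNIV k" for k :: "real^'n \<Rightarrow> real"
  proof -
    have "integrable lborel (\<lambda>z. indicator ?Q z *\<^sub>R (k z)\<^sup>2)" by (rule int) (intro continuous_intros k)
    moreover have "(\<lambda>z. indicator ?Q z *\<^sub>R (k z)\<^sup>2) = (\<lambda>z. (norm (indicator ?Q z * k z))\<^sup>2)"
      by (auto simp: indicator_def)
    ultimately show ?thesis using borel_measurable_continuous_onI[OF k] by (simp add: L2_def)
  qed
  have cg: "continuous_on UNIV (\<lambda>z. c - f (a + z))"
    by (intro continuous_intros continuous_on_compose2[OF f]) auto
  define k where "k z = indicator ?Q z * (c - f (a + z))" for z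
  have k: "L2 lborel k" unfolding k_def by (rule L2i[OF cg])
  have one: "L2 lborel (\<lambda>z. indicator ?Q z * (1::real))" by (rule L2i) auto
  have "norm2 lborel (\<lambda>z. indicator ?Q z * (1::real)) = sqrt H"
  proof -
    have "(\<lambda>z. (norm (indicator ?Q z * (1::real)))\<^sup>2) = indicator ?Q" by (auto simp: indicator_def)
    then have "norm2 lborel (\<lambda>z. indicator ?Q z * (1::real)) = sqrt (measure lborel ?Q)"
      by (simp add: norm2_def)
    then show ?thesis using mQ H by (simp add: measure_def)
  qed
  with Cauchy_Schwarz_L2[OF one k] have "\<bar>ip2 lborel (\<lambda>z. indicator ?Q z * 1) k\<bar> \<le> sqrt H * norm2 lborel k"
    by simp
  moreover have "ip2 lborel (\<lambda>z. indicator ?Q z * 1) k = H * c - box_int h f a"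
  proof -
    have "(\<lambda>z. (indicator ?Q z * 1) \<bullet> k z) = (\<lambda>z. indicator ?Q z *\<^sub>R c - indicator ?Q z *\<^sub>R f (a + z))"
      by (auto simp: k_def indicator_def)
    moreover have "(\<integral>z. indicator ?Q z *\<^sub>R c - indicator ?Q z *\<^sub>R f (a + z) \<partial>lborel)
        = (\<integral>z. indicator ?Q z *\<^sub>R c \<partial>lborel) - (\<integral>z. indicator ?Q z *\<^sub>R f (a + z) \<partial>lborel)"
      by (rule Bochner_Integration.integral_diff; rule int; intro continuous_intros continuous_on_compose2[OF f]; simp)
    ultimately show ?thesis using mQ H by (simp add: ip2_def box_int_def measure_def)
  qed
  ultimately have "\<bar>H * c - box_int h f a\<bar> \<le> \<bar>sqrt H * norm2 lborel k\<bar>" using H by simp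
  then have "(H * c - box_int h f a)\<^sup>2 \<le> (sqrt H * norm2 lborel k)\<^sup>2" by (simp only: abs_le_square_iff)
  then have le: "(H * c - box_int h f a)\<^sup>2 \<le> H * (norm2 lborel k)\<^sup>2" using H by (simp add: power_mult_distrib)
  have "c - box_int h f a / H = (H * c - box_int h f a) / H" using H by (simp add: diff_divide_distrib)
  then have "(c - box_int h f a / H)\<^sup>2 = (H * c - box_int h f a)\<^sup>2 / H\<^sup>2" by (simp add: power_divide)
  also have "\<dots> \<le> (H * (norm2 lborel k)\<^sup>2) / H\<^sup>2" by (rule divide_right_mono[OF le]) simp
  also have "\<dots> = 1 / H * (norm2 lborel k)\<^sup>2" using H by (simp add: power2_eq_square)
  finally have "ennreal ((c - box_int h f a / H)\<^sup>2) \<le> ennreal (1 / H * (norm2 lborel k)\<^sup>2)" by (rule ennreal_leI)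
  also have "\<dots> = ennreal (1 / H) * ennreal ((norm2 lborel k)\<^sup>2)"
    by (rule ennreal_mult) (use H in auto)
  also have "ennreal ((norm2 lborel k)\<^sup>2) = (\<integral>\<^sup>+z. ennreal ((norm (k z))\<^sup>2) \<partial>lborel)"
    unfolding norm2_square by (rule nn_integral_eq_integral[symmetric]) (use k in \<open>auto simp: L2_def\<close>)
  also have "\<dots> = (\<integral>\<^sup>+z. ennreal ((c - f (a + z))\<^sup>2) * indicator ?Q z \<partial>lborel)"
    by (rule nn_integral_cong) (auto simp: k_def indicator_def)
  finally show ?thesis by (simp add: H_def)
qed

text \<open>The average of a function over a cell of side h differs from it in L2 by at most the average
  of its translates by vectors of the cube [-h,h].\<close>
lemma box_average_estimate:
  fixes \<phi> :: "real^'n::finite \<Rightarrow> real"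
  assumes \<phi>: "test_fun \<Omega> \<phi>" and h: "h > 0"
  defines "N \<equiv> CARD('n)"
  shows "(\<integral>\<^sup>+x. ennreal ((\<phi> x - box_int h \<phi> (grid_floor h x) / h ^ N)\<^sup>2) \<partial>lborel)
     \<le> ennreal (2 ^ N * ((real N * h)\<^sup>2 * (norm2 lborel (cgrad \<phi>))\<^sup>2))"
proof -
  let ?Q = "cbox 0 (\<chi> i. h) :: (real^'n) set" and ?R = "cbox (\<chi> i. - h) (\<chi> i. h) :: (real^'n) set"
  define D where "D = (real N * h)\<^sup>2 * (norm2 lborel (cgrad \<phi>))\<^sup>2"
  have cont: "continuous_on UNIV \<phi>" by (rule smooth_fun_continuous[OF test_funD(1)[OF \<phi>]])
  have meas[measurable]: "\<phi> \<in> borel_measurable borel" by (rule borel_measurable_continuous_onI[OF cont])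
  have "(\<integral>\<^sup>+x. ennreal ((\<phi> x - box_int h \<phi> (grid_floor h x) / h ^ N)\<^sup>2) \<partial>lborel)
     \<le> (\<integral>\<^sup>+x. ennreal (1 / h ^ N) * (\<integral>\<^sup>+z. ennreal ((\<phi> (x + z) - \<phi> x)\<^sup>2) * indicator ?R z \<partial>lborel) \<partial>lborel)"
  proof (rule nn_integral_mono)
    fix x :: "real^'n"
    define a where "a = grid_floor h x"
    have "ennreal ((\<phi> x - box_int h \<phi> a / h ^ N)\<^sup>2)
       \<le> ennreal (1 / h ^ N) * (\<integral>\<^sup>+z. ennreal ((\<phi> x - \<phi> (a + z))\<^sup>2) * indicator ?Q z \<partial>lborel)"
      unfolding N_def by (rule box_int_square_le[OF cont h])
    \<comment> \<open>Shifting z by x - a recentres the integral at x. Since x lies in the cell with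
      corner a, the shifted cell stays inside the cube \<open>?R\<close> whatever the position of
      x.\<close>
    also have "(\<integral>\<^sup>+z. ennreal ((\<phi> x - \<phi> (a + z))\<^sup>2) * indicator ?Q z \<partial>lborel)
       = (\<integral>\<^sup>+z. ennreal ((\<phi> x - \<phi> (a + (z + (x - a))))\<^sup>2) * indicator ?Q (z + (x - a)) \<partial>lborel)"
      by (rule nn_integral_lborel_translate[symmetric, of "\<lambda>z. ennreal ((\<phi> x - \<phi> (a + z))\<^sup>2) * indicator ?Q z"]) measurable
    also have "\<dots> \<le> (\<integral>\<^sup>+z. ennreal ((\<phi> (x + z) - \<phi> x)\<^sup>2) * indicator ?R z \<partial>lborel)"
    proof (rule nn_integral_mono)
      fix z :: "real^'n"
      have "z \<in> ?R" if "z + (x - a) \<in> ?Q"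
        unfolding mem_box_cart
      proof
        fix i
        have "0 \<le> z $ i + (x $ i - a $ i)" "z $ i + (x $ i - a $ i) \<le> h"
          using that by (auto simp: mem_box_cart)
        with grid_floor_bounds[OF h, of x i] show "(\<chi> i. - h) $ i \<le> z $ i \<and> z $ i \<le> (\<chi> i. h) $ i"
          by (simp add: a_def)
      qed
      then show "ennreal ((\<phi> x - \<phi> (a + (z + (x - a))))\<^sup>2) * indicator ?Q (z + (x - a))
          \<le> ennreal ((\<phi> (x + z) - \<phi> x)\<^sup>2) * indicator ?R z"
        by (auto simp: indicator_def add.commute power2_commute)
    qed
    finally show "ennreal ((\<phi> x - box_int h \<phi> (grid_floor h x) / h ^ N)\<^sup>2)
       \<le> ennreal (1 / h ^ N) * (\<integral>\<^sup>+z. ennreal ((\<phi> (x + z) - \<phi> x)\<^sup>2) * indicator ?R z \<partial>lborel)"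
      by (simp add: a_def mult_left_mono)
  qed
  also have "\<dots> = ennreal (1 / h ^ N) * (\<integral>\<^sup>+x. \<integral>\<^sup>+z. ennreal ((\<phi> (x + z) - \<phi> x)\<^sup>2) * indicator ?R z \<partial>lborel \<partial>lborel)"
    by (rule nn_integral_cmult) measurable
  also have "(\<integral>\<^sup>+x. \<integral>\<^sup>+z. ennreal ((\<phi> (x + z) - \<phi> x)\<^sup>2) * indicator ?R z \<partial>lborel \<partial>lborel)
      = (\<integral>\<^sup>+z. \<integral>\<^sup>+x. ennreal ((\<phi> (x + z) - \<phi> x)\<^sup>2) * indicator ?R z \<partial>lborel \<partial>lborel)"
    by (rule lborel_pair.Fubini'[symmetric]) measurable
  also have "\<dots> \<le> (\<integral>\<^sup>+z. ennreal D * indicator ?R z \<partial>lborel)"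
  proof (rule nn_integral_mono)
    fix z :: "real^'n"
    show "(\<integral>\<^sup>+x. ennreal ((\<phi> (x + z) - \<phi> x)\<^sup>2) * indicator ?R z \<partial>lborel) \<le> ennreal D * indicator ?R z"
    proof (cases "z \<in> ?R")
      case True
      have "norm z \<le> (\<Sum>i\<in>UNIV. \<bar>z $ i\<bar>)" by (rule norm_le_l1_cart)
      also have "\<dots> \<le> (\<Sum>i\<in>(UNIV::'n set). h)"
        by (rule sum_mono) (use True in \<open>simp add: mem_box_cart abs_le_iff minus_le_iff\<close>)
      finally have "(norm z)\<^sup>2 \<le> (real N * h)\<^sup>2" by (intro power_mono) (auto simp: N_def)
      then have "(norm z)\<^sup>2 * (norm2 lborel (cgrad \<phi>))\<^sup>2 \<le> D"
        unfolding D_def by (rule mult_right_mono) simp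
      then show ?thesis using True translation_estimate[OF \<phi>, of z] by (auto intro: order_trans ennreal_leI)
    qed simp
  qed
  also have "\<dots> = ennreal D * ennreal ((2 * h) ^ N)"
    using emeasure_cube[of "-h" h, where 'n='n] h by (simp add: nn_integral_cmult_indicator N_def)
  finally have "(\<integral>\<^sup>+x. ennreal ((\<phi> x - box_int h \<phi> (grid_floor h x) / h ^ N)\<^sup>2) \<partial>lborel)
      \<le> ennreal (1 / h ^ N) * (ennreal D * ennreal ((2 * h) ^ N))" by (simp add: mult_left_mono)
  also have "\<dots> = ennreal (1 / h ^ N * (D * (2 * h) ^ N))"
  proof -
    have "D \<ge> 0" by (simp add: D_def)
    moreover have "ennreal D * ennreal ((2 * h) ^ N) = ennreal (D * (2 * h) ^ N)"
      by (rule ennreal_mult[symmetric]) (use \<open>D \<ge> 0\<close> h in auto)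
    moreover have "ennreal (1 / h ^ N) * ennreal (D * (2 * h) ^ N) = ennreal (1 / h ^ N * (D * (2 * h) ^ N))"
      by (rule ennreal_mult[symmetric]) (use \<open>D \<ge> 0\<close> h in auto)
    ultimately show ?thesis by simp
  qed
  \<comment> \<open>The volume (2h)^N of the cube against the factor 1/h^N leaves 2^N, so the only
    dependence on h is the factor h^2 inside \<open>D\<close>.\<close>
  also have "1 / h ^ N * (D * (2 * h) ^ N) = 2 ^ N * D" using h by (simp add: power_mult_distrib)
  finally show ?thesis by (simp add: D_def)
qed

lemma box_average_bound:
  fixes \<phi> :: "real^'n::finite \<Rightarrow> real"
  assumes \<phi>: "test_fun \<Omega> \<phi>" and h: "h > 0"
  shows "\<bar>box_int h \<phi> a / h ^ CARD('n)\<bar> \<le> sqrt (1 / h ^ CARD('n)) * norm2 lborel \<phi>"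
proof -
  let ?H = "h ^ CARD('n)"
  have cont: "continuous_on UNIV \<phi>" by (rule smooth_fun_continuous[OF test_funD(1)[OF \<phi>]])
  have meas[measurable]: "\<phi> \<in> borel_measurable borel" by (rule borel_measurable_continuous_onI[OF cont])
  have "ennreal ((0 - box_int h \<phi> a / ?H)\<^sup>2)
     \<le> ennreal (1 / ?H) * (\<integral>\<^sup>+z. ennreal ((0 - \<phi> (a + z))\<^sup>2) * indicator (cbox 0 (\<chi> i. h)) z \<partial>lborel)"
    by (rule box_int_square_le[OF cont h])
  also have "\<dots> \<le> ennreal (1 / ?H) * (\<integral>\<^sup>+z. ennreal ((\<phi> (z + a))\<^sup>2) \<partial>lborel)"
    by (intro mult_left_mono nn_integral_mono) (auto simp: indicator_def add.commute)
  also have "(\<integral>\<^sup>+z. ennreal ((\<phi> (z + a))\<^sup>2) \<partial>lborel) = (\<integral>\<^sup>+z. ennreal ((norm (\<phi> z))\<^sup>2) \<partial>lborel)"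
    using nn_integral_lborel_translate[of "\<lambda>z. ennreal ((norm (\<phi> z))\<^sup>2)" a] by simp
  also have "\<dots> = ennreal ((norm2 lborel \<phi>)\<^sup>2)"
    unfolding norm2_square by (rule nn_integral_eq_integral) (use test_fun_L2[OF \<phi>] in \<open>auto simp: L2_def\<close>)
  also have "ennreal (1 / ?H) * ennreal ((norm2 lborel \<phi>)\<^sup>2) = ennreal (1 / ?H * (norm2 lborel \<phi>)\<^sup>2)"
    by (rule ennreal_mult[symmetric]) (use h in auto)
  finally have "(box_int h \<phi> a / ?H)\<^sup>2 \<le> 1 / ?H * (norm2 lborel \<phi>)\<^sup>2"
    using h by (subst (asm) ennreal_le_iff) auto
  also have "\<dots> = (sqrt (1 / ?H) * norm2 lborel \<phi>)\<^sup>2" using h by (simp add: power_mult_distrib)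
  finally have "\<bar>box_int h \<phi> a / ?H\<bar> \<le> \<bar>sqrt (1 / ?H) * norm2 lborel \<phi>\<bar>" by (simp only: abs_le_square_iff)
  also have "\<dots> = sqrt (1 / ?H) * norm2 lborel \<phi>" using h by simp
  finally show ?thesis .
qed

lemma test_fun_norm2_lebesgue_on:
  fixes \<Omega> :: "(real^'n::finite) set"
  assumes "test_fun \<Omega> \<phi>" "open \<Omega>"
  shows "norm2 (lebesgue_on \<Omega>) \<phi> = norm2 lborel \<phi>" "norm2 (lebesgue_on \<Omega>) (cgrad \<phi>) = norm2 lborel (cgrad \<phi>)"
proof -
  note t = test_funD[OF assms(1)]
  have "x \<notin> closure {x. \<phi> x \<noteq> 0}" if "x \<notin> \<Omega>" for x using that t(3) by blast
  then show "norm2 (lebesgue_on \<Omega>) \<phi> = norm2 lborel \<phi>" "norm2 (lebesgue_on \<Omega>) (cgrad \<phi>) = norm2 lborel (cgrad \<phi>)"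
    using assms(2) smooth_fun_continuous[OF t(1)] cgrad_continuous[OF t(1)]
    by (auto intro!: norm2_lebesgue_on_support borel_measurable_continuous_onI intro: zero_outside cgrad_outside lborelD)
qed

text \<open>Cell averages of mesh h approximate all functions of the sequence with an error of order
  h, uniformly in the index. Along one diagonal subsequence the averages converge for every mesh and
  cell; being bounded on a set of finite measure, they are Cauchy in L2, and a three-term estimate
  finishes.\<close>

theorem Rellich_test_fun:
  fixes \<phi> :: "nat \<Rightarrow> real^'n::finite \<Rightarrow> real"
  assumes dom: "open \<Omega>" "bounded \<Omega>" and \<phi>: "\<And>k. test_fun \<Omega> (\<phi> k)"
    and B: "\<And>k. norm2 (lebesgue_on \<Omega>) (\<phi> k) \<le> B" "\<And>k. norm2 (lebesgue_on \<Omega>) (cgrad (\<phi> k)) \<le> B"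
  obtains r where "strict_mono r" "Cauchy_L2 (lebesgue_on \<Omega>) (\<lambda>k. \<phi> (r k))"
proof -
  let ?\<mu> = "lebesgue_on \<Omega>"
  define N where "N = CARD('n)"
  have fin: "finite_measure ?\<mu>" by (rule finite_measure_lebesgue_on) (use dom in \<open>simp add: lmeasurable_open\<close>)
  have \<Omega>: "\<Omega> \<in> sets lebesgue" using dom by (simp add: lmeasurable_open fmeasurableD)
  note B' = B[unfolded test_fun_norm2_lebesgue_on[OF \<phi> dom(1)]]
  have B0: "B \<ge> 0" using B(1)[of 0] norm2_nonneg[of ?\<mu> "\<phi> 0"] by linarith
  define h where "h j = 1 / real (Suc j)" for j
  have h: "h j > 0" for j by (simp add: h_def)
  \<comment> \<open>The index pairs a mesh number with a lattice node, so a single diagonal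
    extraction treats all meshes at once.\<close>
  define a where "a k i = box_int (h (fst i)) (\<phi> k) (grid_point (h (fst i)) (snd i)) / h (fst i) ^ N"
    for k and i :: "nat \<times> ('n \<Rightarrow> int)"
  have av: "\<bar>box_int (h j) (\<phi> k) y / h j ^ N\<bar> \<le> sqrt (1 / h j ^ N) * B" for j k y
    unfolding N_def
    by (rule order_trans[OF box_average_bound[OF \<phi> h, of j k y] mult_left_mono[OF B'(1)]]) (use h[of j] in simp)
  have "bounded (range (\<lambda>k. a k i))" for i
    unfolding bounded_iff a_def using av by (intro exI[of _ "sqrt (1 / h (fst i) ^ N) * B"]) auto
  then obtain r where r: "strict_mono r" "\<And>i. convergent (\<lambda>k. a (r k) i)"
    by (rule diagonal_convergent_subsequence[of a]) auto
  define A where "A j k x = box_int (h j) (\<phi> (r k)) (grid_floor (h j) x) / h j ^ N" for j k x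
  have \<phi>m: "\<phi> k \<in> borel_measurable borel" for k
    by (rule borel_measurable_continuous_onI[OF smooth_fun_continuous[OF test_funD(1)[OF \<phi>]]])
  have Am: "A j k \<in> borel_measurable borel" for j k
    unfolding A_def
    using measurable_compose[OF grid_floor_measurable[of "h j"] box_int_measurable[OF \<phi>m[of "r k"], of "h j"]] by simp
  have Am': "A j k \<in> borel_measurable ?\<mu>" for j k
    using Am[of j k] by (intro measurable_restrict_space1 measurable_completion) simp
  have Ab: "\<bar>A j k x\<bar> \<le> sqrt (1 / h j ^ N) * B" for j k x unfolding A_def by (rule av)
  have AL2: "L2 ?\<mu> (A j k)" for j k
    by (rule L2_bounded[OF fin Am']) (use Ab in auto)
  have \<phi>L2: "L2 ?\<mu> (\<phi> k)" for k by (rule L2_lborel_imp_L2_lebesgue_on[OF \<Omega> test_fun_L2(1)[OF \<phi>]])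
  \<comment> \<open>Chosen so that (C h)^2 is the bound of \<open>box_average_estimate\<close> with
    the gradient norm replaced by B.\<close>
  define C where "C = sqrt (2 ^ N) * (real N * B)"
  have C0: "C \<ge> 0" using B0 by (simp add: C_def)
  have est: "norm2 ?\<mu> (\<lambda>x. \<phi> (r k) x - A j k x) \<le> C * h j" for j k
  proof (rule norm2_lebesgue_on_le(2)[OF \<Omega>])
    show "(\<lambda>x. \<phi> (r k) x - A j k x) \<in> borel_measurable borel" using \<phi>m Am by simp
    show "0 \<le> C * h j" using C0 h[of j] by simp
    have "(norm2 lborel (cgrad (\<phi> (r k))))\<^sup>2 \<le> B\<^sup>2" using B'(2)[of "r k"] by (rule power_mono) simp
    then have "2 ^ N * ((real N * h j)\<^sup>2 * (norm2 lborel (cgrad (\<phi> (r k))))\<^sup>2) \<le> 2 ^ N * ((real N * h j)\<^sup>2 * B\<^sup>2)"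
      by (intro mult_left_mono) auto
    also have "\<dots> = (C * h j)\<^sup>2" by (simp add: C_def power_mult_distrib)
    finally show "(\<integral>\<^sup>+x. ennreal ((norm (\<phi> (r k) x - A j k x))\<^sup>2) \<partial>lborel) \<le> ennreal ((C * h j)\<^sup>2)"
      using box_average_estimate[OF \<phi> h, of "r k" j] unfolding A_def N_def
      by simp (meson ennreal_leI order_trans)
  qed
  have ACau: "Cauchy_L2 ?\<mu> (A j)" for j
  proof (rule Cauchy_L2_convergent)
    have conv: "convergent (\<lambda>k. A j k x)" for x
      using r(2)[of "(j, \<lambda>i. \<lfloor>x $ i / h j\<rfloor>)"] by (simp add: a_def A_def grid_floor_def)
    define L where "L x = lim (\<lambda>k. A j k x)" for x
    have Lim: "(\<lambda>k. A j k x) \<longlonglongrightarrow> L x" for x using conv[of x] by (simp add: L_def convergent_LIMSEQ_iff)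
    have Lm: "L \<in> borel_measurable ?\<mu>" unfolding L_def using Am' by (intro borel_measurable_lim_metric) auto
    have Lb: "\<bar>L x\<bar> \<le> sqrt (1 / h j ^ N) * B" for x
      using Lim[of x] Ab by (intro LIMSEQ_le_const2[OF tendsto_rabs]) auto
    show "L2 ?\<mu> L" by (rule L2_bounded[OF fin Lm]) (use Lb in auto)
    show "(\<lambda>k. norm2 ?\<mu> (\<lambda>x. A j k x - L x)) \<longlonglongrightarrow> 0"
    proof (rule norm2_tendsto_0_dominated[where g = "\<lambda>x. 2 * (sqrt (1 / h j ^ N) * B)"])
      show "(\<lambda>x. A j k x - L x) \<in> borel_measurable ?\<mu>" for k using Am' Lm by simp
      show "L2 ?\<mu> (\<lambda>x. 2 * (sqrt (1 / h j ^ N) * B))" by (rule L2_bounded[OF fin]) auto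
      show "AE x in ?\<mu>. (\<lambda>k. A j k x - L x) \<longlonglongrightarrow> 0" using Lim by (simp add: LIM_zero)
      show "AE x in ?\<mu>. norm (A j k x - L x) \<le> norm (2 * (sqrt (1 / h j ^ N) * B))" for k
      proof (rule AE_I2)
        fix x
        show "norm (A j k x - L x) \<le> norm (2 * (sqrt (1 / h j ^ N) * B))"
          using Ab[of j k x] Lb[of x] abs_triangle_ineq4[of "A j k x" "L x"]
            abs_ge_self[of "2 * (sqrt (1 / h j ^ N) * B)"] unfolding real_norm_def by linarith
      qed
    qed
  qed (use AL2 in auto)
  have "Cauchy_L2 ?\<mu> (\<lambda>k. \<phi> (r k))" unfolding Cauchy_L2_def
  proof (intro allI impI)
    fix e :: real assume e: "e > 0"
    have "(\<lambda>j. C * h j) \<longlonglongrightarrow> C * 0" unfolding h_def by (intro tendsto_intros LIMSEQ_Suc[OF lim_const_over_n])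
    then have "\<forall>\<^sub>F j in sequentially. C * h j < e / 3" by (rule order_tendstoD(2)) (use e in auto)
    then obtain j where j: "C * h j < e / 3" by (auto simp: eventually_sequentially)
    obtain N0 where N0: "\<And>m n. m \<ge> N0 \<Longrightarrow> n \<ge> N0 \<Longrightarrow> norm2 ?\<mu> (\<lambda>x. A j m x - A j n x) < e / 3"
      using Cauchy_L2D[OF ACau[of j], of "e / 3"] e by auto
    have "norm2 ?\<mu> (\<lambda>x. \<phi> (r m) x - \<phi> (r n) x) < e" if "m \<ge> N0" "n \<ge> N0" for m n
    proof -
      have "norm2 ?\<mu> (\<lambda>x. \<phi> (r m) x - \<phi> (r n) x)
          \<le> norm2 ?\<mu> (\<lambda>x. \<phi> (r m) x - A j m x) + norm2 ?\<mu> (\<lambda>x. A j m x - \<phi> (r n) x)"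
        by (rule norm2_triangle_diff[OF \<phi>L2 AL2 \<phi>L2])
      also have "norm2 ?\<mu> (\<lambda>x. A j m x - \<phi> (r n) x)
          \<le> norm2 ?\<mu> (\<lambda>x. A j m x - A j n x) + norm2 ?\<mu> (\<lambda>x. A j n x - \<phi> (r n) x)"
        by (rule norm2_triangle_diff[OF AL2 AL2 \<phi>L2])
      also have "norm2 ?\<mu> (\<lambda>x. A j n x - \<phi> (r n) x) = norm2 ?\<mu> (\<lambda>x. \<phi> (r n) x - A j n x)"
        by (rule norm2_minus_commute)
      finally show ?thesis using est[of m j] est[of n j] N0[OF that] j by simp
    qed
    then show "\<exists>N. \<forall>m\<ge>N. \<forall>n\<ge>N. norm2 ?\<mu> (\<lambda>x. \<phi> (r m) x - \<phi> (r n) x) < e" by blast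
  qed
  with r(1) show ?thesis by (rule that)
qed

section \<open>The space H^1_0 and its weak gradients\<close>

text \<open>Translates the definition of \<open>H10_grad\<close>, which speaks of extended integrals
  and measurable limits, into L2 norms. A limit at finite distance from one square integrable
  approximant is itself square integrable.\<close>

lemma tendsto_nn_integral_norm2_iff:
  fixes F :: "'a \<Rightarrow> 'b::euclidean_space"
  assumes f: "\<And>k. L2 M (f k)" and F: "F \<in> borel_measurable M"
  shows "((\<lambda>k. \<integral>\<^sup>+x. ennreal ((norm (f k x - F x))\<^sup>2) \<partial>M) \<longlonglongrightarrow> 0) \<longleftrightarrow>
    L2 M F \<and> (\<lambda>k. norm2 M (\<lambda>x. f k x - F x)) \<longlonglongrightarrow> 0" (is "?nn \<longleftrightarrow> _")
proof -
  have eq: "(\<integral>\<^sup>+x. ennreal ((norm (f k x - F x))\<^sup>2) \<partial>M) = ennreal ((norm2 M (\<lambda>x. f k x - F x))\<^sup>2)" if "L2 M F" for k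
    unfolding norm2_square by (rule nn_integral_eq_integral) (use L2_diff[OF f[of k] that] in \<open>auto simp: L2_def\<close>)
  have "L2 M F" if ?nn
  proof -
    have "\<forall>\<^sub>F k in sequentially. (\<integral>\<^sup>+x. ennreal ((norm (f k x - F x))\<^sup>2) \<partial>M) < 1"
      by (rule order_tendstoD(2)[OF that]) simp
    then obtain k where k: "(\<integral>\<^sup>+x. ennreal ((norm (f k x - F x))\<^sup>2) \<partial>M) < 1"
      by (auto simp: eventually_sequentially)
    have m: "(\<lambda>x. f k x - F x) \<in> borel_measurable M" using L2_measurable[OF f[of k]] F by simp
    have "(\<integral>\<^sup>+x. ennreal ((norm (f k x - F x))\<^sup>2) \<partial>M) < \<infinity>"
      using k by (rule order.strict_trans) simp
    then have "integrable M (\<lambda>x. (norm (f k x - F x))\<^sup>2)"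
      using m by (intro integrableI_nonneg) auto
    then have "L2 M (\<lambda>x. f k x - F x)" using m by (simp add: L2_def)
    from L2_diff[OF f[of k] this] show ?thesis by simp
  qed
  moreover have "?nn \<longleftrightarrow> (\<lambda>k. norm2 M (\<lambda>x. f k x - F x)) \<longlonglongrightarrow> 0" if L: "L2 M F"
  proof -
    have "?nn \<longleftrightarrow> (\<lambda>k. (norm2 M (\<lambda>x. f k x - F x))\<^sup>2) \<longlonglongrightarrow> 0"
      unfolding eq[OF L] by (subst ennreal_0[symmetric], subst tendsto_ennreal_iff) auto
    also have "\<dots> \<longleftrightarrow> (\<lambda>k. norm2 M (\<lambda>x. f k x - F x)) \<longlonglongrightarrow> 0"
      using tendsto_power[of "\<lambda>k. norm2 M (\<lambda>x. f k x - F x)" 0 sequentially 2]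
        tendsto_real_sqrt[of "\<lambda>k. (norm2 M (\<lambda>x. f k x - F x))\<^sup>2" 0 sequentially] by auto
    finally show ?thesis .
  qed
  ultimately show ?thesis by blast
qed

locale bounded_domain =
  fixes \<Omega> :: "(real^'n::finite) set"
  assumes open_dom: "open \<Omega>" and bounded_dom: "bounded \<Omega>"
begin

abbreviation \<mu> :: "(real^'n) measure" where "\<mu> \<equiv> lebesgue_on \<Omega>"

lemma finite_mu: "finite_measure \<mu>"
  by (rule finite_measure_lebesgue_on) (use open_dom bounded_dom in \<open>simp add: lmeasurable_open\<close>)

lemma sets_dom: "\<Omega> \<in> sets lebesgue"
  using open_dom bounded_dom by (simp add: lmeasurable_open fmeasurableD)

lemma set_borel_measurable_iff:
  "set_borel_measurable lebesgue \<Omega> f \<longleftrightarrow> f \<in> borel_measurable \<mu>"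
  for f :: "_ \<Rightarrow> 'b::real_normed_vector"
  unfolding set_borel_measurable_def using borel_measurable_restrict_space_iff[of \<Omega> lebesgue f] sets_dom by simp

lemma set_integral_eq: "(\<integral>x\<in>\<Omega>. f x \<partial>lebesgue) = (\<integral>x. f x \<partial>\<mu>)" for f :: "_ \<Rightarrow> real"
  unfolding set_lebesgue_integral_def using sets_dom by (subst integral_restrict_space) auto

lemma set_nn_integral_eq: "(\<integral>\<^sup>+x\<in>\<Omega>. f x \<partial>lebesgue) = (\<integral>\<^sup>+x. f x \<partial>\<mu>)"
  using sets_dom by (subst nn_integral_restrict_space) auto

lemma AE_dom_iff: "(AE x\<in>\<Omega> in lebesgue. P x) \<longleftrightarrow> (AE x in \<mu>. P x)"
  using sets_dom by (subst AE_restrict_space_iff) auto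

lemma test_fun_L2_mu:
  assumes "test_fun \<Omega> \<phi>" shows "L2 \<mu> \<phi>" "L2 \<mu> (cgrad \<phi>)"
  using test_fun_L2[OF assms] L2_lborel_imp_L2_lebesgue_on[OF sets_dom] by auto

lemma H10_grad_iff:
  "H10_grad \<Omega> u G \<longleftrightarrow> L2 \<mu> u \<and> L2 \<mu> G \<and>
    (\<exists>\<phi>. (\<forall>k. test_fun \<Omega> (\<phi> k)) \<and> (\<lambda>k. norm2 \<mu> (\<lambda>x. \<phi> k x - u x)) \<longlonglongrightarrow> 0 \<and>
      (\<lambda>k. norm2 \<mu> (\<lambda>x. cgrad (\<phi> k) x - G x)) \<longlonglongrightarrow> 0)"
proof -
  have 1: "((\<lambda>k. \<integral>\<^sup>+x. ennreal ((\<phi> k x - u x)\<^sup>2) \<partial>\<mu>) \<longlonglongrightarrow> 0) \<longleftrightarrow>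
      L2 \<mu> u \<and> (\<lambda>k. norm2 \<mu> (\<lambda>x. \<phi> k x - u x)) \<longlonglongrightarrow> 0"
    if "\<forall>k. test_fun \<Omega> (\<phi> k)" "u \<in> borel_measurable \<mu>" for \<phi>
    using tendsto_nn_integral_norm2_iff[of \<mu> \<phi> u] that test_fun_L2_mu by auto
  have 2: "((\<lambda>k. \<integral>\<^sup>+x. ennreal ((norm (cgrad (\<phi> k) x - G x))\<^sup>2) \<partial>\<mu>) \<longlonglongrightarrow> 0) \<longleftrightarrow>
      L2 \<mu> G \<and> (\<lambda>k. norm2 \<mu> (\<lambda>x. cgrad (\<phi> k) x - G x)) \<longlonglongrightarrow> 0"
    if "\<forall>k. test_fun \<Omega> (\<phi> k)" "G \<in> borel_measurable \<mu>" for \<phi>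
    using tendsto_nn_integral_norm2_iff[of \<mu> "\<lambda>k. cgrad (\<phi> k)" G] that test_fun_L2_mu by auto
  show ?thesis
    unfolding H10_grad_def set_borel_measurable_iff set_nn_integral_eq
    using 1 2 L2_measurable[of \<mu> u] L2_measurable[of \<mu> G] by blast
qed

lemma H10_gradD:
  assumes "H10_grad \<Omega> u G" shows "L2 \<mu> u" "L2 \<mu> G"
  using assms by (auto simp: H10_grad_iff)

lemma H10_gradE:
  assumes "H10_grad \<Omega> u G"
  obtains \<phi> where "\<And>k. test_fun \<Omega> (\<phi> k)" "(\<lambda>k. norm2 \<mu> (\<lambda>x. \<phi> k x - u x)) \<longlonglongrightarrow> 0"
    "(\<lambda>k. norm2 \<mu> (\<lambda>x. cgrad (\<phi> k) x - G x)) \<longlonglongrightarrow> 0"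
  using assms by (auto simp: H10_grad_iff)

lemma H10_gradI:
  assumes "L2 \<mu> u" "L2 \<mu> G" "\<And>k. test_fun \<Omega> (\<phi> k)" "(\<lambda>k. norm2 \<mu> (\<lambda>x. \<phi> k x - u x)) \<longlonglongrightarrow> 0"
    "(\<lambda>k. norm2 \<mu> (\<lambda>x. cgrad (\<phi> k) x - G x)) \<longlonglongrightarrow> 0"
  shows "H10_grad \<Omega> u G"
  using assms by (auto simp: H10_grad_iff)

lemma H10_grad_test_fun:
  assumes "test_fun \<Omega> \<phi>" shows "H10_grad \<Omega> \<phi> (cgrad \<phi>)"
  by (rule H10_gradI[where \<phi> = "\<lambda>_. \<phi>"]) (use assms test_fun_L2_mu in auto)

text \<open>Both derivatives are moved onto \<psi>, so that for fixed \<psi> the right-hand side is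
  continuous in \<phi> for the L2 norm alone.\<close>

lemma ip2_cgrad:
  assumes \<phi>: "test_fun \<Omega> \<phi>" and \<psi>: "test_fun \<Omega> \<psi>"
  shows "ip2 \<mu> (cgrad \<phi>) (cgrad \<psi>) = - (\<Sum>i\<in>UNIV. ip2 \<mu> \<phi> (pd i (pd i \<psi>)))"
proof -
  have zero: "f x = 0" if "test_fun \<Omega> f" "x \<notin> \<Omega>" for f x
    using test_funD(3)[OF that(1)] that(2) zero_outside[of x f] by blast
  have meas: "f \<in> borel_measurable borel" if "test_fun \<Omega> f" for f
    by (rule borel_measurable_continuous_onI[OF smooth_fun_continuous[OF test_funD(1)[OF that]]])
  have tr: "ip2 \<mu> f g = (\<integral>x. f x * g x \<partial>lborel)" if "test_fun \<Omega> f" "test_fun \<Omega> g" for f g :: "real^'n \<Rightarrow> real"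
    unfolding ip2_def inner_real_def
    by (rule integral_lebesgue_on_support[OF sets_dom]) (use meas[OF that(1)] meas[OF that(2)] zero[OF that(1)] in auto)
  have "ip2 \<mu> (cgrad \<phi>) (cgrad \<psi>) = (\<integral>x. (\<Sum>i\<in>UNIV. pd i \<phi> x \<bullet> pd i \<psi> x) \<partial>\<mu>)"
    by (simp add: ip2_def inner_vec_def pd_eq_cgrad)
  also have "\<dots> = (\<Sum>i\<in>UNIV. ip2 \<mu> (pd i \<phi>) (pd i \<psi>))"
    unfolding ip2_def
    by (rule Bochner_Integration.integral_sum, rule integrable_inner_L2) (auto intro!: test_fun_L2_mu test_fun_pd \<phi> \<psi>)
  also have "\<dots> = (\<Sum>i\<in>UNIV. - ip2 \<mu> \<phi> (pd i (pd i \<psi>)))"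
    by (rule sum.cong[OF refl]) (simp add: tr test_fun_pd \<phi> \<psi> test_fun_integration_by_parts[OF \<phi> test_fun_pd[OF \<psi>]])
  finally show ?thesis by (simp add: sum_negf)
qed

lemma L2_tendsto_diff:
  assumes "\<And>k. L2 M (f k)" "L2 M F" "\<And>k. L2 M (g k)" "L2 M G"
    "(\<lambda>k. norm2 M (\<lambda>x. f k x - F x)) \<longlonglongrightarrow> 0" "(\<lambda>k. norm2 M (\<lambda>x. g k x - G x)) \<longlonglongrightarrow> 0"
  shows "(\<lambda>k. norm2 M (\<lambda>x. (f k x - c *\<^sub>R g k x) - (F x - c *\<^sub>R G x))) \<longlonglongrightarrow> 0"
proof (rule tendsto_sandwich[OF _ _ tendsto_const])
  show "\<forall>\<^sub>F k in sequentially. norm2 M (\<lambda>x. (f k x - c *\<^sub>R g k x) - (F x - c *\<^sub>R G x))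
      \<le> norm2 M (\<lambda>x. f k x - F x) + \<bar>- c\<bar> * norm2 M (\<lambda>x. g k x - G x)"
  proof (rule always_eventually, rule allI)
    fix k
    have "norm2 M (\<lambda>x. (f k x - F x) + (- c) *\<^sub>R (g k x - G x))
      \<le> norm2 M (\<lambda>x. f k x - F x) + norm2 M (\<lambda>x. (- c) *\<^sub>R (g k x - G x))"
      by (rule norm2_triangle) (intro L2_diff L2_scaleR assms)+
    moreover have "(\<lambda>x. (f k x - F x) + (- c) *\<^sub>R (g k x - G x)) = (\<lambda>x. (f k x - c *\<^sub>R g k x) - (F x - c *\<^sub>R G x))"
      by (auto simp: algebra_simps)
    ultimately show "norm2 M (\<lambda>x. (f k x - c *\<^sub>R g k x) - (F x - c *\<^sub>R G x))
      \<le> norm2 M (\<lambda>x. f k x - F x) + \<bar>- c\<bar> * norm2 M (\<lambda>x. g k x - G x)"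
      by (simp only: norm2_scaleR)
  qed
  show "(\<lambda>k. norm2 M (\<lambda>x. f k x - F x) + \<bar>- c\<bar> * norm2 M (\<lambda>x. g k x - G x)) \<longlonglongrightarrow> 0"
    using tendsto_add[OF assms(5) tendsto_mult_left[OF assms(6), of "\<bar>- c\<bar>"]] by simp
qed simp

text \<open>This one combination yields the differences tested in the equations (c = 1) as well as
  the variations u - t \<phi> of a minimizer.\<close>

lemma H10_grad_diff_scaleR:
  assumes u: "H10_grad \<Omega> u G" and v: "H10_grad \<Omega> v H"
  shows "H10_grad \<Omega> (\<lambda>x. u x - c * v x) (\<lambda>x. G x - c *\<^sub>R H x)"
proof -
  obtain \<phi> where \<phi>: "\<And>k. test_fun \<Omega> (\<phi> k)" "(\<lambda>k. norm2 \<mu> (\<lambda>x. \<phi> k x - u x)) \<longlonglongrightarrow> 0"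
    "(\<lambda>k. norm2 \<mu> (\<lambda>x. cgrad (\<phi> k) x - G x)) \<longlonglongrightarrow> 0" by (rule H10_gradE[OF u]) blast
  obtain \<psi> where \<psi>: "\<And>k. test_fun \<Omega> (\<psi> k)" "(\<lambda>k. norm2 \<mu> (\<lambda>x. \<psi> k x - v x)) \<longlonglongrightarrow> 0"
    "(\<lambda>k. norm2 \<mu> (\<lambda>x. cgrad (\<psi> k) x - H x)) \<longlonglongrightarrow> 0" by (rule H10_gradE[OF v]) blast
  note D = H10_gradD[OF u] H10_gradD[OF v]
  have cg: "cgrad (\<lambda>x. \<phi> k x + (- c) * \<psi> k x) x = cgrad (\<phi> k) x - c *\<^sub>R cgrad (\<psi> k) x" for k x
    unfolding cgrad_add[OF test_funD(1)[OF \<phi>(1)] test_funD(1)[OF test_fun_cmult[OF \<psi>(1)]]]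
      cgrad_cmult[OF test_funD(1)[OF \<psi>(1)]] by simp
  show ?thesis
  proof (rule H10_gradI[where \<phi> = "\<lambda>k x. \<phi> k x + (- c) * \<psi> k x"])
    show "(\<lambda>k. norm2 \<mu> (\<lambda>x. \<phi> k x + - c * \<psi> k x - (u x - c * v x))) \<longlonglongrightarrow> 0"
      using L2_tendsto_diff[OF test_fun_L2_mu(1)[OF \<phi>(1)] D(1) test_fun_L2_mu(1)[OF \<psi>(1)] D(3) \<phi>(2) \<psi>(2), of c] by simp
    show "(\<lambda>k. norm2 \<mu> (\<lambda>x. cgrad (\<lambda>x. \<phi> k x + - c * \<psi> k x) x - (G x - c *\<^sub>R H x))) \<longlonglongrightarrow> 0"
      unfolding cg
      using L2_tendsto_diff[OF test_fun_L2_mu(2)[OF \<phi>(1)] D(2) test_fun_L2_mu(2)[OF \<psi>(1)] D(4) \<phi>(3) \<psi>(3), of c] by simp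
    show "test_fun \<Omega> (\<lambda>x. \<phi> k x + - c * \<psi> k x)" for k
      by (rule test_fun_add[OF \<phi>(1) test_fun_cmult[OF \<psi>(1)]])
  qed (use D in \<open>auto intro!: L2_diff L2_cmult L2_scaleR\<close>)
qed

lemma H10_grad_diff:
  "H10_grad \<Omega> u G \<Longrightarrow> H10_grad \<Omega> v H \<Longrightarrow> H10_grad \<Omega> (\<lambda>x. u x - v x) (\<lambda>x. G x - H x)"
  using H10_grad_diff_scaleR[of u G v H 1] by simp

text \<open>The gradients of the approximating functions converge to V and have test functions as components,
  so testing with them gives (V,V) = 0 without density of test functions in L2.\<close>
lemma H10_grad_unique_0:
  assumes "H10_grad \<Omega> (\<lambda>x. 0) V"
  shows "AE x in \<mu>. V x = 0"
proof -
  obtain \<psi> where \<psi>: "\<And>k. test_fun \<Omega> (\<psi> k)" "(\<lambda>k. norm2 \<mu> (\<lambda>x. \<psi> k x - 0)) \<longlonglongrightarrow> 0"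
    "(\<lambda>k. norm2 \<mu> (\<lambda>x. cgrad (\<psi> k) x - V x)) \<longlonglongrightarrow> 0" by (rule H10_gradE[OF assms]) blast
  note V = H10_gradD(2)[OF assms]
  have cst: "(\<lambda>j. norm2 \<mu> (\<lambda>x. f x - f x)) \<longlonglongrightarrow> 0" for f :: "real^'n \<Rightarrow> 'b::euclidean_space" by simp
  have "ip2 \<mu> V (cgrad (\<psi> k)) = 0" for k
  proof -
    have "(\<lambda>j. ip2 \<mu> (cgrad (\<psi> j)) (cgrad (\<psi> k))) \<longlonglongrightarrow> ip2 \<mu> V (cgrad (\<psi> k))"
      by (rule tendsto_norm2_imp_tendsto_ip2[OF test_fun_L2_mu(2)[OF \<psi>(1)] V _ _ \<psi>(3) cst])
        (auto intro: test_fun_L2_mu \<psi>)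
    moreover have "(\<lambda>j. - (\<Sum>i\<in>UNIV. ip2 \<mu> (\<psi> j) (pd i (pd i (\<psi> k))))) \<longlonglongrightarrow> - (\<Sum>i\<in>(UNIV::'n set). 0)"
    proof (intro tendsto_minus tendsto_sum)
      fix i
      have "(\<lambda>j. ip2 \<mu> (\<psi> j) (pd i (pd i (\<psi> k)))) \<longlonglongrightarrow> ip2 \<mu> (\<lambda>x. 0) (pd i (pd i (\<psi> k)))"
        by (rule tendsto_norm2_imp_tendsto_ip2[OF test_fun_L2_mu(1)[OF \<psi>(1)] L2_zero _ _ \<psi>(2) cst])
          (auto intro: test_fun_L2_mu test_fun_pd \<psi>)
      then show "(\<lambda>j. ip2 \<mu> (\<psi> j) (pd i (pd i (\<psi> k)))) \<longlonglongrightarrow> 0" by (simp add: ip2_def)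
    qed
    ultimately show ?thesis
      unfolding ip2_cgrad[OF \<psi>(1) \<psi>(1)] using LIMSEQ_unique by fastforce
  qed
  moreover have "(\<lambda>k. ip2 \<mu> V (cgrad (\<psi> k))) \<longlonglongrightarrow> ip2 \<mu> V V"
    by (rule tendsto_norm2_imp_tendsto_ip2[OF V V test_fun_L2_mu(2)[OF \<psi>(1)] V cst \<psi>(3)])
  ultimately have "ip2 \<mu> V V = 0" by (simp add: LIMSEQ_const_iff)
  then have "norm2 \<mu> V = 0" by (simp add: norm2_square_eq_ip2[symmetric])
  then show ?thesis by (simp add: norm2_eq_0_iff[OF V])
qed

text \<open>Lets a function be exchanged for an a.e. equal representative that satisfies its bounds
  at every point.\<close>

lemma H10_grad_cong:
  assumes u: "H10_grad \<Omega> u G" and v: "v \<in> borel_measurable \<mu>" "AE x in \<mu>. u x = v x"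
  shows "H10_grad \<Omega> v G"
proof -
  obtain \<phi> where \<phi>: "\<And>k. test_fun \<Omega> (\<phi> k)" "(\<lambda>k. norm2 \<mu> (\<lambda>x. \<phi> k x - u x)) \<longlonglongrightarrow> 0"
    "(\<lambda>k. norm2 \<mu> (\<lambda>x. cgrad (\<phi> k) x - G x)) \<longlonglongrightarrow> 0" by (rule H10_gradE[OF u]) blast
  have "norm2 \<mu> (\<lambda>x. \<phi> k x - u x) = norm2 \<mu> (\<lambda>x. \<phi> k x - v x)" for k
    by (rule norm2_cong_AE)
      (use v L2_measurable[OF H10_gradD(1)[OF u]] L2_measurable[OF test_fun_L2_mu(1)[OF \<phi>(1)]] in auto)
  moreover have "L2 \<mu> v" by (rule L2_cong_AE[OF H10_gradD(1)[OF u] v(1)]) (use v(2) in auto)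
  ultimately show ?thesis using H10_gradI[OF _ H10_gradD(2)[OF u] \<phi>(1) _ \<phi>(3)] \<phi>(2) by simp
qed

lemma H10_grad_unique:
  assumes u: "H10_grad \<Omega> u G" and v: "H10_grad \<Omega> v H" and eq: "AE x in \<mu>. u x = v x"
  shows "AE x in \<mu>. G x = H x"
proof -
  have "H10_grad \<Omega> (\<lambda>x. 0) (\<lambda>x. G x - H x)"
    by (rule H10_grad_cong[OF H10_grad_diff[OF u v]]) (use eq in auto)
  from H10_grad_unique_0[OF this] show ?thesis by simp
qed

lemma H10_wgrad: "H10 \<Omega> u \<Longrightarrow> H10_grad \<Omega> u (wgrad \<Omega> u)"
  unfolding H10_def wgrad_def using someI_ex[of "H10_grad \<Omega> u"] by blast

lemma H10I: "H10_grad \<Omega> u G \<Longrightarrow> H10 \<Omega> u"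
  by (auto simp: H10_def)

text \<open>Although \<open>wgrad\<close> is an arbitrary choice, it agrees a.e. with any gradient
  that has been exhibited explicitly, so integrals may be computed with the latter.\<close>

lemma wgrad_eq: "H10_grad \<Omega> u G \<Longrightarrow> AE x in \<mu>. wgrad \<Omega> u x = G x"
  by (rule H10_grad_unique[OF H10_wgrad[OF H10I]]) auto

lemma H10_grad_approx:
  assumes "H10_grad \<Omega> u G" "e > 0"
  obtains \<phi> where "test_fun \<Omega> \<phi>" "norm2 \<mu> (\<lambda>x. \<phi> x - u x) < e" "norm2 \<mu> (\<lambda>x. cgrad \<phi> x - G x) < e"
proof -
  obtain \<phi> where \<phi>: "\<And>j. test_fun \<Omega> (\<phi> j)" "(\<lambda>j. norm2 \<mu> (\<lambda>x. \<phi> j x - u x)) \<longlonglongrightarrow> 0"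
    "(\<lambda>j. norm2 \<mu> (\<lambda>x. cgrad (\<phi> j) x - G x)) \<longlonglongrightarrow> 0" by (rule H10_gradE[OF assms(1)]) blast
  have "\<forall>\<^sub>F j in sequentially. norm2 \<mu> (\<lambda>x. \<phi> j x - u x) < e \<and> norm2 \<mu> (\<lambda>x. cgrad (\<phi> j) x - G x) < e"
    by (intro eventually_conj order_tendstoD(2)[OF \<phi>(2)] order_tendstoD(2)[OF \<phi>(3)] assms(2))
  from eventually_happens'[OF sequentially_bot this]
  obtain j where "norm2 \<mu> (\<lambda>x. \<phi> j x - u x) < e" "norm2 \<mu> (\<lambda>x. cgrad (\<phi> j) x - G x) < e" by blast
  with \<phi>(1)[of j] show ?thesis by (rule that)
qed

text \<open>Each member of the sequence is replaced by a test function within 1/(k+1) in value and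
  gradient; these test functions still converge to the limit pair.\<close>

lemma H10_grad_closed:
  assumes u: "\<And>k. H10_grad \<Omega> (u k) (G k)" and L: "L2 \<mu> v" "L2 \<mu> H"
    and lim: "(\<lambda>k. norm2 \<mu> (\<lambda>x. u k x - v x)) \<longlonglongrightarrow> 0" "(\<lambda>k. norm2 \<mu> (\<lambda>x. G k x - H x)) \<longlonglongrightarrow> 0"
  shows "H10_grad \<Omega> v H"
proof -
  have "\<forall>k. \<exists>\<phi>. test_fun \<Omega> \<phi> \<and> norm2 \<mu> (\<lambda>x. \<phi> x - u k x) < 1 / real (Suc k) \<and> norm2 \<mu> (\<lambda>x. cgrad \<phi> x - G k x) < 1 / real (Suc k)"
  proof
    fix k
    show "\<exists>\<phi>. test_fun \<Omega> \<phi> \<and> norm2 \<mu> (\<lambda>x. \<phi> x - u k x) < 1 / real (Suc k) \<and> norm2 \<mu> (\<lambda>x. cgrad \<phi> x - G k x) < 1 / real (Suc k)"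
      by (rule H10_grad_approx[OF u[of k], of "1 / real (Suc k)"]) (simp, blast)
  qed
  from choice[OF this] obtain \<phi> where \<phi>: "\<And>k. test_fun \<Omega> (\<phi> k)" "\<And>k. norm2 \<mu> (\<lambda>x. \<phi> k x - u k x) < 1 / real (Suc k)"
    "\<And>k. norm2 \<mu> (\<lambda>x. cgrad (\<phi> k) x - G k x) < 1 / real (Suc k)" by blast
  have z: "(\<lambda>k. 1 / real (Suc k)) \<longlonglongrightarrow> 0" by (rule LIMSEQ_Suc[OF lim_const_over_n])
  show ?thesis
  proof (rule H10_gradI[OF L \<phi>(1)])
    show "(\<lambda>k. norm2 \<mu> (\<lambda>x. \<phi> k x - v x)) \<longlonglongrightarrow> 0"
    proof (rule tendsto_sandwich[OF _ _ tendsto_const])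
      show "\<forall>\<^sub>F k in sequentially. norm2 \<mu> (\<lambda>x. \<phi> k x - v x) \<le> 1 / real (Suc k) + norm2 \<mu> (\<lambda>x. u k x - v x)"
      proof (rule always_eventually, rule allI)
        fix k show "norm2 \<mu> (\<lambda>x. \<phi> k x - v x) \<le> 1 / real (Suc k) + norm2 \<mu> (\<lambda>x. u k x - v x)"
          using norm2_triangle_diff[OF test_fun_L2_mu(1)[OF \<phi>(1)[of k]] H10_gradD(1)[OF u[of k]] L(1)] \<phi>(2)[of k] by linarith
      qed
      show "(\<lambda>k. 1 / real (Suc k) + norm2 \<mu> (\<lambda>x. u k x - v x)) \<longlonglongrightarrow> 0" using tendsto_add[OF z lim(1)] by simp
    qed simp
    show "(\<lambda>k. norm2 \<mu> (\<lambda>x. cgrad (\<phi> k) x - H x)) \<longlonglongrightarrow> 0"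
    proof (rule tendsto_sandwich[OF _ _ tendsto_const])
      show "\<forall>\<^sub>F k in sequentially. norm2 \<mu> (\<lambda>x. cgrad (\<phi> k) x - H x) \<le> 1 / real (Suc k) + norm2 \<mu> (\<lambda>x. G k x - H x)"
      proof (rule always_eventually, rule allI)
        fix k show "norm2 \<mu> (\<lambda>x. cgrad (\<phi> k) x - H x) \<le> 1 / real (Suc k) + norm2 \<mu> (\<lambda>x. G k x - H x)"
          using norm2_triangle_diff[OF test_fun_L2_mu(2)[OF \<phi>(1)[of k]] H10_gradD(2)[OF u[of k]] L(2)] \<phi>(3)[of k] by linarith
      qed
      show "(\<lambda>k. 1 / real (Suc k) + norm2 \<mu> (\<lambda>x. G k x - H x)) \<longlonglongrightarrow> 0" using tendsto_add[OF z lim(2)] by simp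
    qed simp
  qed
qed

text \<open>Chain rule. The error of the gradients splits into \<open>soft_min'\<close> at the
  approximant times the gradient error, which is contracted, and the change of
  \<open>soft_min'\<close> times the fixed field \<open>G\<close>, which tends to 0 by dominated
  convergence.\<close>

lemma H10_grad_soft_min:
  assumes u: "H10_grad \<Omega> u G" and e: "e > 0"
  shows "H10_grad \<Omega> (\<lambda>x. soft_min T e (u x)) (\<lambda>x. soft_min' T e (u x) *\<^sub>R G x)"
proof -
  obtain \<phi>0 where \<phi>0: "\<And>k. test_fun \<Omega> (\<phi>0 k)" "(\<lambda>k. norm2 \<mu> (\<lambda>x. \<phi>0 k x - u x)) \<longlonglongrightarrow> 0"
    "(\<lambda>k. norm2 \<mu> (\<lambda>x. cgrad (\<phi>0 k) x - G x)) \<longlonglongrightarrow> 0" by (rule H10_gradE[OF u]) blast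
  note D = H10_gradD[OF u]
  \<comment> \<open>The second part of the splitting needs pointwise convergence of the
    approximants, hence a subsequence.\<close>
  obtain r where r: "strict_mono r" and AE: "AE x in \<mu>. (\<lambda>k. \<phi>0 (r k) x) \<longlonglongrightarrow> u x"
    using tendsto_norm2_AE_subseq[OF finite_mu test_fun_L2_mu(1)[OF \<phi>0(1)] D(1) \<phi>0(2)] by blast
  define \<phi> where "\<phi> k = \<phi>0 (r k)" for k
  have \<phi>: "test_fun \<Omega> (\<phi> k)" for k by (simp add: \<phi>_def \<phi>0)
  have l1: "(\<lambda>k. norm2 \<mu> (\<lambda>x. \<phi> k x - u x)) \<longlonglongrightarrow> 0"
    using LIMSEQ_subseq_LIMSEQ[OF \<phi>0(2) r] by (simp add: o_def \<phi>_def)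
  have l2: "(\<lambda>k. norm2 \<mu> (\<lambda>x. cgrad (\<phi> k) x - G x)) \<longlonglongrightarrow> 0"
    using LIMSEQ_subseq_LIMSEQ[OF \<phi>0(3) r] by (simp add: o_def \<phi>_def)
  note s = test_funD(1)[OF \<phi>] and \<phi>L = test_fun_L2_mu[OF \<phi>]
  have m': "soft_min' T e \<in> borel_measurable borel"
    by (rule borel_measurable_continuous_onI[OF continuous_soft_min'[OF e]])
  have m: "soft_min T e \<in> borel_measurable borel"
    by (rule borel_measurable_continuous_onI) (use has_derivative_soft_min[OF e] in \<open>auto intro: DERIV_continuous_on\<close>)
  have um: "u \<in> borel_measurable \<mu>" and Gm: "G \<in> borel_measurable \<mu>"
    and \<phi>m: "\<phi> k \<in> borel_measurable \<mu>" and \<phi>gm: "cgrad (\<phi> k) \<in> borel_measurable \<mu>" for k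
    using D \<phi>L by (auto intro: L2_measurable)
  have tu: "(\<lambda>x. soft_min T e (u x)) \<in> borel_measurable \<mu>" by (rule measurable_compose[OF um m])
  have tu': "(\<lambda>x. soft_min' T e (u x)) \<in> borel_measurable \<mu>" by (rule measurable_compose[OF um m'])
  have t\<phi>': "(\<lambda>x. soft_min' T e (\<phi> k x)) \<in> borel_measurable \<mu>" for k by (rule measurable_compose[OF \<phi>m m'])
  have b: "\<bar>soft_min' T e s\<bar> \<le> 1" for s using soft_min'_bounds[OF e, of T s] by auto
  have b2: "\<bar>soft_min' T e s - soft_min' T e t\<bar> \<le> 1" for s t
    using soft_min'_bounds[OF e, of T s] soft_min'_bounds[OF e, of T t] by (auto simp: abs_le_iff)
  have L: "L2 \<mu> (\<lambda>x. soft_min' T e (u x) *\<^sub>R G x)"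
    by (rule L2_dominated[OF D(2), of _ 1]) (use tu' Gm b in \<open>auto intro!: mult_left_le_one_le\<close>)
  have L': "L2 \<mu> (\<lambda>x. (soft_min' T e (\<phi> k x) - soft_min' T e (u x)) *\<^sub>R G x)" for k
    by (rule L2_dominated[OF D(2), of _ 1]) (use tu' t\<phi>' Gm b2 in \<open>auto intro!: mult_left_le_one_le\<close>)
  have L'': "L2 \<mu> (\<lambda>x. soft_min' T e (\<phi> k x) *\<^sub>R (cgrad (\<phi> k) x - G x))" for k
    by (rule L2_dominated[OF L2_diff[OF \<phi>L(2)[of k] D(2)], of _ 1]) (use t\<phi>' Gm \<phi>gm b in \<open>auto intro!: mult_left_le_one_le\<close>)
  show ?thesis
  proof (rule H10_gradI)
    show "test_fun \<Omega> (\<lambda>x. soft_min T e (\<phi> k x))" for k by (rule test_fun_soft_min[OF \<phi> e])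
    show "L2 \<mu> (\<lambda>x. soft_min T e (u x))"
      by (rule L2_dominated[OF D(1) tu, of 1]) (use soft_min_Lipschitz[OF e, of T _ 0] in auto)
    show "L2 \<mu> (\<lambda>x. soft_min' T e (u x) *\<^sub>R G x)" by (rule L)
    show "(\<lambda>k. norm2 \<mu> (\<lambda>x. soft_min T e (\<phi> k x) - soft_min T e (u x))) \<longlonglongrightarrow> 0"
    proof (rule tendsto_sandwich[OF _ _ tendsto_const l1])
      show "\<forall>\<^sub>F k in sequentially. norm2 \<mu> (\<lambda>x. soft_min T e (\<phi> k x) - soft_min T e (u x)) \<le> norm2 \<mu> (\<lambda>x. \<phi> k x - u x)"
      proof (rule always_eventually, rule allI, rule norm2_mono)
        fix k
        show "L2 \<mu> (\<lambda>x. \<phi> k x - u x)" by (rule L2_diff[OF \<phi>L(1) D(1)])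
        show "(\<lambda>x. soft_min T e (\<phi> k x) - soft_min T e (u x)) \<in> borel_measurable \<mu>"
          by (rule borel_measurable_diff[OF measurable_compose[OF \<phi>m m] tu])
        show "AE x in \<mu>. norm (soft_min T e (\<phi> k x) - soft_min T e (u x)) \<le> norm (\<phi> k x - u x)"
          using soft_min_Lipschitz[OF e] by simp
      qed
    qed simp
    show "(\<lambda>k. norm2 \<mu> (\<lambda>x. cgrad (\<lambda>x. soft_min T e (\<phi> k x)) x - soft_min' T e (u x) *\<^sub>R G x)) \<longlonglongrightarrow> 0"
    proof (rule tendsto_sandwich[OF _ _ tendsto_const])
      have "(\<lambda>k. norm2 \<mu> (\<lambda>x. (soft_min' T e (\<phi> k x) - soft_min' T e (u x)) *\<^sub>R G x)) \<longlonglongrightarrow> 0"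
      proof (rule norm2_tendsto_0_dominated[OF L2_measurable[OF L'] D(2)])
        show "AE x in \<mu>. (\<lambda>k. (soft_min' T e (\<phi> k x) - soft_min' T e (u x)) *\<^sub>R G x) \<longlonglongrightarrow> 0"
          using AE
        proof eventually_elim
          case (elim x)
          have "isCont (soft_min' T e) (u x)"
            using continuous_soft_min'[OF e] by (simp add: continuous_on_eq_continuous_at)
          from isCont_tendsto_compose[OF this elim]
          have "(\<lambda>k. soft_min' T e (\<phi> k x) - soft_min' T e (u x)) \<longlonglongrightarrow> 0" by (simp add: \<phi>_def LIM_zero)
          from tendsto_scaleR[OF this tendsto_const[of "G x"]] show ?case by simp
        qed
        show "AE x in \<mu>. norm ((soft_min' T e (\<phi> k x) - soft_min' T e (u x)) *\<^sub>R G x) \<le> norm (G x)" for k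
          using b2 by (auto intro!: mult_left_le_one_le)
      qed
      from tendsto_add[OF l2 this]
      show "(\<lambda>k. norm2 \<mu> (\<lambda>x. cgrad (\<phi> k) x - G x) + norm2 \<mu> (\<lambda>x. (soft_min' T e (\<phi> k x) - soft_min' T e (u x)) *\<^sub>R G x)) \<longlonglongrightarrow> 0"
        by simp
      show "\<forall>\<^sub>F k in sequentially. norm2 \<mu> (\<lambda>x. cgrad (\<lambda>x. soft_min T e (\<phi> k x)) x - soft_min' T e (u x) *\<^sub>R G x)
        \<le> norm2 \<mu> (\<lambda>x. cgrad (\<phi> k) x - G x) + norm2 \<mu> (\<lambda>x. (soft_min' T e (\<phi> k x) - soft_min' T e (u x)) *\<^sub>R G x)"
      proof (rule always_eventually, rule allI)
        fix k
        have "(\<lambda>x. cgrad (\<lambda>x. soft_min T e (\<phi> k x)) x - soft_min' T e (u x) *\<^sub>R G x)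
           = (\<lambda>x. soft_min' T e (\<phi> k x) *\<^sub>R (cgrad (\<phi> k) x - G x) + (soft_min' T e (\<phi> k x) - soft_min' T e (u x)) *\<^sub>R G x)"
          by (rule ext) (simp add: cgrad_soft_min[OF s e] algebra_simps)
        moreover have "norm2 \<mu> (\<lambda>x. soft_min' T e (\<phi> k x) *\<^sub>R (cgrad (\<phi> k) x - G x)) \<le> norm2 \<mu> (\<lambda>x. cgrad (\<phi> k) x - G x)"
          by (rule norm2_mono[OF L2_diff[OF \<phi>L(2) D(2)] L2_measurable[OF L'']]) (use b in \<open>auto intro!: mult_left_le_one_le\<close>)
        ultimately show "norm2 \<mu> (\<lambda>x. cgrad (\<lambda>x. soft_min T e (\<phi> k x)) x - soft_min' T e (u x) *\<^sub>R G x)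
          \<le> norm2 \<mu> (\<lambda>x. cgrad (\<phi> k) x - G x) + norm2 \<mu> (\<lambda>x. (soft_min' T e (\<phi> k x) - soft_min' T e (u x)) *\<^sub>R G x)"
          using norm2_triangle[OF L'' L', of k k] by simp
      qed
    qed simp
  qed
qed

text \<open>The sequence is shadowed by test functions at distance below 1/(k+1); their norms stay
  below B + 1, and a Cauchy subsequence of the shadows is one of the original sequence.\<close>

theorem Rellich_H10:
  fixes u :: "nat \<Rightarrow> real^'n \<Rightarrow> real"
  assumes u: "\<And>k. H10_grad \<Omega> (u k) (G k)" and B: "\<And>k. norm2 \<mu> (u k) \<le> B" "\<And>k. norm2 \<mu> (G k) \<le> B"
  obtains r where "strict_mono r" "Cauchy_L2 \<mu> (\<lambda>k. u (r k))"
proof -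
  have z: "(\<lambda>k. 1 / real (Suc k)) \<longlonglongrightarrow> 0" by (rule LIMSEQ_Suc[OF lim_const_over_n])
  have "\<forall>k. \<exists>\<phi>. test_fun \<Omega> \<phi> \<and> norm2 \<mu> (\<lambda>x. \<phi> x - u k x) < 1 / real (Suc k) \<and> norm2 \<mu> (\<lambda>x. cgrad \<phi> x - G k x) < 1 / real (Suc k)"
  proof
    fix k
    show "\<exists>\<phi>. test_fun \<Omega> \<phi> \<and> norm2 \<mu> (\<lambda>x. \<phi> x - u k x) < 1 / real (Suc k) \<and> norm2 \<mu> (\<lambda>x. cgrad \<phi> x - G k x) < 1 / real (Suc k)"
      by (rule H10_grad_approx[OF u[of k], of "1 / real (Suc k)"]) (simp, blast)
  qed
  from choice[OF this] obtain \<phi> where \<phi>: "\<And>k. test_fun \<Omega> (\<phi> k)" "\<And>k. norm2 \<mu> (\<lambda>x. \<phi> k x - u k x) < 1 / real (Suc k)"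
    "\<And>k. norm2 \<mu> (\<lambda>x. cgrad (\<phi> k) x - G k x) < 1 / real (Suc k)" by blast
  note \<phi>L = test_fun_L2_mu[OF \<phi>(1)] and D = H10_gradD[OF u]
  have le1: "1 / real (Suc k) \<le> 1" for k :: nat by simp
  have "norm2 \<mu> (\<phi> k) \<le> B + 1" "norm2 \<mu> (cgrad (\<phi> k)) \<le> B + 1" for k
    using norm2_triangle_sub[OF \<phi>L(1) D(1), of k k] norm2_triangle_sub[OF \<phi>L(2) D(2), of k k]
      \<phi>(2,3)[of k] B[of k] le1[of k] by linarith+
  from Rellich_test_fun[OF open_dom bounded_dom \<phi>(1) this]
  obtain r where r: "strict_mono r" "Cauchy_L2 \<mu> (\<lambda>k. \<phi> (r k))" .
  have "Cauchy_L2 \<mu> (\<lambda>k. u (r k))" unfolding Cauchy_L2_def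
  proof (intro allI impI)
    fix e :: real assume e: "e > 0"
    have "(\<lambda>k. 1 / real (Suc (r k))) \<longlonglongrightarrow> 0" using LIMSEQ_subseq_LIMSEQ[OF z r(1)] by (simp add: o_def)
    then have "\<forall>\<^sub>F k in sequentially. 1 / real (Suc (r k)) < e / 3" by (rule order_tendstoD(2)) (use e in auto)
    then obtain N1 where N1: "\<And>k. k \<ge> N1 \<Longrightarrow> 1 / real (Suc (r k)) < e / 3" by (auto simp: eventually_sequentially)
    obtain N2 where N2: "\<And>m n. m \<ge> N2 \<Longrightarrow> n \<ge> N2 \<Longrightarrow> norm2 \<mu> (\<lambda>x. \<phi> (r m) x - \<phi> (r n) x) < e / 3"
      using Cauchy_L2D[OF r(2), of "e / 3"] e by auto
    have "norm2 \<mu> (\<lambda>x. u (r m) x - u (r n) x) < e" if "m \<ge> max N1 N2" "n \<ge> max N1 N2" for m n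
    proof -
      have a: "norm2 \<mu> (\<lambda>x. u (r m) x - u (r n) x) \<le> norm2 \<mu> (\<lambda>x. u (r m) x - \<phi> (r m) x) + norm2 \<mu> (\<lambda>x. \<phi> (r m) x - u (r n) x)"
        by (rule norm2_triangle_diff[OF D(1) \<phi>L(1) D(1)])
      have b: "norm2 \<mu> (\<lambda>x. \<phi> (r m) x - u (r n) x) \<le> norm2 \<mu> (\<lambda>x. \<phi> (r m) x - \<phi> (r n) x) + norm2 \<mu> (\<lambda>x. \<phi> (r n) x - u (r n) x)"
        by (rule norm2_triangle_diff[OF \<phi>L(1) \<phi>L(1) D(1)])
      have "norm2 \<mu> (\<lambda>x. u (r m) x - \<phi> (r m) x) < e / 3"
        using \<phi>(2)[of "r m"] N1[of m] that by (subst norm2_minus_commute) auto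
      moreover have "norm2 \<mu> (\<lambda>x. \<phi> (r n) x - u (r n) x) < e / 3"
        using \<phi>(2)[of "r n"] N1[of n] that by auto
      moreover have "norm2 \<mu> (\<lambda>x. \<phi> (r m) x - \<phi> (r n) x) < e / 3" using N2 that by auto
      ultimately show ?thesis using a b by simp
    qed
    then show "\<exists>N. \<forall>m\<ge>N. \<forall>n\<ge>N. norm2 \<mu> (\<lambda>x. u (r m) x - u (r n) x) < e" by blast
  qed
  with r(1) show ?thesis by (rule that)
qed

end

section \<open>The elliptic bilinear form\<close>

locale elliptic_domain = bounded_domain \<Omega> for \<Omega> :: "(real^'n::finite) set" +
  fixes M :: "real^'n \<Rightarrow> real^'n^'n" and \<alpha> \<beta> :: real
  assumes ell: "elliptic_matrix \<Omega> M \<alpha> \<beta>"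
begin

text \<open>Acts on gradient fields rather than on functions, so that an explicit gradient can be
  inserted directly; \<open>aform_eq\<close> leads back to the form on functions.\<close>

definition form :: "(real^'n \<Rightarrow> real^'n) \<Rightarrow> (real^'n \<Rightarrow> real^'n) \<Rightarrow> real" where
  "form G H = ip2 \<mu> (\<lambda>x. M x *v G x) H"

lemma alpha_pos: "\<alpha> > 0"
  using ell by (simp add: elliptic_matrix_def)

lemma M_coercive: "x \<in> \<Omega> \<Longrightarrow> \<alpha> * (norm \<xi>)\<^sup>2 \<le> (M x *v \<xi>) \<bullet> \<xi>"
  using ell by (simp add: elliptic_matrix_def)

lemma M_nonneg: "x \<in> \<Omega> \<Longrightarrow> 0 \<le> (M x *v \<xi>) \<bullet> \<xi>"
  using M_coercive[of x \<xi>] alpha_pos by (meson mult_nonneg_nonneg less_imp_le order_trans zero_le_power2)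

lemma M_sym: "x \<in> \<Omega> \<Longrightarrow> (M x *v \<xi>) \<bullet> \<eta> = (M x *v \<eta>) \<bullet> \<xi>"
proof -
  assume "x \<in> \<Omega>"
  then have "M x *v \<xi> = \<xi> v* M x"
    using ell transpose_matrix_vector[of "M x" \<xi>] by (simp add: elliptic_matrix_def)
  then show ?thesis using dot_lmul_matrix[of \<xi> "M x" \<eta>] by (simp add: inner_commute)
qed

lemma AE_domI: "(\<And>x. x \<in> \<Omega> \<Longrightarrow> P x) \<Longrightarrow> AE x in \<mu>. P x"
  by (rule AE_I2) (simp add: space_restrict_space)

lemma M_bounded: obtains K where "\<And>x \<xi>. x \<in> \<Omega> \<Longrightarrow> norm (M x *v \<xi>) \<le> K * norm \<xi>"
proof -
  obtain C where C: "\<And>x i j. x \<in> \<Omega> \<Longrightarrow> \<bar>M x $ i $ j\<bar> \<le> C"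
    using ell unfolding elliptic_matrix_def by blast
  have "norm (M x *v \<xi>) \<le> (real CARD('n) * (real CARD('n) * C)) * norm \<xi>" if x: "x \<in> \<Omega>" for x \<xi>
  proof -
    have "norm (M x *v \<xi>) \<le> (\<Sum>i\<in>UNIV. \<bar>(M x *v \<xi>) $ i\<bar>)" by (rule norm_le_l1_cart)
    also have "\<dots> \<le> (\<Sum>i\<in>(UNIV::'n set). real CARD('n) * C * norm \<xi>)"
    proof (rule sum_mono)
      fix i
      have "\<bar>(M x *v \<xi>) $ i\<bar> \<le> (\<Sum>j\<in>UNIV. \<bar>M x $ i $ j * \<xi> $ j\<bar>)"
        unfolding matrix_vector_mult_def by (simp add: sum_abs)
      also have "\<dots> \<le> (\<Sum>j\<in>(UNIV::'n set). C * norm \<xi>)"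
      proof (rule sum_mono)
        fix j
        have "\<bar>M x $ i $ j\<bar> * \<bar>\<xi> $ j\<bar> \<le> C * norm \<xi>"
          by (rule mult_mono[OF C[OF x] component_le_norm_cart]) (use C[OF x, of i j] in auto)
        then show "\<bar>M x $ i $ j * \<xi> $ j\<bar> \<le> C * norm \<xi>" by (simp add: abs_mult)
      qed
      finally show "\<bar>(M x *v \<xi>) $ i\<bar> \<le> real CARD('n) * C * norm \<xi>" by simp
    qed
    finally show ?thesis by (simp add: mult.assoc)
  qed
  then show ?thesis by (rule that)
qed

lemma M_measurable:
  assumes "G \<in> borel_measurable \<mu>"
  shows "(\<lambda>x. M x *v G x) \<in> borel_measurable \<mu>"
proof -
  have "(\<lambda>x. M x $ i $ j) \<in> borel_measurable \<mu>" for i j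
    using ell set_borel_measurable_iff[of "\<lambda>x. M x $ i $ j"] by (simp add: elliptic_matrix_def)
  moreover have "(\<lambda>x. G x $ j) \<in> borel_measurable \<mu>" for j
    using assms by (simp add: cart_eq_inner_axis)
  ultimately have "(\<lambda>x. \<Sum>j\<in>UNIV. M x $ i $ j * G x $ j) \<in> borel_measurable \<mu>" for i
    by (intro borel_measurable_sum borel_measurable_times)
  then show ?thesis
    by (subst borel_measurable_euclidean_space) (auto simp: Basis_vec_def inner_axis matrix_vector_mult_def)
qed

lemma L2_M:
  assumes "L2 \<mu> G"
  shows "L2 \<mu> (\<lambda>x. M x *v G x)"
proof -
  obtain K where "\<And>x \<xi>. x \<in> \<Omega> \<Longrightarrow> norm (M x *v \<xi>) \<le> K * norm \<xi>" by (rule M_bounded) blast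
  then show ?thesis
    by (intro L2_dominated[OF assms M_measurable[OF L2_measurable[OF assms]], of K] AE_domI)
qed

lemma form_coercive:
  assumes "L2 \<mu> G" shows "\<alpha> * (norm2 \<mu> G)\<^sup>2 \<le> form G G"
proof -
  have "(\<integral>x. \<alpha> * (norm (G x))\<^sup>2 \<partial>\<mu>) \<le> form G G"
    unfolding form_def ip2_def
    by (rule integral_mono_AE[OF _ integrable_inner_L2[OF L2_M[OF assms] assms]])
      (use assms in \<open>auto simp: L2_def intro!: AE_domI M_coercive\<close>)
  then show ?thesis by (simp add: norm2_square)
qed

lemma form_nonneg: "L2 \<mu> G \<Longrightarrow> 0 \<le> form G G"
  using form_coercive[of G] alpha_pos by (meson mult_nonneg_nonneg less_imp_le order_trans zero_le_power2)

lemma form_commute: "form G H = form H G"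
  unfolding form_def ip2_def
  by (rule Bochner_Integration.integral_cong) (auto simp: space_restrict_space M_sym)

lemma form_diff_left:
  assumes "L2 \<mu> G" "L2 \<mu> H" "L2 \<mu> K"
  shows "form (\<lambda>x. G x - H x) K = form G K - form H K"
  unfolding form_def using ip2_diff_left[OF L2_M[OF assms(1)] L2_M[OF assms(2)] assms(3)]
  by (simp add: matrix_vector_mult_diff_distrib)

lemma form_diff_right:
  assumes "L2 \<mu> G" "L2 \<mu> H" "L2 \<mu> K"
  shows "form K (\<lambda>x. G x - H x) = form K G - form K H"
  unfolding form_def using ip2_diff_right[OF assms(1,2) L2_M[OF assms(3)]] .

lemma form_scaleR_left: "form (\<lambda>x. c *\<^sub>R G x) K = c * form G K"
  by (simp add: form_def ip2_def matrix_vector_mult_scaleR)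

lemma form_add_scaleR:
  assumes G: "L2 \<mu> G" and H: "L2 \<mu> H"
  shows "form (\<lambda>x. G x - t *\<^sub>R H x) (\<lambda>x. G x - t *\<^sub>R H x) = form G G - 2 * t * form G H + t\<^sup>2 * form H H"
proof -
  note tH = L2_scaleR[OF H, of t]
  have r: "form K (\<lambda>x. t *\<^sub>R H x) = t * form K H" for K
    using form_scaleR_left[of t H K] by (simp add: form_commute[of K])
  have "form (\<lambda>x. G x - t *\<^sub>R H x) (\<lambda>x. G x - t *\<^sub>R H x)
     = form G G - form G (\<lambda>x. t *\<^sub>R H x) - (form (\<lambda>x. t *\<^sub>R H x) G - form (\<lambda>x. t *\<^sub>R H x) (\<lambda>x. t *\<^sub>R H x))"
    by (simp add: form_diff_left[OF G tH L2_diff[OF G tH]] form_diff_right[OF G tH G] form_diff_right[OF G tH tH])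
  then show ?thesis
    by (simp add: r form_scaleR_left form_commute[of H G] power2_eq_square)
qed

text \<open>Boundedness of the matrix field turns L2 convergence of the fields into L2 convergence
  of their images, and the inner product is jointly continuous.\<close>

lemma form_tendsto:
  assumes G: "\<And>k. L2 \<mu> (G k)" "L2 \<mu> G'" and H: "\<And>k. L2 \<mu> (H k)" "L2 \<mu> H'"
    and lim: "(\<lambda>k. norm2 \<mu> (\<lambda>x. G k x - G' x)) \<longlonglongrightarrow> 0" "(\<lambda>k. norm2 \<mu> (\<lambda>x. H k x - H' x)) \<longlonglongrightarrow> 0"
  shows "(\<lambda>k. form (G k) (H k)) \<longlonglongrightarrow> form G' H'"
  unfolding form_def
proof (rule tendsto_norm2_imp_tendsto_ip2[OF L2_M[OF G(1)] L2_M[OF G(2)] H _ lim(2)])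
  obtain K where K: "\<And>x \<xi>. x \<in> \<Omega> \<Longrightarrow> norm (M x *v \<xi>) \<le> K * norm \<xi>" by (rule M_bounded) blast
  show "(\<lambda>k. norm2 \<mu> (\<lambda>x. M x *v G k x - M x *v G' x)) \<longlonglongrightarrow> 0"
  proof (rule tendsto_sandwich[OF _ _ tendsto_const])
    show "\<forall>\<^sub>F k in sequentially. norm2 \<mu> (\<lambda>x. M x *v G k x - M x *v G' x) \<le> \<bar>K\<bar> * norm2 \<mu> (\<lambda>x. G k x - G' x)"
    proof (rule always_eventually, rule allI)
      fix k
      note D = L2_diff[OF G(1)[of k] G(2)]
      have "norm2 \<mu> (\<lambda>x. M x *v G k x - M x *v G' x) \<le> norm2 \<mu> (\<lambda>x. K *\<^sub>R (G k x - G' x))"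
      proof (rule norm2_mono)
        show "L2 \<mu> (\<lambda>x. K *\<^sub>R (G k x - G' x))" by (rule L2_scaleR[OF D])
        show "(\<lambda>x. M x *v G k x - M x *v G' x) \<in> borel_measurable \<mu>"
          by (rule L2_measurable[OF L2_diff[OF L2_M[OF G(1)] L2_M[OF G(2)]]])
        show "AE x in \<mu>. norm (M x *v G k x - M x *v G' x) \<le> norm (K *\<^sub>R (G k x - G' x))"
        proof (rule AE_domI)
          fix x assume "x \<in> \<Omega>"
          have "norm (M x *v G k x - M x *v G' x) = norm (M x *v (G k x - G' x))"
            by (simp add: matrix_vector_mult_diff_distrib)
          also have "\<dots> \<le> K * norm (G k x - G' x)" by (rule K[OF \<open>x \<in> \<Omega>\<close>])
          also have "\<dots> \<le> \<bar>K\<bar> * norm (G k x - G' x)" by (intro mult_right_mono) auto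
          finally show "norm (M x *v G k x - M x *v G' x) \<le> norm (K *\<^sub>R (G k x - G' x))" by simp
        qed
      qed
      then show "norm2 \<mu> (\<lambda>x. M x *v G k x - M x *v G' x) \<le> \<bar>K\<bar> * norm2 \<mu> (\<lambda>x. G k x - G' x)"
        by (simp add: norm2_scaleR)
    qed
    show "(\<lambda>k. \<bar>K\<bar> * norm2 \<mu> (\<lambda>x. G k x - G' x)) \<longlonglongrightarrow> 0" using tendsto_mult_left[OF lim(1), of "\<bar>K\<bar>"] by simp
  qed simp
qed

lemma aform_eq:
  assumes u: "H10_grad \<Omega> u G" and v: "H10_grad \<Omega> v H"
  shows "aform \<Omega> M u v = form G H"
  unfolding aform_def set_integral_eq form_def ip2_def
proof (rule integral_cong_AE)
  show "AE x in \<mu>. (M x *v wgrad \<Omega> u x) \<bullet> wgrad \<Omega> v x = (M x *v G x) \<bullet> H x"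
    using wgrad_eq[OF u] wgrad_eq[OF v] by eventually_elim simp
  have "(\<lambda>x. (M x *v G x) \<bullet> H x) \<in> borel_measurable \<mu>" if "L2 \<mu> G" "L2 \<mu> H" for G H
    using integrable_inner_L2[OF L2_M[OF that(1)] that(2)] by auto
  then show "(\<lambda>x. (M x *v wgrad \<Omega> u x) \<bullet> wgrad \<Omega> v x) \<in> borel_measurable \<mu>" "(\<lambda>x. (M x *v G x) \<bullet> H x) \<in> borel_measurable \<mu>"
    using H10_gradD[OF u] H10_gradD[OF v] H10_gradD[OF H10_wgrad[OF H10I[OF u]]] H10_gradD[OF H10_wgrad[OF H10I[OF v]]] by blast+
qed

end

section \<open>Derivatives of powers\<close>

text \<open>Away from 0 this is the usual power rule on each side; at 0 the difference quotient has
  absolute value |h|^(q-1), which vanishes in the limit because q > 1.\<close>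

lemma has_derivative_abs_powr:
  fixes q :: real
  assumes q: "q > 1"
  shows "((\<lambda>s. \<bar>s\<bar> powr q) has_real_derivative q * \<bar>s\<bar> powr (q - 1) * sgn s) (at s)"
proof (cases s "0::real" rule: linorder_cases)
  case greater
  have "((\<lambda>s. s powr q) has_real_derivative q * s powr (q - 1)) (at s)"
    by (rule has_real_derivative_powr[OF greater])
  then have "((\<lambda>s. \<bar>s\<bar> powr q) has_real_derivative q * s powr (q - 1)) (at s)"
    by (rule has_field_derivative_transform_within_open[of _ _ _ "{0<..}"]) (use greater in auto)
  then show ?thesis using greater by simp
next
  case less
  have "((\<lambda>s. (- s) powr q) has_real_derivative q * (- s) powr (q - 1) * (- 1)) (at s)"
    by (rule DERIV_chain2[of "\<lambda>s. s powr q"])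
      (use has_real_derivative_powr[of "- s" q] less in \<open>auto intro!: derivative_eq_intros\<close>)
  then have "((\<lambda>s. \<bar>s\<bar> powr q) has_real_derivative q * (- s) powr (q - 1) * (- 1)) (at s)"
    by (rule has_field_derivative_transform_within_open[of _ _ _ "{..<0}"]) (use less in auto)
  then show ?thesis using less by simp
next
  case equal
  have "((\<lambda>h. \<bar>h\<bar> powr (q - 1)) \<longlongrightarrow> 0) (at (0::real))"
  proof -
    have "((\<lambda>h. \<bar>h\<bar> powr (q - 1)) \<longlongrightarrow> \<bar>0\<bar> powr (q - 1)) (at (0::real))"
      by (rule tendsto_powr') (use q in \<open>auto intro!: tendsto_intros tendsto_rabs_zero tendsto_ident_at\<close>)
    then show ?thesis by simp
  qed
  then have "((\<lambda>h. (\<bar>0 + h\<bar> powr q - \<bar>0\<bar> powr q) / h) \<longlongrightarrow> 0) (at (0::real))"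
  proof (rule Lim_null_comparison[rotated])
    show "\<forall>\<^sub>F h in at (0::real). norm ((\<bar>0 + h\<bar> powr q - \<bar>0\<bar> powr q) / h) \<le> \<bar>h\<bar> powr (q - 1)"
      unfolding eventually_at_filter
    proof (rule always_eventually, intro allI impI)
      fix h :: real assume "h \<noteq> 0"
      then show "norm ((\<bar>0 + h\<bar> powr q - \<bar>0\<bar> powr q) / h) \<le> \<bar>h\<bar> powr (q - 1)"
        by (simp add: powr_diff)
    qed
  qed
  then have "((\<lambda>s. \<bar>s\<bar> powr q) has_real_derivative 0) (at 0)" by (simp add: DERIV_def)
  then show ?thesis using equal by simp
qed

text \<open>The critical point is again 0, where the quotient is dominated by the one for
  |s|^q.\<close>

lemma has_derivative_pos_part_powr:
  fixes q :: real
  assumes q: "q > 1"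
  shows "((\<lambda>s. \<bar>max s 0\<bar> powr q) has_real_derivative q * (max s 0) powr (q - 1)) (at s)"
proof (cases s "0::real" rule: linorder_cases)
  case greater
  have "((\<lambda>s. s powr q) has_real_derivative q * s powr (q - 1)) (at s)"
    by (rule has_real_derivative_powr[OF greater])
  then have "((\<lambda>s. \<bar>max s 0\<bar> powr q) has_real_derivative q * s powr (q - 1)) (at s)"
    by (rule has_field_derivative_transform_within_open[of _ _ _ "{0<..}"]) (use greater in auto)
  then show ?thesis using greater by simp
next
  case less
  have "((\<lambda>s. \<bar>max s 0\<bar> powr q) has_real_derivative 0) (at s)"
    by (rule has_field_derivative_transform_within_open[of "\<lambda>s. 0" _ _ "{..<0}"]) (use less in auto)
  then show ?thesis using less by simp
next
  case equal
  have d: "((\<lambda>s. \<bar>s\<bar> powr q) has_real_derivative 0) (at (0::real))" using has_derivative_abs_powr[OF q, of 0] by simp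
  then have "((\<lambda>h. (\<bar>0 + h\<bar> powr q - \<bar>0\<bar> powr q) / h) \<longlongrightarrow> 0) (at (0::real))" by (simp add: DERIV_def)
  then have "((\<lambda>h. (\<bar>max (0 + h) 0\<bar> powr q - \<bar>max 0 0\<bar> powr q) / h) \<longlongrightarrow> 0) (at (0::real))"
  proof (rule Lim_null_comparison[OF _ tendsto_norm_zero, rotated])
    show "\<forall>\<^sub>F h in at (0::real). norm ((\<bar>max (0 + h) 0\<bar> powr q - \<bar>max 0 0\<bar> powr q) / h) \<le> norm ((\<bar>0 + h\<bar> powr q - \<bar>0\<bar> powr q) / h)"
      by (rule always_eventually) (auto simp: max_def divide_nonneg_nonpos)
  qed
  then have "((\<lambda>s. \<bar>max s 0\<bar> powr q) has_real_derivative 0) (at 0)" by (simp add: DERIV_def)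
  then show ?thesis using equal by simp
qed

section \<open>Minimizers: truncation and Euler-Lagrange equation\<close>

locale variational_problem = elliptic_domain \<Omega> M \<alpha> \<beta>
  for \<Omega> :: "(real^'n::finite) set" and M \<alpha> \<beta> +
  fixes lam p :: real
  assumes p_gt: "p > 2" and lam_pos: "lam > 0"
begin

text \<open>The zero-order density of the energy \<open>Jm\<close>. It is kept on the whole line,
  since the competitors u - t \<phi> may change sign.\<close>

definition hfun :: "real \<Rightarrow> real \<Rightarrow> real" where
  "hfun m s = \<bar>s\<bar> powr m / m - lam / p * \<bar>max s 0\<bar> powr p"

definition hder :: "real \<Rightarrow> real \<Rightarrow> real" where
  "hder m s = \<bar>s\<bar> powr (m - 1) * sgn s - lam * (max s 0) powr (p - 1)"

lemma has_derivative_hfun: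
  assumes "m > 1" shows "(hfun m has_real_derivative hder m s) (at s)"
proof -
  have "((\<lambda>s. \<bar>s\<bar> powr m / m - lam / p * \<bar>max s 0\<bar> powr p) has_real_derivative
      (m * \<bar>s\<bar> powr (m - 1) * sgn s) / m - lam / p * (p * (max s 0) powr (p - 1))) (at s)"
    using p_gt by (intro DERIV_diff DERIV_cmult DERIV_cdivide has_derivative_abs_powr[OF assms] has_derivative_pos_part_powr) auto
  moreover have "(m * \<bar>s\<bar> powr (m - 1) * sgn s) / m - lam / p * (p * (max s 0) powr (p - 1)) = hder m s"
    using assms p_gt by (simp add: hder_def)
  ultimately show ?thesis by (simp add: hfun_def[abs_def])
qed

lemma hfun_continuous: "m > 1 \<Longrightarrow> continuous_on S (hfun m)"
  using has_derivative_hfun by (meson DERIV_atLeastAtMost_imp_continuous_on DERIV_isCont continuous_at_imp_continuous_on)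

lemma hfun_measurable: "m > 1 \<Longrightarrow> f \<in> borel_measurable N \<Longrightarrow> (\<lambda>x. hfun m (f x)) \<in> borel_measurable N"
  by (rule measurable_compose[OF _ borel_measurable_continuous_onI[OF hfun_continuous]])

lemma hder_measurable:
  assumes [measurable]: "f \<in> borel_measurable N"
  shows "(\<lambda>x. hder m (f x)) \<in> borel_measurable N"
  unfolding hder_def by measurable

lemma powr_le_one_plus:
  fixes s :: real
  assumes "0 \<le> s" "0 \<le> q" "q \<le> m" shows "s powr q \<le> 1 + s powr m"
proof (cases "s \<le> 1")
  case True
  then have "s powr q \<le> 1 powr q" using assms by (intro powr_mono2) auto
  then show ?thesis by (simp add: add_increasing2)
next
  case False
  then have "s powr q \<le> s powr m" using assms by (intro powr_mono) auto
  then show ?thesis by simp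
qed

lemma hfun_bound:
  assumes "m \<ge> p"
  shows "\<bar>hfun m s\<bar> \<le> (1 / m + lam / p) * (1 + \<bar>s\<bar> powr m)"
proof -
  have m: "m > 0" using assms p_gt by simp
  have "\<bar>max s 0\<bar> powr p \<le> \<bar>s\<bar> powr p" using p_gt by (intro powr_mono2) auto
  also have "\<dots> \<le> 1 + \<bar>s\<bar> powr m" using assms p_gt by (intro powr_le_one_plus) auto
  finally have "lam / p * \<bar>max s 0\<bar> powr p \<le> lam / p * (1 + \<bar>s\<bar> powr m)"
    using lam_pos p_gt by (intro mult_left_mono) auto
  moreover have "0 \<le> lam / p * \<bar>max s 0\<bar> powr p" using lam_pos p_gt by simp
  moreover have "\<bar>s\<bar> powr m / m \<le> 1 / m * (1 + \<bar>s\<bar> powr m)" "0 \<le> \<bar>s\<bar> powr m / m" using m by (auto simp: field_simps)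
  moreover have "(1 / m + lam / p) * (1 + \<bar>s\<bar> powr m) = 1 / m * (1 + \<bar>s\<bar> powr m) + lam / p * (1 + \<bar>s\<bar> powr m)"
    by (rule distrib_right)
  ultimately show ?thesis unfolding hfun_def by linarith
qed

lemma Lp_iff: "Lp \<Omega> q v \<longleftrightarrow> v \<in> borel_measurable \<mu> \<and> integrable \<mu> (\<lambda>x. \<bar>v x\<bar> powr q)"
proof -
  have "(\<integral>\<^sup>+x. ennreal (\<bar>v x\<bar> powr q) \<partial>\<mu>) < \<infinity> \<longleftrightarrow> integrable \<mu> (\<lambda>x. \<bar>v x\<bar> powr q)" if "v \<in> borel_measurable \<mu>"
    using that by (simp add: integrable_iff_bounded)
  then show ?thesis unfolding Lp_def set_borel_measurable_iff set_nn_integral_eq by auto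
qed

lemma integrable_one_plus_powr:
  assumes "Lp \<Omega> m v" shows "integrable \<mu> (\<lambda>x. C * (1 + \<bar>v x\<bar> powr m))"
  using assms finite_measure.integrable_const[OF finite_mu, of "1::real"] unfolding Lp_iff by auto

lemma integrable_hfun:
  assumes v: "Lp \<Omega> m v" and m: "m \<ge> p"
  shows "integrable \<mu> (\<lambda>x. hfun m (v x))"
proof (rule Bochner_Integration.integrable_bound[OF integrable_one_plus_powr[OF v, of "1 / m + lam / p"]])
  show "(\<lambda>x. hfun m (v x)) \<in> borel_measurable \<mu>"
    using v m p_gt by (intro hfun_measurable) (auto simp: Lp_iff)
  show "AE x in \<mu>. norm (hfun m (v x)) \<le> norm ((1 / m + lam / p) * (1 + \<bar>v x\<bar> powr m))"
  proof (rule AE_I2)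
    fix x show "norm (hfun m (v x)) \<le> norm ((1 / m + lam / p) * (1 + \<bar>v x\<bar> powr m))"
      using hfun_bound[OF m, of "v x"] unfolding real_norm_def by linarith
  qed
qed

lemma integrable_powr_le:
  assumes v: "Lp \<Omega> m v" and q: "0 \<le> q" "q \<le> m"
  shows "integrable \<mu> (\<lambda>x. \<bar>max (v x) 0\<bar> powr q)" "integrable \<mu> (\<lambda>x. \<bar>v x\<bar> powr q)"
proof -
  have [measurable]: "v \<in> borel_measurable \<mu>" using v by (simp add: Lp_iff)
  have le: "\<bar>v x\<bar> powr q \<le> 1 * (1 + \<bar>v x\<bar> powr m)" for x using powr_le_one_plus[of "\<bar>v x\<bar>" q m] q by simp
  have le2: "\<bar>max (v x) 0\<bar> powr q \<le> \<bar>v x\<bar> powr q" for x using q by (intro powr_mono2) auto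
  show 1: "integrable \<mu> (\<lambda>x. \<bar>v x\<bar> powr q)"
    by (rule Bochner_Integration.integrable_bound[OF integrable_one_plus_powr[OF v, of 1]])
      (use le in \<open>auto simp: abs_of_nonneg\<close>)
  show "integrable \<mu> (\<lambda>x. \<bar>max (v x) 0\<bar> powr q)"
    by (rule Bochner_Integration.integrable_bound[OF 1]) (use le2 in auto)
qed

lemma Jm_eq:
  assumes v: "Lp \<Omega> m v" and H: "H10_grad \<Omega> v H" and m: "m \<ge> p"
  shows "Jm \<Omega> M lam p m v = 1/2 * form H H + (\<integral>x. hfun m (v x) \<partial>\<mu>)"
proof -
  have i: "integrable \<mu> (\<lambda>x. \<bar>v x\<bar> powr m)" using v by (simp add: Lp_iff)
  have "(\<integral>x. hfun m (v x) \<partial>\<mu>) = (\<integral>x. \<bar>v x\<bar> powr m \<partial>\<mu>) / m - lam / p * (\<integral>x. \<bar>max (v x) 0\<bar> powr p \<partial>\<mu>)"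
    unfolding hfun_def
    by (subst Bochner_Integration.integral_diff) (use i integrable_powr_le(1)[OF v, of p] m p_gt in auto)
  then show ?thesis unfolding Jm_def aform_eq[OF H H] pnorm_pow_def set_integral_eq by simp
qed

definition minimizer :: "real \<Rightarrow> (real^'n \<Rightarrow> real) \<Rightarrow> bool" where
  "minimizer m u \<longleftrightarrow> Xm \<Omega> m u \<and> (AE x in \<mu>. 0 \<le> u x) \<and> (\<forall>v. Xm \<Omega> m v \<longrightarrow> Jm \<Omega> M lam p m u \<le> Jm \<Omega> M lam p m v)"

lemma minimizerD:
  assumes "minimizer m u"
  shows "Lp \<Omega> m u" "H10_grad \<Omega> u (wgrad \<Omega> u)" "AE x in \<mu>. 0 \<le> u x"
  using assms by (auto simp: minimizer_def Xm_def H10_wgrad)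

lemma minimizer_le:
  assumes u: "minimizer m u" "H10_grad \<Omega> u G" and m: "m \<ge> p" and v: "Lp \<Omega> m v" "H10_grad \<Omega> v H"
  shows "1/2 * form G G + (\<integral>x. hfun m (u x) \<partial>\<mu>) \<le> 1/2 * form H H + (\<integral>x. hfun m (v x) \<partial>\<mu>)"
proof -
  have "Xm \<Omega> m v" using v by (auto simp: Xm_def H10I)
  then have "Jm \<Omega> M lam p m u \<le> Jm \<Omega> M lam p m v" using u(1) by (auto simp: minimizer_def)
  then show ?thesis using Jm_eq[OF minimizerD(1)[OF u(1)] u(2) m] Jm_eq[OF v m] by simp
qed

text \<open>The positive zero of \<open>hder m\<close>: there s^(m-1) = lam s^(p-1), that is s^(m-p)
  = lam.\<close>

definition bnd :: "real \<Rightarrow> real" where "bnd m = lam powr (1 / (m - p))"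

lemma bnd_pos: "bnd m > 0"
  using lam_pos by (simp add: bnd_def)

text \<open>Beyond its positive zero the derivative is positive, since t^(m-p) exceeds lam. The
  strict inequality is what later turns an equality of integrals into an a.e. bound.\<close>

lemma hfun_less_above_bnd:
  assumes m: "m > p" and s: "s > bnd m"
  shows "hfun m (bnd m) < hfun m s"
proof (rule DERIV_pos_imp_increasing_open[OF s])
  show "continuous_on {bnd m..s} (hfun m)" by (rule hfun_continuous) (use m p_gt in auto)
  fix t assume t: "bnd m < t"
  then have tp: "t > 0" using bnd_pos[of m] by linarith
  have "lam = bnd m powr (m - p)" using m lam_pos by (simp add: bnd_def powr_powr)
  also have "\<dots> < t powr (m - p)" using t m bnd_pos[of m] by (intro powr_less_mono2) auto
  finally have "lam * t powr (p - 1) < t powr (m - p) * t powr (p - 1)" using tp by simp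
  also have "\<dots> = t powr (m - 1)" by (simp add: powr_add[symmetric])
  finally have "hder m t > 0" using tp by (simp add: hder_def)
  then show "\<exists>y. (hfun m has_real_derivative y) (at t) \<and> 0 < y"
    using has_derivative_hfun[of m t] m p_gt by auto
qed

text \<open>Truncating at the minimum point of the nonlinearity lowers the energy; the smooth
  approximation of the truncation stays in the space because it acts on test functions.\<close>
lemma minimizer_le_bnd:
  assumes u: "minimizer m u" and m: "m > p"
  shows "AE x in \<mu>. u x \<le> bnd m"
proof -
  have m1: "m > 1" "m \<ge> p" using m p_gt by auto
  define G where "G = wgrad \<Omega> u"
  note uL = minimizerD(1)[OF u] and G = minimizerD(2)[OF u, folded G_def]
  have um[measurable]: "u \<in> borel_measurable \<mu>" using uL by (simp add: Lp_iff)
  define e where "e k = 1 / real (Suc k)" for k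
  have e: "e k > 0" for k by (simp add: e_def)
  have e0: "e \<longlonglongrightarrow> 0" unfolding e_def by (rule LIMSEQ_Suc[OF lim_const_over_n])
  define w where "w k x = soft_min (bnd m) (e k) (u x)" for k x
  have wG: "H10_grad \<Omega> (w k) (\<lambda>x. soft_min' (bnd m) (e k) (u x) *\<^sub>R G x)" for k
    unfolding w_def by (rule H10_grad_soft_min[OF G e])
  have wm: "w k \<in> borel_measurable \<mu>" for k using L2_measurable[OF H10_gradD(1)[OF wG]] .
  have wle: "\<bar>w k x\<bar> \<le> \<bar>u x\<bar>" for k x
    using soft_min_Lipschitz[OF e, of "bnd m" k "u x" 0] by (simp add: w_def)
  have wple: "\<bar>w k x\<bar> powr m \<le> \<bar>u x\<bar> powr m" for k x using m1 by (intro powr_mono2 wle) auto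
  have wL: "Lp \<Omega> m (w k)" for k
  proof -
    have "integrable \<mu> (\<lambda>x. \<bar>w k x\<bar> powr m)"
    proof (rule Bochner_Integration.integrable_bound)
      show "integrable \<mu> (\<lambda>x. \<bar>u x\<bar> powr m)" using uL by (simp add: Lp_iff)
      show "(\<lambda>x. \<bar>w k x\<bar> powr m) \<in> borel_measurable \<mu>" using wm[of k] by measurable
    qed (use wple in auto)
    then show ?thesis using wm by (simp add: Lp_iff)
  qed
  \<comment> \<open>The truncated competitor has the gradient of u multiplied by a factor between 0
    and 1, so its form is no larger, and minimality leaves a comparison of the zero-order terms
    alone.\<close>
  have "(\<integral>x. hfun m (u x) \<partial>\<mu>) \<le> (\<integral>x. hfun m (w k x) \<partial>\<mu>)" for k
  proof -
    let ?t = "\<lambda>x. soft_min' (bnd m) (e k) (u x)"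
    have "form (\<lambda>x. ?t x *\<^sub>R G x) (\<lambda>x. ?t x *\<^sub>R G x) \<le> form G G"
      unfolding form_def ip2_def
    proof (rule integral_mono_AE)
      show "integrable \<mu> (\<lambda>x. (M x *v ?t x *\<^sub>R G x) \<bullet> ?t x *\<^sub>R G x)" "integrable \<mu> (\<lambda>x. (M x *v G x) \<bullet> G x)"
        using integrable_inner_L2[OF L2_M[OF H10_gradD(2)[OF wG]] H10_gradD(2)[OF wG]]
          integrable_inner_L2[OF L2_M[OF H10_gradD(2)[OF G]] H10_gradD(2)[OF G]] by auto
      show "AE x in \<mu>. (M x *v ?t x *\<^sub>R G x) \<bullet> ?t x *\<^sub>R G x \<le> (M x *v G x) \<bullet> G x"
      proof (rule AE_domI)
        fix x assume x: "x \<in> \<Omega>"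
        have "?t x * ?t x \<le> 1 * 1"
          using soft_min'_bounds[OF e, of "bnd m" k "u x"] by (intro mult_mono) auto
        then have "(?t x * ?t x) * ((M x *v G x) \<bullet> G x) \<le> 1 * ((M x *v G x) \<bullet> G x)"
          by (intro mult_right_mono M_nonneg[OF x]) simp
        then show "(M x *v ?t x *\<^sub>R G x) \<bullet> ?t x *\<^sub>R G x \<le> (M x *v G x) \<bullet> G x"
          by (simp add: matrix_vector_mult_scaleR mult.assoc)
      qed
    qed
    then show ?thesis using minimizer_le[OF u G m1(2) wL[of k] wG[of k]] by linarith
  qed
  moreover have "(\<lambda>k. \<integral>x. hfun m (w k x) \<partial>\<mu>) \<longlonglongrightarrow> (\<integral>x. hfun m (min (u x) (bnd m)) \<partial>\<mu>)"
  proof (rule integral_dominated_convergence[OF _ _ integrable_one_plus_powr[OF uL, of "1 / m + lam / p"]])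
    show "(\<lambda>x. hfun m (min (u x) (bnd m))) \<in> borel_measurable \<mu>" by (rule hfun_measurable[OF m1(1)]) measurable
    show "(\<lambda>x. hfun m (w k x)) \<in> borel_measurable \<mu>" for k by (rule hfun_measurable[OF m1(1) wm])
    show "AE x in \<mu>. (\<lambda>k. hfun m (w k x)) \<longlonglongrightarrow> hfun m (min (u x) (bnd m))"
    proof (rule AE_I2)
      fix x
      have "(\<lambda>k. w k x) \<longlonglongrightarrow> min (u x) (bnd m)" unfolding w_def
        by (rule soft_min_tendsto_min[OF _ e0]) (use bnd_pos[of m] in simp)
      then show "(\<lambda>k. hfun m (w k x)) \<longlonglongrightarrow> hfun m (min (u x) (bnd m))"
        by (rule isCont_tendsto_compose[OF DERIV_isCont[OF has_derivative_hfun[OF m1(1)]]])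
    qed
    show "AE x in \<mu>. norm (hfun m (w k x)) \<le> (1 / m + lam / p) * (1 + \<bar>u x\<bar> powr m)" for k
    proof (rule AE_I2)
      fix x
      have "\<bar>hfun m (w k x)\<bar> \<le> (1 / m + lam / p) * (1 + \<bar>w k x\<bar> powr m)" by (rule hfun_bound[OF m1(2)])
      also have "\<dots> \<le> (1 / m + lam / p) * (1 + \<bar>u x\<bar> powr m)"
        using wple[of k x] lam_pos p_gt m1 by (intro mult_left_mono) auto
      finally show "norm (hfun m (w k x)) \<le> (1 / m + lam / p) * (1 + \<bar>u x\<bar> powr m)" by simp
    qed
  qed
  \<comment> \<open>Only the zero-order integrals pass to the limit of vanishing smoothing; the
    gradients have already left the inequality.\<close>
  ultimately have le: "(\<integral>x. hfun m (u x) \<partial>\<mu>) \<le> (\<integral>x. hfun m (min (u x) (bnd m)) \<partial>\<mu>)"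
    by (intro LIMSEQ_le_const[where X = "\<lambda>k. \<integral>x. hfun m (w k x) \<partial>\<mu>"]) auto
  have i1: "integrable \<mu> (\<lambda>x. hfun m (u x))" by (rule integrable_hfun[OF uL m1(2)])
  have i2: "integrable \<mu> (\<lambda>x. hfun m (min (u x) (bnd m)))"
  proof (rule Bochner_Integration.integrable_bound[OF integrable_one_plus_powr[OF uL, of "(1 / m + lam / p) * (1 + bnd m powr m)"]])
    show "(\<lambda>x. hfun m (min (u x) (bnd m))) \<in> borel_measurable \<mu>" by (rule hfun_measurable[OF m1(1)]) measurable
    show "AE x in \<mu>. norm (hfun m (min (u x) (bnd m))) \<le> norm ((1 / m + lam / p) * (1 + bnd m powr m) * (1 + \<bar>u x\<bar> powr m))"
    proof (rule AE_I2)
      fix x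
      have "\<bar>min (u x) (bnd m)\<bar> powr m \<le> bnd m powr m + \<bar>u x\<bar> powr m"
        using bnd_pos[of m] by (auto simp: min_def)
      moreover have "0 \<le> bnd m powr m * \<bar>u x\<bar> powr m" by simp
      ultimately have "1 + \<bar>min (u x) (bnd m)\<bar> powr m \<le> (1 + bnd m powr m) * (1 + \<bar>u x\<bar> powr m)"
        unfolding distrib_right distrib_left by linarith
      then have "(1 / m + lam / p) * (1 + \<bar>min (u x) (bnd m)\<bar> powr m) \<le> (1 / m + lam / p) * ((1 + bnd m powr m) * (1 + \<bar>u x\<bar> powr m))"
        using lam_pos p_gt m1 by (intro mult_left_mono) auto
      then show "norm (hfun m (min (u x) (bnd m))) \<le> norm ((1 / m + lam / p) * (1 + bnd m powr m) * (1 + \<bar>u x\<bar> powr m))"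
        using hfun_bound[OF m1(2), of "min (u x) (bnd m)"] unfolding real_norm_def mult.assoc by linarith
    qed
  qed
  \<comment> \<open>A nonnegative function with integral at most 0 vanishes a.e., whereas it is
    strictly positive wherever u exceeds the bound.\<close>
  define d where "d x = hfun m (u x) - hfun m (min (u x) (bnd m))" for x
  have d0: "d x \<ge> 0" for x
    using hfun_less_above_bnd[OF m, of "u x"] by (cases "u x \<le> bnd m") (auto simp: d_def min_def)
  have di: "integrable \<mu> d" unfolding d_def using i1 i2 by auto
  have "(\<integral>x. d x \<partial>\<mu>) \<le> 0" unfolding d_def using le i1 i2 by simp
  moreover have "(\<integral>x. d x \<partial>\<mu>) \<ge> 0" using d0 by simp
  ultimately have "(\<integral>x. d x \<partial>\<mu>) = 0" by simp
  then have "AE x in \<mu>. d x = 0" using integral_nonneg_eq_0_iff_AE[OF di] d0 by simp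
  then show ?thesis
  proof eventually_elim
    case (elim x)
    then show ?case using hfun_less_above_bnd[OF m, of "u x"] by (cases "u x \<le> bnd m") (auto simp: d_def min_def)
  qed
qed

lemma hder_bound:
  assumes "m > 1" "\<bar>s\<bar> \<le> R"
  shows "\<bar>hder m s\<bar> \<le> R powr (m - 1) + lam * R powr (p - 1)"
proof -
  have a: "\<bar>\<bar>s\<bar> powr (m - 1) * sgn s\<bar> \<le> R powr (m - 1)"
  proof -
    have "\<bar>\<bar>s\<bar> powr (m - 1) * sgn s\<bar> \<le> \<bar>s\<bar> powr (m - 1)" by (simp add: abs_mult sgn_if)
    also have "\<dots> \<le> R powr (m - 1)" using assms by (intro powr_mono2) auto
    finally show ?thesis .
  qed
  have "(max s 0) powr (p - 1) \<le> R powr (p - 1)" using assms p_gt by (intro powr_mono2) auto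
  then have "lam * (max s 0) powr (p - 1) \<le> lam * R powr (p - 1)" using lam_pos by simp
  moreover have "0 \<le> lam * (max s 0) powr (p - 1)" using lam_pos by simp
  ultimately show ?thesis using a unfolding hder_def by linarith
qed

text \<open>Compare u with u - t \<phi>, divide by t > 0 and let t tend to 0. The quotients of the
  zero-order term are dominated by a constant because u and its variations are bounded and
  \<open>hfun m\<close> is Lipschitz on bounded intervals. The reverse inequality comes from
  -\<phi>.\<close>

lemma Euler_Lagrange_test_le:
  assumes u: "minimizer m u" "H10_grad \<Omega> u G" and m: "m > p" and \<phi>: "test_fun \<Omega> \<phi>"
  shows "form G (cgrad \<phi>) + (\<integral>x. hder m (u x) * \<phi> x \<partial>\<mu>) \<le> 0"
proof -
  have m1: "m > 1" "m \<ge> p" using m p_gt by auto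
  note uL = minimizerD(1)[OF u(1)]
  have um[measurable]: "u \<in> borel_measurable \<mu>" using uL by (simp add: Lp_iff)
  have \<phi>G: "H10_grad \<Omega> \<phi> (cgrad \<phi>)" by (rule H10_grad_test_fun[OF \<phi>])
  have \<phi>m[measurable]: "\<phi> \<in> borel_measurable \<mu>" using L2_measurable[OF H10_gradD(1)[OF \<phi>G]] .
  obtain S where S: "\<And>x. \<bar>\<phi> x\<bar> \<le> S" "S \<ge> 0"
  proof -
    have "compact (\<phi> ` closure {x. \<phi> x \<noteq> 0})"
      by (rule compact_continuous_image[OF smooth_fun_continuous[OF test_funD(1)[OF \<phi>]] test_funD(2)[OF \<phi>]])
    from compact_imp_bounded[OF this] obtain S where S: "S > 0" "\<And>x. x \<in> closure {x. \<phi> x \<noteq> 0} \<Longrightarrow> \<bar>\<phi> x\<bar> \<le> S"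
      unfolding bounded_pos by auto
    have "\<bar>\<phi> x\<bar> \<le> S" for x using S zero_outside[of x \<phi>] by (cases "x \<in> closure {x. \<phi> x \<noteq> 0}") auto
    with S(1) show ?thesis by (intro that[of S]) auto
  qed
  \<comment> \<open>An interval of radius R contains the values of u and of every variation with t
    \<le> 1.\<close>
  define R where "R = bnd m + S"
  define L where "L = R powr (m - 1) + lam * R powr (p - 1)"
  have AEb: "AE x in \<mu>. \<bar>u x\<bar> \<le> bnd m"
    using minimizer_le_bnd[OF u(1) m] minimizerD(3)[OF u(1)] by eventually_elim simp
  have Lip: "\<bar>hfun m s - hfun m t\<bar> \<le> L * \<bar>s - t\<bar>" if "\<bar>s\<bar> \<le> R" "\<bar>t\<bar> \<le> R" for s t
  proof -
    have "norm (hfun m s - hfun m t) \<le> L * norm (s - t)"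
    proof (rule field_differentiable_bound[of "{-R..R}" "hfun m" "hder m"])
      show "(hfun m has_field_derivative hder m z) (at z within {-R..R})" for z
        using has_derivative_hfun[OF m1(1)] by (rule has_field_derivative_at_within)
      show "norm (hder m z) \<le> L" if "z \<in> {-R..R}" for z
        using hder_bound[OF m1(1), of z R] that by (auto simp: L_def abs_le_iff)
    qed (use that in \<open>auto simp: abs_le_iff\<close>)
    then show ?thesis by simp
  qed
  define t where "t k = 1 / real (Suc k)" for k
  have t: "0 < t k" "t k \<le> 1" for k by (auto simp: t_def)
  have t0: "t \<longlonglongrightarrow> 0" unfolding t_def by (rule LIMSEQ_Suc[OF lim_const_over_n])
  define v where "v k x = u x - t k * \<phi> x" for k x
  have vG: "H10_grad \<Omega> (v k) (\<lambda>x. G x - t k *\<^sub>R cgrad \<phi> x)" for k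
    unfolding v_def by (rule H10_grad_diff_scaleR[OF u(2) \<phi>G])
  have vm[measurable]: "v k \<in> borel_measurable \<mu>" for k unfolding v_def by measurable
  have t\<phi>: "\<bar>t k * \<phi> x\<bar> \<le> S" for k x
    using mult_mono[OF t(2)[of k] S(1)[of x]] t(1)[of k] by (simp add: abs_mult)
  have vb: "AE x in \<mu>. \<bar>v k x\<bar> \<le> R" for k
    using AEb
  proof eventually_elim
    case (elim x) then show ?case using t\<phi>[of k x] unfolding v_def R_def by linarith
  qed
  have vL: "Lp \<Omega> m (v k)" for k
    unfolding Lp_iff
  proof
    show "integrable \<mu> (\<lambda>x. \<bar>v k x\<bar> powr m)"
    proof (rule Bochner_Integration.integrable_bound)
      show "integrable \<mu> (\<lambda>x. R powr m)" by (rule finite_measure.integrable_const[OF finite_mu])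
      show "AE x in \<mu>. norm (\<bar>v k x\<bar> powr m) \<le> norm (R powr m)"
        using vb[of k] by eventually_elim (use m1 in \<open>auto intro: powr_mono2\<close>)
    qed measurable
  qed (rule vm)
  define q where "q k x = (hfun m (v k x) - hfun m (u x)) / t k" for k x
  have "form G (cgrad \<phi>) \<le> t k / 2 * form (cgrad \<phi>) (cgrad \<phi>) + (\<integral>x. q k x \<partial>\<mu>)" for k
  proof -
    have "1/2 * form G G + (\<integral>x. hfun m (u x) \<partial>\<mu>) \<le> 1/2 * form (\<lambda>x. G x - t k *\<^sub>R cgrad \<phi> x) (\<lambda>x. G x - t k *\<^sub>R cgrad \<phi> x) + (\<integral>x. hfun m (v k x) \<partial>\<mu>)"
      by (rule minimizer_le[OF u m1(2) vL vG])
    moreover have "form (\<lambda>x. G x - t k *\<^sub>R cgrad \<phi> x) (\<lambda>x. G x - t k *\<^sub>R cgrad \<phi> x)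
        = form G G - 2 * t k * form G (cgrad \<phi>) + (t k)\<^sup>2 * form (cgrad \<phi>) (cgrad \<phi>)"
      by (rule form_add_scaleR[OF H10_gradD(2)[OF u(2)] H10_gradD(2)[OF \<phi>G]])
    moreover have "(\<integral>x. hfun m (v k x) \<partial>\<mu>) - (\<integral>x. hfun m (u x) \<partial>\<mu>) = t k * (\<integral>x. q k x \<partial>\<mu>)"
      unfolding q_def using integrable_hfun[OF vL m1(2), of k] integrable_hfun[OF uL m1(2)] t(1)[of k] by simp
    ultimately have "t k * form G (cgrad \<phi>) \<le> (t k)\<^sup>2 / 2 * form (cgrad \<phi>) (cgrad \<phi>) + t k * (\<integral>x. q k x \<partial>\<mu>)"
      by (simp add: algebra_simps)
    also have "\<dots> = t k * (t k / 2 * form (cgrad \<phi>) (cgrad \<phi>) + (\<integral>x. q k x \<partial>\<mu>))"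
      by (simp add: power2_eq_square algebra_simps)
    finally show ?thesis using t(1)[of k] by simp
  qed
  moreover have "(\<lambda>k. t k / 2 * form (cgrad \<phi>) (cgrad \<phi>) + (\<integral>x. q k x \<partial>\<mu>))
      \<longlonglongrightarrow> 0 / 2 * form (cgrad \<phi>) (cgrad \<phi>) + (\<integral>x. - (hder m (u x) * \<phi> x) \<partial>\<mu>)"
  proof (rule tendsto_add)
    show "(\<lambda>k. t k / 2 * form (cgrad \<phi>) (cgrad \<phi>)) \<longlonglongrightarrow> 0 / 2 * form (cgrad \<phi>) (cgrad \<phi>)"
      by (intro tendsto_intros t0) simp
    show "(\<lambda>k. \<integral>x. q k x \<partial>\<mu>) \<longlonglongrightarrow> (\<integral>x. - (hder m (u x) * \<phi> x) \<partial>\<mu>)"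
    proof (rule integral_dominated_convergence[where w = "\<lambda>x. L * S"])
      show "integrable \<mu> (\<lambda>x. L * S)" by (rule finite_measure.integrable_const[OF finite_mu])
      show "(\<lambda>x. - (hder m (u x) * \<phi> x)) \<in> borel_measurable \<mu>" using hder_measurable[OF um, of m] by measurable
      show "q k \<in> borel_measurable \<mu>" for k
        unfolding q_def using hfun_measurable[OF m1(1) um] hfun_measurable[OF m1(1) vm[of k]] by measurable
      show "AE x in \<mu>. norm (q k x) \<le> L * S" for k
        using vb[of k] AEb
      proof eventually_elim
        case (elim x)
        have "\<bar>u x\<bar> \<le> R" using elim S(2) by (simp add: R_def)
        from Lip[OF elim(1) this] have "\<bar>hfun m (v k x) - hfun m (u x)\<bar> \<le> L * (t k * \<bar>\<phi> x\<bar>)"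
          using t(1)[of k] by (simp add: v_def abs_mult)
        then have "\<bar>q k x\<bar> \<le> L * \<bar>\<phi> x\<bar>" using t(1)[of k] by (simp add: q_def abs_divide pos_divide_le_eq mult_ac)
        also have "\<dots> \<le> L * S" using S(1)[of x] lam_pos by (intro mult_left_mono) (auto simp: L_def)
        finally show ?case by simp
      qed
      show "AE x in \<mu>. (\<lambda>k. q k x) \<longlonglongrightarrow> - (hder m (u x) * \<phi> x)"
      proof (rule AE_I2)
        fix x
        have d: "(hfun m has_real_derivative hder m (u x - 0 * \<phi> x)) (at (u x - 0 * \<phi> x))"
          by (rule has_derivative_hfun[OF m1(1)])
        have "((\<lambda>h. u x - h * \<phi> x) has_real_derivative (- \<phi> x)) (at 0)"
          by (auto intro!: derivative_eq_intros)
        from DERIV_chain2[OF d this]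
        have "((\<lambda>h. hfun m (u x - h * \<phi> x)) has_real_derivative (hder m (u x) * - \<phi> x)) (at 0)" by simp
        then have "((\<lambda>h. (hfun m (u x - h * \<phi> x) - hfun m (u x)) / h) \<longlongrightarrow> hder m (u x) * - \<phi> x) (at 0)"
          by (simp add: DERIV_def)
        then have "((\<lambda>k. (hfun m (u x - t k * \<phi> x) - hfun m (u x)) / t k) \<longlonglongrightarrow> hder m (u x) * - \<phi> x)"
          by (rule filterlim_compose) (use t t0 in \<open>auto simp: filterlim_at less_imp_neq[symmetric]\<close>)
        then show "(\<lambda>k. q k x) \<longlonglongrightarrow> - (hder m (u x) * \<phi> x)" by (simp add: q_def v_def)
      qed
    qed
  qed
  ultimately have "form G (cgrad \<phi>) \<le> 0 / 2 * form (cgrad \<phi>) (cgrad \<phi>) + (\<integral>x. - (hder m (u x) * \<phi> x) \<partial>\<mu>)"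
    by (intro LIMSEQ_le_const) auto
  then show ?thesis by simp
qed

lemma hder_L2:
  assumes "minimizer m u" "m > p"
  shows "L2 \<mu> (\<lambda>x. hder m (u x))"
proof (rule L2_bounded[OF finite_mu hder_measurable])
  show "u \<in> borel_measurable \<mu>" using minimizerD(1)[OF assms(1)] by (simp add: Lp_iff)
  show "AE x in \<mu>. norm (hder m (u x)) \<le> bnd m powr (m - 1) + lam * bnd m powr (p - 1)"
    using minimizer_le_bnd[OF assms] minimizerD(3)[OF assms(1)]
    by eventually_elim (use hder_bound[of m _ "bnd m"] assms(2) p_gt in auto)
qed

text \<open>The a.e. bound on u puts the reaction term into L2, so both sides are continuous in the
  test function for the H^1 norm and the equation extends from test functions to all of
  H^1_0.\<close>

lemma Euler_Lagrange:
  assumes u: "minimizer m u" "H10_grad \<Omega> u G" and m: "m > p" and v: "H10_grad \<Omega> v H"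
  shows "form G H + ip2 \<mu> (\<lambda>x. hder m (u x)) v = 0"
proof -
  have test: "form G (cgrad \<phi>) + ip2 \<mu> (\<lambda>x. hder m (u x)) \<phi> = 0" if \<phi>: "test_fun \<Omega> \<phi>" for \<phi>
  proof -
    have cg: "cgrad (\<lambda>x. (-1) * \<phi> x) = (\<lambda>x. (-1) *\<^sub>R cgrad \<phi> x)"
      by (rule ext) (rule cgrad_cmult[OF test_funD(1)[OF \<phi>]])
    have "form G (cgrad \<phi>) + (\<integral>x. hder m (u x) * \<phi> x \<partial>\<mu>) \<le> 0"
      by (rule Euler_Lagrange_test_le[OF u m \<phi>])
    moreover have "form G (\<lambda>x. (-1) *\<^sub>R cgrad \<phi> x) + (\<integral>x. hder m (u x) * ((-1) * \<phi> x) \<partial>\<mu>) \<le> 0"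
      using Euler_Lagrange_test_le[OF u m test_fun_cmult[OF \<phi>, of "-1"]] unfolding cg .
    moreover have "form G (\<lambda>x. (-1) *\<^sub>R cgrad \<phi> x) = - form G (cgrad \<phi>)"
      using form_scaleR_left[of "-1" "cgrad \<phi>" G] by (simp add: form_commute[of G])
    ultimately show ?thesis by (simp add: ip2_def)
  qed
  obtain \<phi> where \<phi>: "\<And>k. test_fun \<Omega> (\<phi> k)" "(\<lambda>k. norm2 \<mu> (\<lambda>x. \<phi> k x - v x)) \<longlonglongrightarrow> 0"
    "(\<lambda>k. norm2 \<mu> (\<lambda>x. cgrad (\<phi> k) x - H x)) \<longlonglongrightarrow> 0" by (rule H10_gradE[OF v]) blast
  have c: "(\<lambda>k. norm2 \<mu> (\<lambda>x. f x - f x)) \<longlonglongrightarrow> 0" for f :: "real^'n \<Rightarrow> 'b::euclidean_space" by simp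
  have "(\<lambda>k. form G (cgrad (\<phi> k)) + ip2 \<mu> (\<lambda>x. hder m (u x)) (\<phi> k)) \<longlonglongrightarrow> form G H + ip2 \<mu> (\<lambda>x. hder m (u x)) v"
    by (intro tendsto_add form_tendsto[OF _ _ _ _ c \<phi>(3)] tendsto_norm2_imp_tendsto_ip2[OF _ _ _ _ c \<phi>(2)]
        hder_L2[OF u(1) m] H10_gradD[OF u(2)] H10_gradD[OF v] test_fun_L2_mu[OF \<phi>(1)])
  then show ?thesis unfolding test[OF \<phi>(1)] by (simp add: LIMSEQ_const_iff)
qed

end

section \<open>Bounds and pairings that survive convex combinations\<close>

lemma norm2_le_const:
  assumes "finite_measure N" "f \<in> borel_measurable N" "AE x in N. norm (f x) \<le> c"
  shows "norm2 N f \<le> norm2 N (\<lambda>x. c :: real)"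
proof (rule norm2_mono[OF L2_bounded[OF assms(1), of _ "\<bar>c\<bar>"] assms(2)])
  show "AE x in N. norm (f x) \<le> norm c" using assms(3) by eventually_elim simp
qed auto

lemma mid_hull_AE_bounds:
  assumes "h \<in> mid_hull S" "\<And>f. f \<in> S \<Longrightarrow> AE x in N. 0 \<le> f x \<and> f x \<le> (c::real)"
  shows "AE x in N. 0 \<le> h x \<and> h x \<le> c"
  using assms
proof (induction rule: mid_hull.induct)
  case (mid f g)
  have "AE x in N. 0 \<le> f x \<and> f x \<le> c" "AE x in N. 0 \<le> g x \<and> g x \<le> c" using mid by auto
  then show ?case by eventually_elim auto
qed

lemma mid_hull_ip2_bounds:
  assumes "h \<in> mid_hull S" and S: "\<And>f. f \<in> S \<Longrightarrow> L2 N f" "\<And>f. f \<in> S \<Longrightarrow> \<bar>ip2 N f v - L\<bar> \<le> e" and v: "L2 N v"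
  shows "\<bar>ip2 N h v - L\<bar> \<le> e"
  using assms(1)
proof (induction rule: mid_hull.induct)
  case (base f) then show ?case by (rule S(2))
next
  case (mid f g)
  have L: "L2 N f" "L2 N g" using L2_mid_hull[OF _ S(1)] mid.hyps by blast+
  have "ip2 N (\<lambda>x. (f x + g x) / 2) v = ip2 N (\<lambda>x. f x + g x) v / 2"
    by (simp add: ip2_def)
  also have "\<dots> = (ip2 N f v + ip2 N g v) / 2" by (simp add: ip2_add_left[OF L v])
  finally show ?case using mid.IH by (simp add: abs_le_iff field_simps)
qed

text \<open>Pairings of tail members with v lie in a small interval around L; intervals are convex,
  so the hull elements share it, and strong convergence passes it on to g. The sequence h does not
  depend on v, hence one g serves all test functions.\<close>

lemma mid_hull_limit_ip2:
  assumes a: "\<And>k. L2 N (a k)" and v: "L2 N v" and lim: "(\<lambda>k. ip2 N (a k) v) \<longlonglongrightarrow> L"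
    and h: "\<And>n. h n \<in> mid_hull (a ` {n..})" and g: "L2 N g" "(\<lambda>n. norm2 N (\<lambda>x. h n x - g x)) \<longlonglongrightarrow> 0"
  shows "ip2 N g v = L"
proof -
  have hL: "L2 N (h n)" for n by (rule L2_mid_hull[OF h]) (use a in auto)
  have "(\<lambda>n. norm2 N (\<lambda>x. v x - v x)) \<longlonglongrightarrow> 0" by simp
  from tendsto_norm2_imp_tendsto_ip2[OF hL g(1) v v g(2) this]
  have l1: "(\<lambda>n. ip2 N (h n) v) \<longlonglongrightarrow> ip2 N g v" .
  have l2: "(\<lambda>n. ip2 N (h n) v) \<longlonglongrightarrow> L"
  proof (rule LIMSEQ_I)
    fix e :: real assume e: "e > 0"
    obtain n0 where n0: "\<And>k. k \<ge> n0 \<Longrightarrow> norm (ip2 N (a k) v - L) < e / 2"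
      using LIMSEQ_D[OF lim, of "e / 2"] e by auto
    have "\<bar>ip2 N (h n) v - L\<bar> \<le> e / 2" if "n \<ge> n0" for n
    proof (rule mid_hull_ip2_bounds[OF h _ _ v])
      fix f assume "f \<in> a ` {n..}"
      then obtain k where k: "f = a k" "k \<ge> n" by auto
      show "L2 N f" using a k by simp
      show "\<bar>ip2 N f v - L\<bar> \<le> e / 2" using n0[of k] k that by simp
    qed
    then have "norm (ip2 N (h n) v - L) < e" if "n \<ge> n0" for n using that e by fastforce
    then show "\<exists>n0. \<forall>n\<ge>n0. norm (ip2 N (h n) v - L) < e" by blast
  qed
  show ?thesis by (rule LIMSEQ_unique[OF l1 l2])
qed

lemma powr_at_top_tendsto_0:
  fixes \<rho> :: real
  assumes "0 < \<rho>" "\<rho> < 1" "filterlim f at_top F"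
  shows "((\<lambda>k. \<rho> powr f k) \<longlongrightarrow> 0) F"
proof -
  have "filterlim (\<lambda>k. ln \<rho> * f k) at_bot F"
    by (rule filterlim_tendsto_neg_mult_at_bot[OF tendsto_const _ assms(3)]) (use assms in simp)
  then have "((\<lambda>k. exp (ln \<rho> * f k)) \<longlongrightarrow> 0) F" by (rule filterlim_compose[OF exp_at_bot])
  then show ?thesis using assms(1) by (simp add: powr_def mult.commute)
qed

section \<open>Uniform bounds and compactness for a sequence of minimizers\<close>

locale minimizer_sequence = variational_problem \<Omega> M \<alpha> \<beta> lam p
  for \<Omega> :: "(real^'n::finite) set" and M \<alpha> \<beta> lam p +
  fixes m :: "nat \<Rightarrow> real" and U :: "nat \<Rightarrow> real^'n \<Rightarrow> real" and \<delta> :: real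
  assumes minU: "\<And>k. minimizer (m k) (U k)" and m_ge: "\<And>k. m k \<ge> p + 1"
    and m_mono: "mono m" and m_lim: "filterlim m at_top sequentially"
    and energy: "\<And>k. Jm \<Omega> M lam p (m k) (U k) \<le> - \<delta>" and \<delta>_pos: "\<delta> > 0"
begin

text \<open>A common upper bound for all truncation levels: \<open>m k \<ge> p + 1\<close> keeps the
  exponent 1/(m k - p) at most 1, and a base of at least 1 makes the power increasing in the
  exponent even when lam is below 1.\<close>

definition Tb :: real where "Tb = max 1 lam"

abbreviation G :: "nat \<Rightarrow> real^'n \<Rightarrow> real^'n" where "G k \<equiv> wgrad \<Omega> (U k)"

lemma Tb: "Tb \<ge> 1" "lam \<le> Tb" "Tb > 0" by (auto simp: Tb_def)

lemma m_gt: "m k > p" "m k > 1" "m k \<ge> p" using m_ge[of k] p_gt by auto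

lemma lam_powr_le_Tb: "0 \<le> e \<Longrightarrow> lam powr e \<le> Tb powr e"
  using Tb lam_pos by (intro powr_mono2) auto

lemma bnd_le: "bnd (m k) \<le> Tb"
proof -
  have e: "0 \<le> 1 / (m k - p)" "1 / (m k - p) \<le> 1" using m_ge[of k] by (auto simp: divide_simps)
  have "bnd (m k) \<le> Tb powr (1 / (m k - p))" unfolding bnd_def by (rule lam_powr_le_Tb[OF e(1)])
  also have "\<dots> \<le> Tb powr 1" using e Tb by (intro powr_mono) auto
  finally show ?thesis using Tb by simp
qed

lemma UG: "H10_grad \<Omega> (U k) (G k)" by (rule minimizerD(2)[OF minU])

lemma U_measurable: "U k \<in> borel_measurable \<mu>" by (rule L2_measurable[OF H10_gradD(1)[OF UG]])

lemma U_bounds: "AE x in \<mu>. 0 \<le> U k x \<and> U k x \<le> bnd (m k)"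
  using minimizer_le_bnd[OF minU m_gt(1)] minimizerD(3)[OF minU] by eventually_elim simp

lemma U_le_Tb: "AE x in \<mu>. \<bar>U k x\<bar> \<le> Tb"
  using U_bounds[of k] by eventually_elim (use bnd_le[of k] in auto)

text \<open>From (m-1)/(m-p) = 1 + (p-1)/(m-p), the level raised to the power m - 1 equals lam times
  lam^((p-1)/(m-p)). Replacing the second base by \<open>Tb\<close> makes the bound nonincreasing in
  k while its limit remains lam, so one value controls a whole tail.\<close>

definition penalty_bnd :: "nat \<Rightarrow> real" where "penalty_bnd k = lam * Tb powr ((p - 1) / (m k - p))"

lemma bnd_powr_le: "bnd (m k) powr (m k - 1) \<le> penalty_bnd k"
proof -
  have ne: "m k - p \<noteq> 0" using m_gt(1)[of k] by simp
  have "bnd (m k) powr (m k - 1) = lam powr ((m k - 1) / (m k - p))" by (simp add: bnd_def powr_powr)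
  also have "(m k - 1) / (m k - p) = 1 + (p - 1) / (m k - p)" using ne by (simp add: field_simps)
  also have "lam powr (1 + (p - 1) / (m k - p)) = lam * lam powr ((p - 1) / (m k - p))"
    using lam_pos by (simp add: powr_add)
  also have "\<dots> \<le> penalty_bnd k" unfolding penalty_bnd_def
    using lam_pos p_gt m_gt(1)[of k] by (intro mult_left_mono lam_powr_le_Tb) auto
  finally show ?thesis .
qed

lemma penalty_bnd_antimono: "n \<le> k \<Longrightarrow> penalty_bnd k \<le> penalty_bnd n"
proof -
  assume "n \<le> k"
  then have "m n \<le> m k" using m_mono by (simp add: monoD)
  then have "(p - 1) / (m k - p) \<le> (p - 1) / (m n - p)"
    using m_gt(1)[of n] m_gt(1)[of k] p_gt by (intro divide_left_mono) auto
  then show ?thesis unfolding penalty_bnd_def using Tb lam_pos by (intro mult_left_mono powr_mono) auto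
qed

lemma penalty_bnd_pos: "penalty_bnd k > 0" using lam_pos Tb by (simp add: penalty_bnd_def)

lemma inverse_m_tendsto: "(\<lambda>k. c / (m k - p)) \<longlonglongrightarrow> 0"
proof (rule real_tendsto_divide_at_top[OF tendsto_const])
  show "filterlim (\<lambda>k. m k - p) at_top sequentially"
    using filterlim_tendsto_add_at_top[OF tendsto_const[of "- p"] m_lim] by simp
qed

lemma penalty_bnd_tendsto: "penalty_bnd \<longlonglongrightarrow> lam"
proof -
  have "(\<lambda>k. lam * Tb powr ((p - 1) / (m k - p))) \<longlonglongrightarrow> lam * Tb powr 0"
    using Tb by (intro tendsto_mult tendsto_const tendsto_powr inverse_m_tendsto) auto
  then show ?thesis using Tb by (simp add: penalty_bnd_def[abs_def])
qed

lemma bnd_tendsto: "(\<lambda>k. bnd (m k)) \<longlonglongrightarrow> 1"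
proof -
  have "(\<lambda>k. lam powr (1 / (m k - p))) \<longlonglongrightarrow> lam powr 0"
    using lam_pos by (intro tendsto_powr tendsto_const inverse_m_tendsto) auto
  then show ?thesis using lam_pos by (simp add: bnd_def[abs_def])
qed

definition penalty :: "nat \<Rightarrow> real^'n \<Rightarrow> real" where "penalty k x = \<bar>U k x\<bar> powr (m k - 1) * sgn (U k x)"

definition pos_powr :: "(real^'n \<Rightarrow> real) \<Rightarrow> real^'n \<Rightarrow> real" where "pos_powr f x = (max (f x) 0) powr (p - 1)"

lemma hder_eq: "hder (m k) (U k x) = penalty k x - lam * pos_powr (U k) x"
  by (simp add: hder_def penalty_def pos_powr_def)

lemma penalty_measurable: "penalty k \<in> borel_measurable \<mu>"
  using U_measurable[of k] unfolding penalty_def by measurable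

lemma pos_powr_measurable: "f \<in> borel_measurable \<mu> \<Longrightarrow> pos_powr f \<in> borel_measurable \<mu>"
  unfolding pos_powr_def by measurable

lemma penalty_bounds: "AE x in \<mu>. 0 \<le> penalty k x \<and> penalty k x \<le> penalty_bnd k"
  using U_bounds[of k]
proof eventually_elim
  case (elim x)
  have "\<bar>U k x\<bar> powr (m k - 1) \<le> bnd (m k) powr (m k - 1)"
    using elim m_gt(2)[of k] by (intro powr_mono2) auto
  also note bnd_powr_le
  finally have "\<bar>U k x\<bar> powr (m k - 1) \<le> penalty_bnd k" .
  then show ?case using elim penalty_bnd_pos[of k] by (auto simp: penalty_def sgn_if)
qed

lemma penalty_bound_0: "AE x in \<mu>. norm (penalty k x) \<le> penalty_bnd 0"
  using penalty_bounds[of k] by eventually_elim (use penalty_bnd_antimono[of 0 k] in auto)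

lemma penalty_L2: "L2 \<mu> (penalty k)"
  by (rule L2_bounded[OF finite_mu penalty_measurable penalty_bound_0])

lemma pos_powr_bound: "\<bar>f x\<bar> \<le> Tb \<Longrightarrow> norm (pos_powr f x) \<le> Tb powr (p - 1)"
  unfolding pos_powr_def using p_gt by (auto intro!: powr_mono2)

lemma pos_powr_L2:
  assumes "f \<in> borel_measurable \<mu>" "AE x in \<mu>. \<bar>f x\<bar> \<le> Tb" shows "L2 \<mu> (pos_powr f)"
  by (rule L2_bounded[OF finite_mu pos_powr_measurable[OF assms(1)], of "Tb powr (p - 1)"])
    (use assms(2) pos_powr_bound in \<open>auto elim!: eventually_mono\<close>)

definition F :: "nat \<Rightarrow> real^'n \<Rightarrow> real" where "F k x = hder (m k) (U k x)"

lemma F_L2: "L2 \<mu> (F k)"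
  unfolding F_def by (rule hder_L2[OF minU m_gt(1)])

lemma F_norm: "norm2 \<mu> (F k) \<le> norm2 \<mu> (\<lambda>x. penalty_bnd 0 + lam * Tb powr (p - 1))"
proof (rule norm2_le_const[OF finite_mu L2_measurable[OF F_L2]])
  show "AE x in \<mu>. norm (F k x) \<le> penalty_bnd 0 + lam * Tb powr (p - 1)"
    using penalty_bound_0[of k] U_le_Tb[of k]
  proof eventually_elim
    case (elim x)
    have "lam * \<bar>pos_powr (U k) x\<bar> \<le> lam * Tb powr (p - 1)"
      using pos_powr_bound[of "U k" x] elim lam_pos by (intro mult_left_mono) auto
    moreover have "\<bar>F k x\<bar> \<le> \<bar>penalty k x\<bar> + lam * \<bar>pos_powr (U k) x\<bar>"
      unfolding F_def hder_eq using abs_triangle_ineq4[of "penalty k x" "lam * pos_powr (U k) x"] lam_pos by (simp add: abs_mult)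
    ultimately show ?case using elim by simp
  qed
qed

lemma U_norm: "norm2 \<mu> (U k) \<le> norm2 \<mu> (\<lambda>x. Tb)"
  by (rule norm2_le_const[OF finite_mu U_measurable]) (use U_le_Tb[of k] in auto)

lemma EL: "H10_grad \<Omega> v H \<Longrightarrow> form (G k) H + ip2 \<mu> (F k) v = 0"
  unfolding F_def by (rule Euler_Lagrange[OF minU UG m_gt(1)])

text \<open>Test the equation of \<open>U k\<close> with \<open>U k\<close> itself: coercivity is on
  one side, a product of uniformly bounded L2 norms on the other.\<close>

lemma G_norm_bounded: obtains B where "\<And>k. norm2 \<mu> (G k) \<le> B"
proof -
  define c where "c = norm2 \<mu> (\<lambda>x. penalty_bnd 0 + lam * Tb powr (p - 1)) * norm2 \<mu> (\<lambda>x::real^'n. Tb)"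
  have "norm2 \<mu> (G k) \<le> sqrt (c / \<alpha>)" for k
  proof -
    have "\<alpha> * (norm2 \<mu> (G k))\<^sup>2 \<le> form (G k) (G k)" by (rule form_coercive[OF H10_gradD(2)[OF UG]])
    also have "\<dots> = - ip2 \<mu> (F k) (U k)" using EL[OF UG, of k k] by simp
    also have "\<dots> \<le> norm2 \<mu> (F k) * norm2 \<mu> (U k)"
      using Cauchy_Schwarz_L2[OF F_L2 H10_gradD(1)[OF UG], of k k] by linarith
    also have "\<dots> \<le> c" unfolding c_def by (rule mult_mono[OF F_norm U_norm]) auto
    finally have "(norm2 \<mu> (G k))\<^sup>2 \<le> c / \<alpha>" using alpha_pos by (simp add: pos_le_divide_eq mult.commute)
    then show ?thesis by (rule real_le_rsqrt)
  qed
  then show ?thesis by (rule that)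
qed

text \<open>The reaction terms are merely bounded in L2. This suffices, because the squared distance
  of two gradients is controlled by the first power of the distance of the functions.\<close>

lemma Cauchy_G:
  assumes "Cauchy_L2 \<mu> (\<lambda>k. U (r k))"
  shows "Cauchy_L2 \<mu> (\<lambda>k. G (r k))"
  unfolding Cauchy_L2_def
proof (intro allI impI)
  fix e :: real assume e: "e > 0"
  define c where "c = norm2 \<mu> (\<lambda>x::real^'n. penalty_bnd 0 + lam * Tb powr (p - 1))"
  have c0: "c \<ge> 0" by (simp add: c_def)
  have est: "\<alpha> * (norm2 \<mu> (\<lambda>x. G i x - G j x))\<^sup>2 \<le> (2 * c) * norm2 \<mu> (\<lambda>x. U i x - U j x)" for i j
  proof -
    note D = H10_grad_diff[OF UG[of i] UG[of j]]
    note DL = H10_gradD[OF D]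
    have "\<alpha> * (norm2 \<mu> (\<lambda>x. G i x - G j x))\<^sup>2 \<le> form (\<lambda>x. G i x - G j x) (\<lambda>x. G i x - G j x)"
      by (rule form_coercive[OF DL(2)])
    also have "\<dots> = form (G i) (\<lambda>x. G i x - G j x) - form (G j) (\<lambda>x. G i x - G j x)"
      by (rule form_diff_left[OF H10_gradD(2)[OF UG] H10_gradD(2)[OF UG] DL(2)])
    also have "\<dots> = ip2 \<mu> (F j) (\<lambda>x. U i x - U j x) - ip2 \<mu> (F i) (\<lambda>x. U i x - U j x)"
      using EL[OF D, of i] EL[OF D, of j] by linarith
    also have "\<dots> \<le> norm2 \<mu> (F j) * norm2 \<mu> (\<lambda>x. U i x - U j x) + norm2 \<mu> (F i) * norm2 \<mu> (\<lambda>x. U i x - U j x)"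
      using Cauchy_Schwarz_L2[OF F_L2 DL(1), of i] Cauchy_Schwarz_L2[OF F_L2 DL(1), of j] by linarith
    also have "\<dots> \<le> c * norm2 \<mu> (\<lambda>x. U i x - U j x) + c * norm2 \<mu> (\<lambda>x. U i x - U j x)"
      unfolding c_def by (intro add_mono mult_right_mono F_norm) auto
    finally show ?thesis by simp
  qed
  \<comment> \<open>The summand 1 keeps the denominator positive whatever the size of c.\<close>
  have e': "\<alpha> * e\<^sup>2 / (2 * c + 1) > 0" using alpha_pos e c0 by simp
  obtain N where N: "\<And>i j. i \<ge> N \<Longrightarrow> j \<ge> N \<Longrightarrow> norm2 \<mu> (\<lambda>x. U (r i) x - U (r j) x) < \<alpha> * e\<^sup>2 / (2 * c + 1)"
    by (rule Cauchy_L2D[OF assms e']) blast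
  have "norm2 \<mu> (\<lambda>x. G (r i) x - G (r j) x) < e" if "i \<ge> N" "j \<ge> N" for i j
  proof -
    let ?n = "norm2 \<mu> (\<lambda>x. U (r i) x - U (r j) x)"
    have "(2 * c) * ?n \<le> (2 * c + 1) * ?n" by (intro mult_right_mono) auto
    also have "\<dots> < \<alpha> * e\<^sup>2" using N[OF that] c0 by (simp add: pos_less_divide_eq mult.commute)
    finally have "\<alpha> * (norm2 \<mu> (\<lambda>x. G (r i) x - G (r j) x))\<^sup>2 < \<alpha> * e\<^sup>2" using est[of "r i" "r j"] by linarith
    then have "(norm2 \<mu> (\<lambda>x. G (r i) x - G (r j) x))\<^sup>2 < e\<^sup>2" using alpha_pos by simp
    then show ?thesis using e by (intro power2_less_imp_less[of _ e]) auto
  qed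
  then show "\<exists>N. \<forall>i\<ge>N. \<forall>j\<ge>N. norm2 \<mu> (\<lambda>x. G (r i) x - G (r j) x) < e" by blast
qed

theorem strong_limit:
  obtains r W where "strict_mono r" "H10 \<Omega> W" "\<And>x. 0 \<le> W x \<and> W x \<le> 1"
    "(\<lambda>k. norm2 \<mu> (\<lambda>x. U (r k) x - W x)) \<longlonglongrightarrow> 0"
    "(\<lambda>k. norm2 \<mu> (\<lambda>x. G (r k) x - wgrad \<Omega> W x)) \<longlonglongrightarrow> 0"
    "AE x in \<mu>. (\<lambda>k. U (r k) x) \<longlonglongrightarrow> W x"
proof -
  obtain B where B: "\<And>k. norm2 \<mu> (G k) \<le> B" by (rule G_norm_bounded) blast
  define B' where "B' = max B (norm2 \<mu> (\<lambda>x::real^'n. Tb))"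
  have "norm2 \<mu> (U k) \<le> B'" "norm2 \<mu> (G k) \<le> B'" for k
    using U_norm[of k] B[of k] by (auto simp: B'_def)
  from Rellich_H10[OF UG this]
  obtain r1 where r1: "strict_mono r1" "Cauchy_L2 \<mu> (\<lambda>k. U (r1 k))" .
  from L2_complete[OF finite_mu H10_gradD(1)[OF UG] r1(2)]
  obtain W0 where W0: "L2 \<mu> W0" "(\<lambda>k. norm2 \<mu> (\<lambda>x. U (r1 k) x - W0 x)) \<longlonglongrightarrow> 0" .
  from L2_complete[OF finite_mu H10_gradD(2)[OF UG] Cauchy_G[OF r1(2)]]
  obtain G0 where G0: "L2 \<mu> G0" "(\<lambda>k. norm2 \<mu> (\<lambda>x. G (r1 k) x - G0 x)) \<longlonglongrightarrow> 0" .
  from tendsto_norm2_AE_subseq[OF finite_mu H10_gradD(1)[OF UG] W0]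
  obtain r2 :: "nat \<Rightarrow> nat" where r2: "strict_mono r2" "AE x in \<mu>. (\<lambda>k. U (r1 (r2 k)) x) \<longlonglongrightarrow> W0 x" .
  define r where "r k = r1 (r2 k)" for k
  have r: "strict_mono r" using strict_mono_o[OF r1(1) r2(1)] by (simp add: r_def[abs_def] o_def)
  \<comment> \<open>The limits of functions and gradients come from completeness separately;
    closedness identifies the second as a gradient of the first.\<close>
  have W0G0: "H10_grad \<Omega> W0 G0" by (rule H10_grad_closed[OF UG W0(1) G0(1) W0(2) G0(2)])
  have "AE x in \<mu>. \<forall>k. 0 \<le> U (r k) x \<and> U (r k) x \<le> bnd (m (r k))"
    using U_bounds by (simp add: AE_all_countable)
  then have W001: "AE x in \<mu>. 0 \<le> W0 x \<and> W0 x \<le> 1"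
    using r2(2)
  proof eventually_elim
    case (elim x)
    have l: "(\<lambda>k. U (r k) x) \<longlonglongrightarrow> W0 x" using elim(2) by (simp add: r_def)
    have b: "(\<lambda>k. bnd (m (r k))) \<longlonglongrightarrow> 1" using LIMSEQ_subseq_LIMSEQ[OF bnd_tendsto r] by (simp add: o_def)
    have "0 \<le> W0 x" by (rule LIMSEQ_le_const[OF l]) (use elim(1) in auto)
    moreover have "W0 x \<le> 1" by (rule LIMSEQ_le[OF l b]) (use elim(1) in auto)
    ultimately show ?case by simp
  qed
  \<comment> \<open>\<open>W0\<close> lies in the unit interval only a.e.; clipping yields a
    representative with the bounds at every point, and neither its gradient nor the limits
    change.\<close>
  define W where "W x = max 0 (min (W0 x) 1)" for x
  have Wm: "W \<in> borel_measurable \<mu>" using L2_measurable[OF W0(1)] unfolding W_def by measurable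
  have WW0: "AE x in \<mu>. W0 x = W x" using W001 by eventually_elim (auto simp: W_def)
  have WG0: "H10_grad \<Omega> W G0" by (rule H10_grad_cong[OF W0G0 Wm WW0])
  have gW: "AE x in \<mu>. wgrad \<Omega> W x = G0 x" by (rule wgrad_eq[OF WG0])
  note HW = H10_wgrad[OF H10I[OF WG0]]
  have e1: "norm2 \<mu> (\<lambda>x. U k x - W0 x) = norm2 \<mu> (\<lambda>x. U k x - W x)" for k
    by (rule norm2_cong_AE) (use WW0 Wm U_measurable[of k] L2_measurable[OF W0(1)] in auto)
  have e2: "norm2 \<mu> (\<lambda>x. G k x - G0 x) = norm2 \<mu> (\<lambda>x. G k x - wgrad \<Omega> W x)" for k
    by (rule norm2_cong_AE)
      (use gW L2_measurable[OF H10_gradD(2)[OF HW]] L2_measurable[OF H10_gradD(2)[OF UG[of k]]] L2_measurable[OF G0(1)] in auto)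
  show ?thesis
  proof (rule that[OF r H10I[OF WG0]])
    show "0 \<le> W x \<and> W x \<le> 1" for x by (auto simp: W_def)
    show "(\<lambda>k. norm2 \<mu> (\<lambda>x. U (r k) x - W x)) \<longlonglongrightarrow> 0"
      using LIMSEQ_subseq_LIMSEQ[OF W0(2) r2(1)] by (simp add: o_def r_def e1)
    show "(\<lambda>k. norm2 \<mu> (\<lambda>x. G (r k) x - wgrad \<Omega> W x)) \<longlonglongrightarrow> 0"
      using LIMSEQ_subseq_LIMSEQ[OF G0(2) r2(1)] by (simp add: o_def r_def e2)
    show "AE x in \<mu>. (\<lambda>k. U (r k) x) \<longlonglongrightarrow> W x"
      using r2(2) WW0 by eventually_elim (simp add: r_def)
  qed
qed

end

section \<open>Passage to the limit\<close>

text \<open>The chosen subsequence is treated as a sequence of minimizers in its own right, so that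
  no subsequence indices appear in the limit arguments.\<close>

locale convergent_minimizer_sequence = minimizer_sequence \<Omega> M \<alpha> \<beta> lam p m U \<delta>
  for \<Omega> :: "(real^'n::finite) set" and M \<alpha> \<beta> lam p m U \<delta> +
  fixes W :: "real^'n \<Rightarrow> real"
  assumes HW: "H10 \<Omega> W" and W01: "\<And>x. 0 \<le> W x \<and> W x \<le> 1"
    and U_lim: "(\<lambda>k. norm2 \<mu> (\<lambda>x. U k x - W x)) \<longlonglongrightarrow> 0"
    and G_lim: "(\<lambda>k. norm2 \<mu> (\<lambda>x. G k x - wgrad \<Omega> W x)) \<longlonglongrightarrow> 0"
    and U_AE: "AE x in \<mu>. (\<lambda>k. U k x) \<longlonglongrightarrow> W x"
begin

abbreviation GW :: "real^'n \<Rightarrow> real^'n" where "GW \<equiv> wgrad \<Omega> W"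

lemma WG: "H10_grad \<Omega> W GW" by (rule H10_wgrad[OF HW])

lemma W_measurable: "W \<in> borel_measurable \<mu>" by (rule L2_measurable[OF H10_gradD(1)[OF WG]])

lemma W_le_Tb: "\<bar>W x\<bar> \<le> Tb" using W01[of x] Tb by auto

lemma U_AE_all: "AE x in \<mu>. (\<lambda>k. U k x) \<longlonglongrightarrow> W x \<and> (\<forall>k. 0 \<le> U k x \<and> U k x \<le> bnd (m k))"
proof -
  have "AE x in \<mu>. \<forall>k. 0 \<le> U k x \<and> U k x \<le> bnd (m k)" using U_bounds by (simp add: AE_all_countable)
  with U_AE show ?thesis by eventually_elim auto
qed

lemma form_G_tendsto:
  assumes "L2 \<mu> H" shows "(\<lambda>k. form (G k) H) \<longlonglongrightarrow> form GW H"
  by (rule form_tendsto[OF H10_gradD(2)[OF UG] H10_gradD(2)[OF WG] assms assms G_lim]) simp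

lemma pos_powr_eq: "pos_powr W x = W x powr (p - 1)" using W01[of x] by (simp add: pos_powr_def)

lemma pos_powr_W_L2: "L2 \<mu> (pos_powr W)" by (rule pos_powr_L2[OF W_measurable]) (use W_le_Tb in auto)

lemma pos_powr_U_L2: "L2 \<mu> (pos_powr (U k))" by (rule pos_powr_L2[OF U_measurable U_le_Tb])

lemma pos_powr_tendsto: "(\<lambda>k. norm2 \<mu> (\<lambda>x. pos_powr (U k) x - pos_powr W x)) \<longlonglongrightarrow> 0"
proof (rule norm2_tendsto_0_dominated[where g = "\<lambda>x. 2 * Tb powr (p - 1)"])
  show "(\<lambda>x. pos_powr (U k) x - pos_powr W x) \<in> borel_measurable \<mu>" for k
    by (rule L2_measurable[OF L2_diff[OF pos_powr_U_L2 pos_powr_W_L2]])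
  show "L2 \<mu> (\<lambda>x. 2 * Tb powr (p - 1))" by (rule L2_bounded[OF finite_mu, of _ "2 * Tb powr (p - 1)"]) auto
  show "AE x in \<mu>. (\<lambda>k. pos_powr (U k) x - pos_powr W x) \<longlonglongrightarrow> 0"
    using U_AE
  proof eventually_elim
    case (elim x)
    have "(\<lambda>k. pos_powr (U k) x) \<longlonglongrightarrow> pos_powr W x"
      unfolding pos_powr_def using p_gt by (intro tendsto_powr' tendsto_max elim tendsto_const) auto
    then show ?case by (rule LIM_zero)
  qed
  show "AE x in \<mu>. norm (pos_powr (U k) x - pos_powr W x) \<le> norm (2 * Tb powr (p - 1))" for k
    using U_le_Tb[of k]
  proof eventually_elim
    case (elim x)
    show ?case using pos_powr_bound[of "U k" x] pos_powr_bound[of W x] W_le_Tb[of x] elim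
        norm_triangle_ineq4[of "pos_powr (U k) x" "pos_powr W x"] by auto
  qed
qed

lemma pos_powr_ip2_tendsto:
  assumes "\<And>k. L2 \<mu> (v k)" "L2 \<mu> w" "(\<lambda>k. norm2 \<mu> (\<lambda>x. v k x - w x)) \<longlonglongrightarrow> 0"
  shows "(\<lambda>k. ip2 \<mu> (pos_powr (U k)) (v k)) \<longlonglongrightarrow> ip2 \<mu> (pos_powr W) w"
  by (rule tendsto_norm2_imp_tendsto_ip2[OF pos_powr_U_L2 pos_powr_W_L2 assms(1,2) pos_powr_tendsto assms(3)])

lemma ip2_F: "L2 \<mu> v \<Longrightarrow> ip2 \<mu> (F k) v = ip2 \<mu> (penalty k) v - lam * ip2 \<mu> (pos_powr (U k)) v"
proof -
  assume v: "L2 \<mu> v"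
  have "ip2 \<mu> (\<lambda>x. penalty k x - lam * pos_powr (U k) x) v = ip2 \<mu> (penalty k) v - ip2 \<mu> (\<lambda>x. lam * pos_powr (U k) x) v"
    by (rule ip2_diff_left[OF penalty_L2 L2_cmult[OF pos_powr_U_L2] v])
  then show ?thesis by (simp add: F_def hder_eq ip2_def mult.assoc)
qed

text \<open>The equation is solved for the pairing with the penalty; every other term converges by
  the strong limits, so the pairing converges although the penalty may have no pointwise
  limit.\<close>

lemma penalty_ip2_tendsto:
  assumes v: "H10_grad \<Omega> v H"
  shows "(\<lambda>k. ip2 \<mu> (penalty k) v) \<longlonglongrightarrow> lam * ip2 \<mu> (pos_powr W) v - form GW H"
proof -
  note D = H10_gradD[OF v]
  have "ip2 \<mu> (penalty k) v = lam * ip2 \<mu> (pos_powr (U k)) v - form (G k) H" for k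
    using EL[OF v, of k] ip2_F[OF D(1), of k] by simp
  moreover have "(\<lambda>k. lam * ip2 \<mu> (pos_powr (U k)) v - form (G k) H) \<longlonglongrightarrow> lam * ip2 \<mu> (pos_powr W) v - form GW H"
    by (intro tendsto_diff tendsto_mult tendsto_const pos_powr_ip2_tendsto form_G_tendsto D) simp
  ultimately show ?thesis by simp
qed

text \<open>Where the limit is below 1 the penalty terms decay geometrically, which yields the
  complementarity condition.\<close>
lemma penalty_complementarity: "(\<lambda>k. ip2 \<mu> (penalty k) (\<lambda>x. 1 - W x)) \<longlonglongrightarrow> 0"
proof -
  have "(\<lambda>k. \<integral>x. penalty k x * (1 - W x) \<partial>\<mu>) \<longlonglongrightarrow> (\<integral>x. 0 \<partial>\<mu>)"
  proof (rule integral_dominated_convergence[where w = "\<lambda>x. penalty_bnd 0"])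
    show "integrable \<mu> (\<lambda>x. penalty_bnd 0)" by (rule finite_measure.integrable_const[OF finite_mu])
    show "(\<lambda>x. penalty k x * (1 - W x)) \<in> borel_measurable \<mu>" for k
      using penalty_measurable[of k] W_measurable by measurable
    show "AE x in \<mu>. norm (penalty k x * (1 - W x)) \<le> penalty_bnd 0" for k
      using penalty_bound_0[of k]
    proof eventually_elim
      case (elim x)
      have "\<bar>penalty k x\<bar> * \<bar>1 - W x\<bar> \<le> penalty_bnd 0 * 1" using elim W01[of x] penalty_bnd_pos[of 0] by (intro mult_mono) auto
      then show ?case by (simp add: abs_mult)
    qed
    show "AE x in \<mu>. (\<lambda>k. penalty k x * (1 - W x)) \<longlonglongrightarrow> 0"
      using U_AE_all
    proof eventually_elim
      case (elim x)
      show ?case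
      proof (cases "W x = 1")
        case False
        \<comment> \<open>The midpoint between \<open>W x\<close> and 1: eventually
          \<open>U k x\<close> lies below it, and its powers with exponent m k - 1 tend to 0. At
          points with \<open>W x = 1\<close> the factor 1 - W vanishes instead.\<close>
        define \<rho> where "\<rho> = (1 + W x) / 2"
        have \<rho>: "0 < \<rho>" "\<rho> < 1" "W x < \<rho>" using W01[of x] False by (auto simp: \<rho>_def)
        have "filterlim (\<lambda>k. m k - 1) at_top sequentially"
          using filterlim_tendsto_add_at_top[OF tendsto_const[of "- 1"] m_lim] by simp
        from powr_at_top_tendsto_0[OF \<rho>(1,2) this]
        have "(\<lambda>k. \<rho> powr (m k - 1)) \<longlonglongrightarrow> 0" .
        moreover have "\<forall>\<^sub>F k in sequentially. norm (penalty k x) \<le> \<rho> powr (m k - 1)"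
          using order_tendstoD(2)[OF conjunct1[OF elim] \<rho>(3)]
        proof eventually_elim
          case (elim k)
          have "norm (penalty k x) \<le> \<bar>U k x\<bar> powr (m k - 1)" by (simp add: penalty_def abs_mult sgn_if)
          also have "\<dots> \<le> \<rho> powr (m k - 1)"
            using elim \<open>(\<lambda>k. U k x) \<longlonglongrightarrow> W x \<and> (\<forall>k. 0 \<le> U k x \<and> U k x \<le> bnd (m k))\<close> m_gt(2)[of k]
            by (intro powr_mono2) (auto simp: abs_of_nonneg)
          finally show ?case .
        qed
        ultimately have "(\<lambda>k. penalty k x) \<longlonglongrightarrow> 0" by (rule Lim_null_comparison[rotated])
        then show ?thesis by (rule tendsto_mult_left_zero)
      qed simp
    qed
  qed simp
  then show ?thesis by (simp add: ip2_def)
qed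

text \<open>The multiplier is the strong limit of convex combinations of penalties. Testing with
  H^1_0 functions identifies its equation. Complementarity requires a separate pairing with 1 - W,
  for which \<open>penalty_complementarity\<close> supplies the limit in place of the
  equation.\<close>

theorem reaction_limit:
  obtains g where "L2 \<mu> g" "\<And>x. 0 \<le> g x \<and> g x \<le> lam" "AE x in \<mu>. g x * (1 - W x) = 0"
    "\<And>v H. H10_grad \<Omega> v H \<Longrightarrow> form GW H + ip2 \<mu> g v = lam * ip2 \<mu> (pos_powr W) v"
proof -
  have nb: "norm2 \<mu> (penalty k) \<le> norm2 \<mu> (\<lambda>x. penalty_bnd 0)" for k
    by (rule norm2_le_const[OF finite_mu penalty_measurable penalty_bound_0])
  obtain h g0 where h: "\<And>n. h n \<in> mid_hull (penalty ` {n..})" and g0: "L2 \<mu> g0" "(\<lambda>n. norm2 \<mu> (\<lambda>x. h n x - g0 x)) \<longlonglongrightarrow> 0"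
  proof (rule bounded_L2_mid_hull_convergent[where M = \<mu> and f = penalty, OF finite_mu penalty_L2 nb])
    fix h g assume "\<And>n. h n \<in> mid_hull (penalty ` {n..})" "L2 \<mu> g" "(\<lambda>n. norm2 \<mu> (\<lambda>x. h n x - g x)) \<longlonglongrightarrow> 0"
    then show thesis by (rule that[of h g])
  qed
  have hL: "L2 \<mu> (h n)" for n by (rule L2_mid_hull[OF h]) (use penalty_L2 in auto)
  \<comment> \<open>A combination from the tail starting at n inherits the bound of index n because
    later bounds are no larger; its limit lam is sharp enough for the multiplier.\<close>
  have hb: "AE x in \<mu>. 0 \<le> h n x \<and> h n x \<le> penalty_bnd n" for n
  proof (rule mid_hull_AE_bounds[OF h])
    fix f assume "f \<in> penalty ` {n..}"
    then obtain k where k: "f = penalty k" "k \<ge> n" by auto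
    show "AE x in \<mu>. 0 \<le> f x \<and> f x \<le> penalty_bnd n"
      using penalty_bounds[of k] by eventually_elim (use penalty_bnd_antimono[OF k(2)] k(1) in auto)
  qed
  from tendsto_norm2_AE_subseq[OF finite_mu hL g0]
  obtain r :: "nat \<Rightarrow> nat" where r: "strict_mono r" "AE x in \<mu>. (\<lambda>k. h (r k) x) \<longlonglongrightarrow> g0 x" .
  have "AE x in \<mu>. \<forall>n. 0 \<le> h n x \<and> h n x \<le> penalty_bnd n" using hb by (simp add: AE_all_countable)
  then have g0b: "AE x in \<mu>. 0 \<le> g0 x \<and> g0 x \<le> lam"
    using r(2)
  proof eventually_elim
    case (elim x)
    have dl: "(\<lambda>k. penalty_bnd (r k)) \<longlonglongrightarrow> lam" using LIMSEQ_subseq_LIMSEQ[OF penalty_bnd_tendsto r(1)] by (simp add: o_def)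
    have "0 \<le> g0 x" by (rule LIMSEQ_le_const[OF elim(2)]) (use elim(1) in auto)
    moreover have "g0 x \<le> lam" by (rule LIMSEQ_le[OF elim(2) dl]) (use elim(1) in auto)
    ultimately show ?case by simp
  qed
  \<comment> \<open>Clipping again gives bounds at every point and alters the limit only on a null
    set.\<close>
  define g where "g x = max 0 (min (g0 x) lam)" for x
  have gm: "g \<in> borel_measurable \<mu>" using L2_measurable[OF g0(1)] unfolding g_def by measurable
  have gg0: "AE x in \<mu>. g x = g0 x" using g0b by eventually_elim (auto simp: g_def)
  have gL: "L2 \<mu> g" by (rule L2_cong_AE[OF g0(1) gm gg0])
  have gb: "0 \<le> g x \<and> g x \<le> lam" for x using lam_pos by (auto simp: g_def)
  have ip: "ip2 \<mu> g v = ip2 \<mu> g0 v" if "L2 \<mu> v" for v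
    unfolding ip2_def by (rule integral_cong_AE)
      (use gg0 L2_measurable[OF that] L2_measurable[OF gL] L2_measurable[OF g0(1)] in auto)
  have WL: "L2 \<mu> (\<lambda>x. 1 - W x)"
    by (rule L2_bounded[OF finite_mu, of _ 1]) (use W_measurable W01 in auto)
  have "ip2 \<mu> g (\<lambda>x. 1 - W x) = 0"
    using mid_hull_limit_ip2[OF penalty_L2 WL penalty_complementarity h g0] ip[OF WL] by simp
  moreover have "integrable \<mu> (\<lambda>x. g x * (1 - W x))" using integrable_inner_L2[OF gL WL] by simp
  ultimately have "AE x in \<mu>. g x * (1 - W x) = 0"
    using integral_nonneg_eq_0_iff_AE[of \<mu> "\<lambda>x. g x * (1 - W x)"] gb W01 by (simp add: ip2_def)
  moreover have "form GW H + ip2 \<mu> g v = lam * ip2 \<mu> (pos_powr W) v" if "H10_grad \<Omega> v H" for v H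
    using mid_hull_limit_ip2[OF penalty_L2 H10_gradD(1)[OF that] penalty_ip2_tendsto[OF that] h g0] ip[OF H10_gradD(1)[OF that]] by simp
  ultimately show ?thesis using gL gb by (intro that[of g]) auto
qed

text \<open>The term with exponent m is nonnegative and is dropped, so its limit never has to be
  identified; the two remaining terms converge by strong convergence of functions and
  gradients.\<close>

lemma energy_limit: "1/2 * form GW GW - lam / p * ip2 \<mu> (pos_powr W) W \<le> - \<delta>"
proof -
  have "1/2 * form (G k) (G k) - lam / p * ip2 \<mu> (pos_powr (U k)) (U k) \<le> - \<delta>" for k
  proof -
    note UL = minimizerD(1)[OF minU]
    have "- (lam / p * (pos_powr (U k) x * U k x)) \<le> hfun (m k) (U k x)" if "0 \<le> U k x" for x
    proof -
      have "pos_powr (U k) x * U k x = \<bar>max (U k x) 0\<bar> powr p"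
        using that p_gt powr_add[of "U k x" "p - 1" 1] by (cases "U k x = 0") (auto simp: pos_powr_def)
      moreover have "0 \<le> \<bar>U k x\<bar> powr m k / m k" using m_gt(2)[of k] by simp
      ultimately show ?thesis by (simp add: hfun_def)
    qed
    then have ae: "AE x in \<mu>. - (lam / p * (pos_powr (U k) x * U k x)) \<le> hfun (m k) (U k x)"
      using U_bounds[of k] by (auto elim!: eventually_mono)
    have i: "integrable \<mu> (\<lambda>x. pos_powr (U k) x * U k x)"
      using integrable_inner_L2[OF pos_powr_U_L2 H10_gradD(1)[OF UG], of k k] by simp
    have "(\<integral>x. - (lam / p * (pos_powr (U k) x * U k x)) \<partial>\<mu>) \<le> (\<integral>x. hfun (m k) (U k x) \<partial>\<mu>)"
      by (rule integral_mono_AE[OF _ integrable_hfun[OF UL m_gt(3)] ae]) (use i in auto)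
    then have "- (lam / p * ip2 \<mu> (pos_powr (U k)) (U k)) \<le> (\<integral>x. hfun (m k) (U k x) \<partial>\<mu>)"
      by (simp add: ip2_def)
    then show ?thesis using energy[of k] Jm_eq[OF UL UG m_gt(3), of k] by simp
  qed
  moreover have "(\<lambda>k. 1/2 * form (G k) (G k) - lam / p * ip2 \<mu> (pos_powr (U k)) (U k))
      \<longlonglongrightarrow> 1/2 * form GW GW - lam / p * ip2 \<mu> (pos_powr W) W"
    by (intro tendsto_diff tendsto_mult tendsto_const
        form_tendsto[OF H10_gradD(2)[OF UG] H10_gradD(2)[OF WG] H10_gradD(2)[OF UG] H10_gradD(2)[OF WG] G_lim G_lim]
        pos_powr_ip2_tendsto[OF H10_gradD(1)[OF UG] H10_gradD(1)[OF WG] U_lim])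
  ultimately show ?thesis by (intro LIMSEQ_le_const2) auto
qed

text \<open>A vanishing limit would leave only the nonnegative form in the limit energy,
  contradicting the bound -\<delta>.\<close>

lemma W_not_zero: "\<not> (AE x in \<mu>. W x = 0)"
proof
  assume "AE x in \<mu>. W x = 0"
  then have "ip2 \<mu> (pos_powr W) W = 0"
    unfolding ip2_def by (intro integral_eq_zero_AE) (auto elim!: eventually_mono)
  then show False using energy_limit form_nonneg[OF H10_gradD(2)[OF WG]] \<delta>_pos by simp
qed

lemma reaction_not_zero:
  assumes eq: "form GW GW + ip2 \<mu> g W = lam * ip2 \<mu> (pos_powr W) W"
  shows "\<not> (AE x in \<mu>. g x = 0)"
proof
  assume "AE x in \<mu>. g x = 0"
  then have "ip2 \<mu> g W = 0"
    unfolding ip2_def by (intro integral_eq_zero_AE) (auto elim!: eventually_mono)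
  with eq have e: "form GW GW = lam * ip2 \<mu> (pos_powr W) W" by simp
  have "ip2 \<mu> (pos_powr W) W \<ge> 0" unfolding ip2_def using W01 by (intro integral_nonneg_AE) (auto simp: pos_powr_def)
  then have "lam / p * ip2 \<mu> (pos_powr W) W \<le> lam / 2 * ip2 \<mu> (pos_powr W) W"
    using lam_pos p_gt by (intro mult_right_mono divide_left_mono) auto
  then show False using energy_limit \<delta>_pos unfolding e by simp
qed

text \<open>A.e. convergence together with the common bound \<open>Tb\<close> on a set of finite
  measure gives all finite exponents by dominated convergence.\<close>

lemma Lq_convergence:
  assumes q: "1 \<le> q" shows "Lq_conv \<Omega> q U W"
  unfolding Lq_conv_def set_integral_eq
proof (intro conjI allI)
  have bd: "integrable \<mu> (\<lambda>x. \<bar>f x\<bar> powr q)" if f: "f \<in> borel_measurable \<mu>" "AE x in \<mu>. \<bar>f x\<bar> \<le> Tb" for f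
  proof (rule Bochner_Integration.integrable_bound)
    show "integrable \<mu> (\<lambda>x. Tb powr q)" by (rule finite_measure.integrable_const[OF finite_mu])
    show "(\<lambda>x. \<bar>f x\<bar> powr q) \<in> borel_measurable \<mu>" using f(1) by measurable
    show "AE x in \<mu>. norm (\<bar>f x\<bar> powr q) \<le> norm (Tb powr q)"
      using f(2) by eventually_elim (use q in \<open>auto intro!: powr_mono2\<close>)
  qed
  show "Lp \<Omega> q (U k)" for k unfolding Lp_iff using U_measurable bd[OF U_measurable U_le_Tb] by blast
  show "Lp \<Omega> q W" unfolding Lp_iff using W_measurable bd[OF W_measurable] W_le_Tb by simp
  have "(\<lambda>k. \<integral>x. \<bar>U k x - W x\<bar> powr q \<partial>\<mu>) \<longlonglongrightarrow> (\<integral>x. 0 \<partial>\<mu>)"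
  proof (rule integral_dominated_convergence[where w = "\<lambda>x. (2 * Tb) powr q"])
    show "integrable \<mu> (\<lambda>x. (2 * Tb) powr q)" by (rule finite_measure.integrable_const[OF finite_mu])
    show "(\<lambda>x. \<bar>U k x - W x\<bar> powr q) \<in> borel_measurable \<mu>" for k
      using U_measurable[of k] W_measurable by measurable
    show "AE x in \<mu>. norm (\<bar>U k x - W x\<bar> powr q) \<le> (2 * Tb) powr q" for k
      using U_le_Tb[of k]
    proof eventually_elim
      case (elim x)
      have "\<bar>U k x - W x\<bar> \<le> 2 * Tb" using elim W_le_Tb[of x] by linarith
      then show ?case using q by (auto intro!: powr_mono2)
    qed
    show "AE x in \<mu>. (\<lambda>k. \<bar>U k x - W x\<bar> powr q) \<longlonglongrightarrow> 0"
      using U_AE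
    proof eventually_elim
      case (elim x)
      have "(\<lambda>k. \<bar>U k x - W x\<bar> powr q) \<longlonglongrightarrow> \<bar>W x - W x\<bar> powr q"
        using q by (intro tendsto_powr' tendsto_rabs tendsto_diff elim tendsto_const) auto
      then show ?case by simp
    qed
  qed simp
  then show "(\<lambda>k. \<integral>x. \<bar>U k x - W x\<bar> powr q \<partial>\<mu>) \<longlonglongrightarrow> 0" by simp
qed

lemma weak_convergence: "H10_weak_conv \<Omega> U W"
  unfolding H10_weak_conv_def set_integral_eq
proof (intro conjI allI impI)
  fix v assume "H10 \<Omega> v"
  note V = H10_gradD[OF H10_wgrad[OF this]]
  have split: "(\<integral>x. f x * v x + Gf x \<bullet> wgrad \<Omega> v x \<partial>\<mu>) = ip2 \<mu> f v + ip2 \<mu> Gf (wgrad \<Omega> v)" if "H10_grad \<Omega> f Gf" for f Gf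
    unfolding ip2_def
    using integrable_inner_L2[OF H10_gradD(1)[OF that] V(1)] integrable_inner_L2[OF H10_gradD(2)[OF that] V(2)] by simp
  have z: "(\<lambda>k. norm2 \<mu> (\<lambda>x. f x - f x)) \<longlonglongrightarrow> 0" for f :: "real^'n \<Rightarrow> 'b::euclidean_space" by simp
  show "(\<lambda>k. \<integral>x. U k x * v x + G k x \<bullet> wgrad \<Omega> v x \<partial>\<mu>) \<longlonglongrightarrow> (\<integral>x. W x * v x + GW x \<bullet> wgrad \<Omega> v x \<partial>\<mu>)"
    unfolding split[OF UG] split[OF WG]
    by (intro tendsto_add tendsto_norm2_imp_tendsto_ip2[OF H10_gradD(1)[OF UG] H10_gradD(1)[OF WG] V(1) V(1) U_lim z]
        tendsto_norm2_imp_tendsto_ip2[OF H10_gradD(2)[OF UG] H10_gradD(2)[OF WG] V(2) V(2) G_lim z])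
qed (use HW H10I[OF UG] in auto)

end

section \<open>Obstacle problem and multiplier for the limit\<close>

theorem theorem4p1:
  fixes \<Omega> :: "(real^'n::finite) set" and M :: "(real^'n) \<Rightarrow> real^'n^'n"
    and \<alpha> \<beta> p lam m0 \<delta> :: real and u :: "real \<Rightarrow> (real^'n) \<Rightarrow> real"
  assumes dom: "open \<Omega>" "connected \<Omega>" "bounded \<Omega>" "\<Omega> \<noteq> {}"
    and ell: "elliptic_matrix \<Omega> M \<alpha> \<beta>"
    and p: "p > 2"
    and lam: "lam > lambda1 \<Omega> \<beta> p"
    and m0_crit: "CARD('n) \<ge> 3 \<Longrightarrow> m0 > 2 * real CARD('n) / (real CARD('n) - 2)"
    and m0_p: "m0 \<ge> p"
    and \<delta>: "\<delta> > 0"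
    and min: "\<And>m. m \<ge> m0 \<Longrightarrow> Xm \<Omega> m (u m) \<and> (AE x\<in>\<Omega> in lebesgue. u m x \<ge> 0)
                 \<and> (\<forall>v. Xm \<Omega> m v \<longrightarrow> Jm \<Omega> M lam p m (u m) \<le> Jm \<Omega> M lam p m v)
                 \<and> Jm \<Omega> M lam p m (u m) \<le> - \<delta>"
  shows "\<exists>w s. H10 \<Omega> w \<and> Linf \<Omega> w \<and> \<not> ae_zero \<Omega> w
     \<and> (\<forall>k. s k \<ge> m0) \<and> strict_mono s \<and> filterlim s at_top sequentially
     \<and> H10_weak_conv \<Omega> (\<lambda>k. u (s k)) w
     \<and> (\<forall>q. 1 \<le> q \<longrightarrow> Lq_conv \<Omega> q (\<lambda>k. u (s k)) w)
     \<and> Kset \<Omega> w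
     \<and> (\<forall>v. Kset \<Omega> v \<longrightarrow>
          aform \<Omega> M w (\<lambda>x. v x - w x) \<ge> lam * (\<integral>x\<in>\<Omega>. w x powr (p - 1) * (v x - w x) \<partial>lebesgue))
     \<and> (\<exists>g. Linf \<Omega> g \<and> (AE x\<in>\<Omega> in lebesgue. 0 \<le> g x \<and> g x \<le> lam) \<and> \<not> ae_zero \<Omega> g
          \<and> (AE x\<in>\<Omega> in lebesgue. g x * (1 - w x) = 0)
          \<and> emeasure lebesgue {x\<in>\<Omega>. w x = 1} > 0
          \<and> (\<forall>\<phi>. H10 \<Omega> \<phi> \<longrightarrow>
               aform \<Omega> M w \<phi> + (\<integral>x\<in>\<Omega>. g x * \<phi> x \<partial>lebesgue)
                 = lam * (\<integral>x\<in>\<Omega>. w x powr (p - 1) * \<phi> x \<partial>lebesgue)))"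
proof -
  interpret elliptic_domain \<Omega> M \<alpha> \<beta> by unfold_locales (use dom ell in auto)
  \<comment> \<open>Taken from the energy at m0: with lam \<le> 0 all three terms of the energy
    would be nonnegative, against the bound -\<delta>.\<close>
  have lam_pos: "lam > 0"
  proof (rule ccontr)
    assume "\<not> lam > 0"
    then have "lam / p * pnorm_pow \<Omega> p (\<lambda>x. max (u m0 x) 0) \<le> 0"
      using p by (intro mult_nonpos_nonneg divide_nonpos_pos)
        (auto simp: pnorm_pow_def set_integral_eq intro!: integral_nonneg_AE)
    moreover have "0 \<le> 1 / m0 * pnorm_pow \<Omega> m0 (u m0)"
      using p m0_p by (intro mult_nonneg_nonneg) (auto simp: pnorm_pow_def set_integral_eq intro!: integral_nonneg_AE)
    moreover have "H10_grad \<Omega> (u m0) (wgrad \<Omega> (u m0))" using min[of m0] by (auto simp: Xm_def H10_wgrad)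
    then have "0 \<le> aform \<Omega> M (u m0) (u m0)" using aform_eq form_nonneg H10_gradD(2) by metis
    ultimately show False using min[of m0] \<delta> unfolding Jm_def by auto
  qed
  interpret variational_problem \<Omega> M \<alpha> \<beta> lam p by unfold_locales (use p lam_pos in auto)
  \<comment> \<open>The shift by 1 beyond m0 \<ge> p secures m k \<ge> p + 1.\<close>
  define m where "m k = m0 + 1 + real k" for k
  have m_lim: "filterlim m at_top sequentially"
    unfolding m_def by (rule filterlim_tendsto_add_at_top[OF tendsto_const filterlim_real_sequentially])
  have m_sm: "strict_mono m" unfolding m_def strict_mono_def by simp
  have mge: "m k \<ge> m0" for k by (simp add: m_def)
  have minm: "minimizer (m k) (u (m k))" "Jm \<Omega> M lam p (m k) (u (m k)) \<le> - \<delta>" for k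
    using min[OF mge[of k]] by (auto simp: minimizer_def AE_dom_iff)
  interpret S: minimizer_sequence \<Omega> M \<alpha> \<beta> lam p m "\<lambda>k. u (m k)" \<delta>
    by unfold_locales (use minm m0_p m_lim strict_mono_mono[OF m_sm] \<delta> in \<open>auto simp: m_def\<close>)
  obtain r W where r: "strict_mono r" and W: "H10 \<Omega> W" "\<And>x. 0 \<le> W x \<and> W x \<le> 1"
    "(\<lambda>k. norm2 \<mu> (\<lambda>x. u (m (r k)) x - W x)) \<longlonglongrightarrow> 0"
    "(\<lambda>k. norm2 \<mu> (\<lambda>x. wgrad \<Omega> (u (m (r k))) x - wgrad \<Omega> W x)) \<longlonglongrightarrow> 0"
    "AE x in \<mu>. (\<lambda>k. u (m (r k)) x) \<longlonglongrightarrow> W x"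
    by (rule S.strong_limit) blast
  define s where "s k = m (r k)" for k
  have s_sm: "strict_mono s" using strict_mono_o[OF m_sm r] by (simp add: s_def[abs_def] o_def)
  have s_lim: "filterlim s at_top sequentially"
    unfolding s_def by (rule filterlim_compose[OF m_lim filterlim_subseq[OF r]])
  \<comment> \<open>The exponents along the subsequence form an admissible sequence again, so the
    limit results apply to it directly.\<close>
  interpret C: convergent_minimizer_sequence \<Omega> M \<alpha> \<beta> lam p s "\<lambda>k. u (s k)" \<delta> W
    by unfold_locales (use minm m0_p s_lim strict_mono_mono[OF s_sm] \<delta> W in \<open>auto simp: s_def m_def\<close>)
  obtain g where g: "L2 \<mu> g" "\<And>x. 0 \<le> g x \<and> g x \<le> lam" "AE x in \<mu>. g x * (1 - W x) = 0"
    and eq: "\<And>v H. H10_grad \<Omega> v H \<Longrightarrow> form (wgrad \<Omega> W) H + ip2 \<mu> g v = lam * ip2 \<mu> (C.pos_powr W) v"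
    by (rule C.reaction_limit) blast
  have g_nz: "\<not> (AE x in \<mu>. g x = 0)" by (rule C.reaction_not_zero[OF eq[OF C.WG]])
  have bW: "ip2 \<mu> (C.pos_powr W) v = (\<integral>x\<in>\<Omega>. W x powr (p - 1) * v x \<partial>lebesgue)" for v
    by (simp add: set_integral_eq ip2_def C.pos_powr_eq)
  have VI: "aform \<Omega> M W (\<lambda>x. v x - W x) \<ge> lam * (\<integral>x\<in>\<Omega>. W x powr (p - 1) * (v x - W x) \<partial>lebesgue)" if "Kset \<Omega> v" for v
  proof -
    have v: "H10_grad \<Omega> v (wgrad \<Omega> v)" "AE x in \<mu>. 0 \<le> v x \<and> v x \<le> 1"
      using that by (auto simp: Kset_def AE_dom_iff H10_wgrad)
    note D = H10_grad_diff[OF v(1) C.WG]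
    have "AE x in \<mu>. g x * (v x - W x) \<le> 0"
      using v(2) g(3)
    proof eventually_elim
      case (elim x)
      have "g x * (v x - W x) = g x * (v x - 1) + g x * (1 - W x)" by (simp add: algebra_simps)
      moreover have "g x * (v x - 1) \<le> 0" using elim(1) g(2)[of x] by (intro mult_nonneg_nonpos) auto
      ultimately show ?case using elim(2) by linarith
    qed
    then have "AE x in \<mu>. 0 \<le> - (g x * (v x - W x))" by eventually_elim simp
    then have "0 \<le> (\<integral>x. - (g x * (v x - W x)) \<partial>\<mu>)" by (rule integral_nonneg_AE)
    then have "ip2 \<mu> g (\<lambda>x. v x - W x) \<le> 0" by (simp add: ip2_def)
    then show ?thesis using eq[OF D] unfolding aform_eq[OF C.WG D] bW by linarith
  qed
  have EQ: "aform \<Omega> M W \<phi> + (\<integral>x\<in>\<Omega>. g x * \<phi> x \<partial>lebesgue) = lam * (\<integral>x\<in>\<Omega>. W x powr (p - 1) * \<phi> x \<partial>lebesgue)"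
    if "H10 \<Omega> \<phi>" for \<phi>
    using eq[OF H10_wgrad[OF that]] aform_eq[OF C.WG H10_wgrad[OF that]] bW[of \<phi>]
    by (simp add: set_integral_eq ip2_def)
  \<comment> \<open>If the contact set were null, complementarity would force g = 0 a.e., which the
    energy bound has already excluded.\<close>
  have pos: "emeasure lebesgue {x\<in>\<Omega>. W x = 1} > 0"
  proof (rule ccontr)
    assume "\<not> emeasure lebesgue {x\<in>\<Omega>. W x = 1} > 0"
    then have z: "emeasure lebesgue {x\<in>\<Omega>. W x = 1} = 0" by simp
    have "{x \<in> space \<mu>. W x = 1} \<in> sets \<mu>" using C.W_measurable by measurable
    then have "{x\<in>\<Omega>. W x = 1} \<in> sets lebesgue"
      using sets_dom by (auto simp: sets_restrict_space_iff space_restrict_space)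
    with z have "AE x in lebesgue. x \<notin> {x\<in>\<Omega>. W x = 1}" by (intro AE_not_in) (auto simp: null_sets_def)
    then have "AE x\<in>\<Omega> in lebesgue. W x \<noteq> 1" by eventually_elim auto
    then have "AE x in \<mu>. W x \<noteq> 1" by (simp only: AE_dom_iff)
    then have "AE x in \<mu>. g x = 0" using g(3) by eventually_elim auto
    with g_nz show False by simp
  qed
  have bounded_Linf: "Linf \<Omega> f" if "f \<in> borel_measurable \<mu>" "\<And>x. 0 \<le> f x \<and> f x \<le> c" for f c
    unfolding Linf_def set_borel_measurable_iff AE_dom_iff using that by (auto intro!: exI[of _ c])
  have "Linf \<Omega> W" by (rule bounded_Linf[OF C.W_measurable W(2)])
  moreover have "Linf \<Omega> g" by (rule bounded_Linf[OF L2_measurable[OF g(1)] g(2)])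
  moreover have "Kset \<Omega> W" using W(1,2) by (simp add: Kset_def)
  ultimately show ?thesis
    using W(1) C.W_not_zero s_sm s_lim C.weak_convergence C.Lq_convergence VI g g_nz pos EQ mge
    unfolding ae_zero_def AE_dom_iff
    by (intro exI[of _ W] exI[of _ s] conjI allI impI exI[of _ g]) (auto simp: s_def)
qed

end
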